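(* Let $\mathcal H$ be a complex separable Hilbert space, $H_0$ a self-adjoint operator in $\mathcal H$ with domain $\operatorname{dom}(H_0)$, $J$ a bounded self-adjoint operator on $\mathcal H$ with $J^2=I_{\mathcal H}$, $K\in\mathcal B_2(\mathcal H)$ a Hilbert-Schmidt operator, $V=KJK^*$, and $H=H_0+V$ with $\operatorname{dom}(H)=\operatorname{dom}(H_0)$. Let $\Xi_\pm(\lambda)$ be the spectral shift operators in $\mathcal H_\pm$ defined in the context and set $$\xi(\lambda)=\operatorname{tr}_{\mathcal H_+}(\Xi_+(\lambda))-\operatorname{tr}_{\mathcal H_-}(\Xi_-(\lambda))\quad\text{for a.e. }\lambda\in\mathbb R.$$ Then for all $z\in\mathbb C\setminus\{\operatorname{spec}(H_0)\cup\operatorname{spec}(H)\}$, $$\operatorname{tr}_{\mathcal H}\big((H-z)^{-1}-(H_0-z)^{-1}\big)=-\int_{\mathbb R}d\lambda\,\xi(\lambda)(\lambda-z)^{-2}.$$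
   Context: $\mathcal B(\cdot),\mathcal B_1(\cdot),\mathcal B_2(\cdot)$ denote bounded, trace class and Hilbert-Schmidt operators; $\|\cdot\|_1$ is the trace norm; $\operatorname{spec}(\cdot)$ is the spectrum; $\mathbb C_+$ is the open upper half-plane; $\operatorname{Im}(T)=(T-T^* )/(2i)$. Decomposition: $J_\pm=(I_{\mathcal H}\pm J)/2$ are orthogonal projections, $J=J_+-J_-$, $\mathcal H_\pm=\operatorname{ran}(J_\pm)$, $\mathcal H=\mathcal H_+\oplus\mathcal H_-$, and $I_\pm$ is the identity in $\mathcal H_\pm$. Put $V_+=KJ_+K^*$, $H_+=H_0+V_+$ with $\operatorname{dom}(H_+)=\operatorname{dom}(H_0)$. For $z\in\mathbb C\setminus\mathbb R$ define $$\Phi_+(z)=I_++J_+K^*(H_0-z)^{-1}K|_{\mathcal H_+}\in\mathcal B(\mathcal H_+),\qquad \widetilde\Phi_-(z)=I_--J_-K^*(H_+-z)^{-1}K|_{\mathcal H_-}\in\mathcal B(\mathcal H_-).$$ These are boundedly invertible, with $\operatorname{Im}(\Phi_+(z))\ge0$ and $\operatorname{Im}(\widetilde\Phi_-(z))\le0$ for $z\in\mathbb C_+$ (and reversed signs for $\operatorname{Im}(z)<0$). Logarithm: for a bounded, boundedly invertible $T$ with $\operatorname{Im}(T)\ge0$, $\log(T)=-i\int_0^\infty d\lambda\,((T+i\lambda)^{-1}-(1+i\lambda)^{-1}I)$ (norm convergent Riemann integral); for a bounded, boundedly invertible $S$ with $\operatorname{Im}(S)\le0$, $\log(S)=(\log(S^*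 ))^*$. Spectral shift operators: $\{\Xi_\pm(\lambda)\}_{\lambda\in\mathbb R}$ are the (a.e. defined, weakly measurable) families of operators with $0\le\Xi_\pm(\lambda)\le I_\pm$, $\Xi_\pm(\lambda)\in\mathcal B_1(\mathcal H_\pm)$ for a.e. $\lambda$, $\|\Xi_\pm(\cdot)\|_1\in L^1(\mathbb R;(1+\lambda^2)^{-1}d\lambda)$, such that for $z\in\mathbb C\setminus\mathbb R$, with some $C_\pm=C_\pm^*\in\mathcal B_1(\mathcal H_\pm)$ and integrals in the weak sense, $$\log(\Phi_+(z))=C_++\int_{\mathbb R}d\lambda\,\Xi_+(\lambda)\big((\lambda-z)^{-1}-\lambda(1+\lambda^2)^{-1}\big),$$ $$\log(\widetilde\Phi_-(z))=C_--\int_{\mathbb R}d\lambda\,\Xi_-(\lambda)\big((\lambda-z)^{-1}-\lambda(1+\lambda^2)^{-1}\big).$$ Such families exist and are unique up to a.e. equality.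
   Formalization: For real z outside both spectra the integral can diverge (H=C, H_0=0, J=K=1, z=1/2), so there the equation is asserted only when the integral converges absolutely; in addition, for every such real z, it is proved as the limit of the integrals at z+iε as ε→0. *)

theory Defs
  imports "HOL-Analysis.Analysis"
begin

section \<open>Complex Hilbert spaces\<close>

text \<open>The real inner product, norm and topology are those of the library; the complex inner product
  is antilinear in the first and linear in the second argument. Positive definiteness is inherited
  from the real inner product, which is its real part.\<close>

class complex_hilbert_space = real_inner + complete_space +
  fixes scaleC :: "complex \<Rightarrow> 'a \<Rightarrow> 'a"  (infixr \<open>*\<^sub>C\<close> 75)
    and cinner :: "'a \<Rightarrow> 'a \<Rightarrow> complex"
  assumes scaleC_add_right: "a *\<^sub>C (x + y) = a *\<^sub>C x + a *\<^sub>C y"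
    and scaleC_add_left: "(a + b) *\<^sub>C x = a *\<^sub>C x + b *\<^sub>C x"
    and scaleC_scaleC: "a *\<^sub>C (b *\<^sub>C x) = (a * b) *\<^sub>C x"
    and scaleC_of_real: "complex_of_real r *\<^sub>C x = r *\<^sub>R x"
    and cinner_commute: "cinner x y = cnj (cinner y x)"
    and cinner_add_right: "cinner x (y + z) = cinner x y + cinner x z"
    and cinner_scaleC_right: "cinner x (a *\<^sub>C y) = a * cinner x y"
    and Re_cinner: "Re (cinner x y) = inner x y"

instantiation complex :: complex_hilbert_space
begin

definition scaleC_complex :: "complex \<Rightarrow> complex \<Rightarrow> complex"
  where "scaleC_complex a x = a * x"

definition cinner_complex :: "complex \<Rightarrow> complex \<Rightarrow> complex"
  where "cinner_complex x y = cnj x * y"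

instance
  by standard
    (simp_all add: scaleC_complex_def cinner_complex_def algebra_simps scaleR_conv_of_real
      inner_complex_def)

end

lemma scaleC_one [simp]: "1 *\<^sub>C x = (x :: 'a::complex_hilbert_space)"
  using scaleC_of_real[of 1 x] by simp

global_interpretation complex_vector:
  vector_space "scaleC :: complex \<Rightarrow> 'a \<Rightarrow> 'a::complex_hilbert_space"
  by standard (simp_all add: scaleC_add_right scaleC_add_left scaleC_scaleC)

lemma cinner_self: "cinner x x = complex_of_real ((norm x)\<^sup>2)"
  for x :: "'a::complex_hilbert_space"
proof (rule complex_eqI)
  show "Re (cinner x x) = Re (complex_of_real ((norm x)\<^sup>2))"
    by (simp add: Re_cinner power2_norm_eq_inner)
  have "Im (cinner x x) = - Im (cinner x x)"
    by (metis cinner_commute cnj.sel(2))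
  then show "Im (cinner x x) = Im (complex_of_real ((norm x)\<^sup>2))"
    by simp
qed

lemma cinner_scaleC_left: "cinner (a *\<^sub>C x) y = cnj a * cinner x y"
  for x :: "'a::complex_hilbert_space"
  by (metis cinner_commute cinner_scaleC_right complex_cnj_mult)

lemma norm_scaleC: "norm (a *\<^sub>C x) = cmod a * norm x"
  for x :: "'a::complex_hilbert_space"
proof -
  have "complex_of_real ((norm (a *\<^sub>C x))\<^sup>2) = (a * cnj a) * cinner x x"
    unfolding cinner_self[symmetric] cinner_scaleC_left cinner_scaleC_right by simp
  also have "\<dots> = complex_of_real ((cmod a * norm x)\<^sup>2)"
    by (simp only: cinner_self complex_norm_square[symmetric] power_mult_distrib of_real_mult)
  finally have "(norm (a *\<^sub>C x))\<^sup>2 = (cmod a * norm x)\<^sup>2"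
    using of_real_eq_iff by blast
  then show ?thesis
    by (simp add: power2_eq_iff_nonneg)
qed

lemma bounded_linear_scaleC: "bounded_linear (\<lambda>x. a *\<^sub>C (x :: 'a::complex_hilbert_space))"
proof (rule bounded_linear_intro[where K = "cmod a"])
  fix r :: real and x y :: 'a
  show "a *\<^sub>C (x + y) = a *\<^sub>C x + a *\<^sub>C y"
    by (rule scaleC_add_right)
  show "a *\<^sub>C (r *\<^sub>R x) = r *\<^sub>R (a *\<^sub>C x)"
    by (simp only: scaleC_of_real[symmetric] scaleC_scaleC mult.commute)
  show "norm (a *\<^sub>C x) \<le> norm x * cmod a"
    by (simp add: norm_scaleC)
qed


section \<open>Bounded operators\<close>

text \<open>The elements of \<open>'a \<Rightarrow>\<^sub>L 'a\<close> are real-linear; complex linearity is the predicate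
  \<open>clinear_op\<close>.\<close>

type_synonym 'a oper = "'a \<Rightarrow>\<^sub>L 'a"

definition clinear_op :: "'a::complex_hilbert_space oper \<Rightarrow> bool"
  where "clinear_op T \<longleftrightarrow> (\<forall>c x. T (c *\<^sub>C x) = c *\<^sub>C T x)"

lift_definition scale_op :: "complex \<Rightarrow> 'a::complex_hilbert_space oper \<Rightarrow> 'a oper"  (infixr \<open>*\<^sub>O\<close> 75)
  is "\<lambda>c T x. c *\<^sub>C T x"
  by (rule bounded_linear_compose[OF bounded_linear_scaleC])

definition adj :: "'a::complex_hilbert_space oper \<Rightarrow> 'a oper"
  where "adj T = (THE S :: 'a oper. \<forall>x y. cinner (S x) y = cinner x (T y))"

definition Im_op :: "'a::complex_hilbert_space oper \<Rightarrow> 'a oper"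
  where "Im_op T = (1 / (2 * \<i>)) *\<^sub>O (T - adj T)"

definition positive_op :: "'a::complex_hilbert_space oper \<Rightarrow> bool"
  where "positive_op T \<longleftrightarrow> clinear_op T \<and> (\<forall>x. cinner x (T x) \<in> \<real>\<^sub>\<ge>\<^sub>0)"

definition abs_op :: "'a::complex_hilbert_space oper \<Rightarrow> 'a oper"
  where "abs_op T = (THE S. positive_op S \<and> S o\<^sub>L S = adj T o\<^sub>L T)"


section \<open>Operators in a closed subspace, Schatten classes and trace\<close>

text \<open>Let \<open>P\<close> be an orthogonal projection. An operator in the Hilbert space \<open>ran P\<close> is represented
  by its extension by zero to the orthogonal complement of \<open>ran P\<close>; the identity of \<open>ran P\<close> is then
  represented by \<open>P\<close>. Adjoints, absolute values and positivity do not depend on whether they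
  are taken in \<open>ran P\<close> or for the extension; inverse, logarithm and trace refer to \<open>P\<close> explicitly.
  The whole space is the case \<open>P = id_blinfun\<close>.\<close>

definition oper_in :: "'a::complex_hilbert_space oper \<Rightarrow> 'a oper \<Rightarrow> bool"
  where "oper_in P T \<longleftrightarrow> clinear_op T \<and> P o\<^sub>L T o\<^sub>L P = T"

definition is_onb :: "'a::complex_hilbert_space set \<Rightarrow> 'a set \<Rightarrow> bool"
  where "is_onb M B \<longleftrightarrow>
    (\<forall>e\<in>B. \<forall>f\<in>B. cinner e f = (if e = f then 1 else 0)) \<and> closure (complex_vector.span B) = M"

definition hilbert_schmidt :: "'a::complex_hilbert_space oper \<Rightarrow> bool"
  where "hilbert_schmidt T \<longleftrightarrow>
    clinear_op T \<and> (\<exists>B. is_onb UNIV B \<and> (\<lambda>e. (norm (T e))\<^sup>2) summable_on B)"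

definition trace_class :: "'a::complex_hilbert_space oper \<Rightarrow> 'a oper \<Rightarrow> bool"
  where "trace_class P T \<longleftrightarrow>
    oper_in P T \<and> (\<exists>B. is_onb (range P) B \<and> (\<lambda>e. cinner e (abs_op T e)) summable_on B)"

text \<open>For a trace class operator the following sum does not depend on the chosen basis.\<close>

definition op_trace :: "'a::complex_hilbert_space oper \<Rightarrow> 'a oper \<Rightarrow> complex"
  where "op_trace P T = (\<Sum>\<^sub>\<infinity>e\<in>(SOME B. is_onb (range P) B). cinner e (T e))"

definition trace_norm :: "'a::complex_hilbert_space oper \<Rightarrow> 'a oper \<Rightarrow> real"
  where "trace_norm P T = Re (op_trace P (abs_op T))"


section \<open>Inverse and logarithm\<close>

definition inverse_in :: "'a::complex_hilbert_space oper \<Rightarrow> 'a oper \<Rightarrow> 'a oper"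
  where "inverse_in P T = (THE S. oper_in P S \<and> S o\<^sub>L T = P \<and> T o\<^sub>L S = P)"

text \<open>The integral is taken with respect to the operator norm.\<close>

definition log_upper :: "'a::complex_hilbert_space oper \<Rightarrow> 'a oper \<Rightarrow> 'a oper"
  where "log_upper P T = (- \<i>) *\<^sub>O
    integral {0..} (\<lambda>t::real. inverse_in P (T + (\<i> * t) *\<^sub>O P) - (1 / (1 + \<i> * t)) *\<^sub>O P)"

text \<open>The second branch is meant for operators with nonpositive imaginary part.\<close>

definition log_in :: "'a::complex_hilbert_space oper \<Rightarrow> 'a oper \<Rightarrow> 'a oper"
  where "log_in P T = (if positive_op (Im_op T) then log_upper P T else adj (log_upper P (adj T)))"


section \<open>Unbounded operators\<close>

text \<open>An unbounded operator is a domain \<open>D\<close> together with a function of which only the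
  values on \<open>D\<close> matter. It is self-adjoint if its graph is the graph of its adjoint.\<close>

definition adjoint_graph :: "'a::complex_hilbert_space set \<Rightarrow> ('a \<Rightarrow> 'a) \<Rightarrow> ('a \<times> 'a) set"
  where "adjoint_graph D A = {(y, w). \<forall>x\<in>D. cinner y (A x) = cinner w x}"

definition self_adjoint_on :: "'a::complex_hilbert_space set \<Rightarrow> ('a \<Rightarrow> 'a) \<Rightarrow> bool"
  where "self_adjoint_on D A \<longleftrightarrow>
    complex_vector.subspace D \<and> closure D = UNIV \<and>
    (\<forall>x\<in>D. \<forall>y\<in>D. A (x + y) = A x + A y) \<and> (\<forall>c. \<forall>x\<in>D. A (c *\<^sub>C x) = c *\<^sub>C A x) \<and>
    adjoint_graph D A = {(x, A x) | x. x \<in> D}"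

definition spec :: "'a::complex_hilbert_space set \<Rightarrow> ('a \<Rightarrow> 'a) \<Rightarrow> complex set"
  where "spec D A = - {z. bij_betw (\<lambda>x. A x - z *\<^sub>C x) D UNIV \<and>
                          bounded_linear (inv_into D (\<lambda>x. A x - z *\<^sub>C x))}"

definition resolvent :: "'a::complex_hilbert_space set \<Rightarrow> ('a \<Rightarrow> 'a) \<Rightarrow> complex \<Rightarrow> 'a oper"
  where "resolvent D A z = Blinfun (inv_into D (\<lambda>x. A x - z *\<^sub>C x))"

definition perturb :: "('a::complex_hilbert_space \<Rightarrow> 'a) \<Rightarrow> 'a oper \<Rightarrow> 'a \<Rightarrow> 'a"
  where "perturb A V = (\<lambda>x. A x + V x)"


section \<open>Spectral shift operators\<close>

definition J_plus :: "'a::complex_hilbert_space oper \<Rightarrow> 'a oper"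
  where "J_plus J = (1/2) *\<^sub>R (id_blinfun + J)"

definition J_minus :: "'a::complex_hilbert_space oper \<Rightarrow> 'a oper"
  where "J_minus J = (1/2) *\<^sub>R (id_blinfun - J)"

definition H_plus ::
  "('a::complex_hilbert_space \<Rightarrow> 'a) \<Rightarrow> 'a oper \<Rightarrow> 'a oper \<Rightarrow> 'a \<Rightarrow> 'a"
  where "H_plus H0 J K = perturb H0 (K o\<^sub>L J_plus J o\<^sub>L adj K)"

definition Phi_plus ::
  "'a::complex_hilbert_space set \<Rightarrow> ('a \<Rightarrow> 'a) \<Rightarrow> 'a oper \<Rightarrow> 'a oper \<Rightarrow> complex \<Rightarrow> 'a oper"
  where "Phi_plus D H0 J K z =
    J_plus J + (J_plus J o\<^sub>L adj K o\<^sub>L resolvent D H0 z o\<^sub>L K o\<^sub>L J_plus J)"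

definition Phi_tilde_minus ::
  "'a::complex_hilbert_space set \<Rightarrow> ('a \<Rightarrow> 'a) \<Rightarrow> 'a oper \<Rightarrow> 'a oper \<Rightarrow> complex \<Rightarrow> 'a oper"
  where "Phi_tilde_minus D H0 J K z =
    J_minus J - (J_minus J o\<^sub>L adj K o\<^sub>L resolvent D (H_plus H0 J K) z o\<^sub>L K o\<^sub>L J_minus J)"

text \<open>\<open>F\<close> is the operator-valued function to be represented and \<open>s\<close> (which is \<open>1\<close> or \<open>-1\<close>) is the
  sign in front of the integral. The families are only determined almost everywhere, hence
  Lebesgue measurability (completed measure) and almost-everywhere conditions.\<close>

definition shift_family ::
  "'a::complex_hilbert_space oper \<Rightarrow> complex \<Rightarrow> (complex \<Rightarrow> 'a oper) \<Rightarrow> (real \<Rightarrow> 'a oper) \<Rightarrow> bool"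
  where "shift_family P s F \<Xi> \<longleftrightarrow>
    (\<forall>x\<in>range P. \<forall>y\<in>range P. (\<lambda>t. cinner x (\<Xi> t y)) \<in> borel_measurable lebesgue) \<and>
    (AE t in lebesgue. positive_op (\<Xi> t) \<and> positive_op (P - \<Xi> t) \<and> trace_class P (\<Xi> t)) \<and>
    integrable lebesgue (\<lambda>t. trace_norm P (\<Xi> t) / (1 + t\<^sup>2)) \<and>
    (\<exists>C. adj C = C \<and> trace_class P C \<and>
      (\<forall>z. z \<notin> \<real> \<longrightarrow> (\<forall>x\<in>range P. \<forall>y\<in>range P.
        cinner x (F z y) = cinner x (C y) +
          s * (LINT t|lebesgue. cinner x (\<Xi> t y) *
                 (1 / (complex_of_real t - z) - complex_of_real (t / (1 + t\<^sup>2)))))))"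

definition Xi_plus ::
  "'a::complex_hilbert_space set \<Rightarrow> ('a \<Rightarrow> 'a) \<Rightarrow> 'a oper \<Rightarrow> 'a oper \<Rightarrow> (real \<Rightarrow> 'a oper) \<Rightarrow> bool"
  where "Xi_plus D H0 J K \<Xi> \<longleftrightarrow>
    shift_family (J_plus J) 1 (\<lambda>z. log_in (J_plus J) (Phi_plus D H0 J K z)) \<Xi>"

definition Xi_minus ::
  "'a::complex_hilbert_space set \<Rightarrow> ('a \<Rightarrow> 'a) \<Rightarrow> 'a oper \<Rightarrow> 'a oper \<Rightarrow> (real \<Rightarrow> 'a oper) \<Rightarrow> bool"
  where "Xi_minus D H0 J K \<Xi> \<longleftrightarrow>
    shift_family (J_minus J) (-1) (\<lambda>z. log_in (J_minus J) (Phi_tilde_minus D H0 J K z)) \<Xi>"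

end

(*
  For a definite perturbation A1 = A + s L L* (s = 1 or s = -1, L Hilbert-Schmidt) put
  W(z) = 1 + s L* (A - z)^-1 L; its inverse is 1 - s L* (A1 - z)^-1 L.  Differentiating the integral
  that defines log W(z), taking traces and using their cyclicity together with
  i int_0^oo (W + i t)^-2 dt = W^-1 gives
    d/dz tr log W(z) = tr (W(z)^-1 W'(z)) = - tr ((A1 - z)^-1 - (A - z)^-1),
  while the integral representation of log W(z) gives s int tr Xi(t) (t - z)^-2 dt for the same
  derivative.  The derivative is taken along real increments of z, for which all resolvent bounds are
  uniform.  Applying this first to H0, H_+ with s = 1 and then to H_+, H with s = -1 and adding proves
  the formula for nonreal z; the real points of the resolvent sets follow by a vertical limit.
*)

theory Submission
  imports Defs
begin

text \<open>Three obstacles shape the proof. At a real point of both resolvent sets the integral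
  need not converge absolutely: for H0 = 0 and H = 1 in dimension one, xi is the indicator function
  of (0, 1), and (t - z)^-2 is not integrable there for z in (0, 1). So at real z the equality is
  asserted under integrability, and the vertical limit in every case. Next, norm convergence of the
  integral for log W(z) does not by itself control traces. The argument therefore stays with
  diagonal matrix elements and exchanges sums with integrals by dominated convergence. The majorants
  come from factoring each operator into two Hilbert-Schmidt operators, which is why S (adj L) R R L
  S is split between the two resolvents. Finally, the spectral shift operators have their traces in
  ran P, the resolvents theirs in the whole space. Cyclicity passes from one basis to the other, and
  for this it is proved with two projections.\<close>

instance complex_hilbert_space \<subseteq> banach ..

section \<open>Calculus of the complex inner product\<close>

lemma cinner_zero_right [simp]: "cinner x 0 = 0" for x :: "'a::complex_hilbert_space"
  using cinner_add_right[of x 0 0] by simp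

lemma cinner_add_left: "cinner (x + y) z = cinner x z + cinner y z"
  for x y z :: "'a::complex_hilbert_space"
  by (metis cinner_add_right cinner_commute complex_cnj_add)

text \<open>Reduces to the real Cauchy-Schwarz inequality: turning \<open>y\<close> by the phase
  \<open>c\<close> makes the product real and nonnegative, hence equal to its real part.\<close>

lemma cinner_norm_le: "cmod (cinner x y) \<le> norm x * norm y"
  for x y :: "'a::complex_hilbert_space"
proof (cases "cinner x y = 0")
  case False
  define c where "c = cnj (cinner x y) / cmod (cinner x y)"
  have c: "cmod c = 1" using False by (simp add: c_def norm_divide)
  have "c * cinner x y = cmod (cinner x y)"
    using False by (simp add: c_def complex_norm_square[symmetric] mult.commute power2_eq_square)
  then have "cmod (cinner x y) = Re (cinner x (c *\<^sub>C y))"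
    by (simp add: cinner_scaleC_right)
  also have "\<dots> \<le> norm x * norm (c *\<^sub>C y)"
    by (simp add: Re_cinner norm_cauchy_schwarz)
  finally show ?thesis by (simp add: norm_scaleC c)
qed simp

lemma scaleR_eq_scaleC: "r *\<^sub>R x = complex_of_real r *\<^sub>C x" for x :: "'a::complex_hilbert_space"
  by (simp add: scaleC_of_real)

interpretation cinner: bounded_bilinear "cinner :: 'a::complex_hilbert_space \<Rightarrow> 'a \<Rightarrow> complex"
proof
  show "\<exists>K. \<forall>a b::'a. norm (cinner a b) \<le> norm a * norm b * K"
    by (rule exI[of _ 1]) (simp add: cinner_norm_le)
qed (simp_all add: cinner_add_left cinner_add_right scaleR_eq_scaleC cinner_scaleC_left
    cinner_scaleC_right scaleC_complex_def)

interpretation scaleC: bounded_bilinear "scaleC :: complex \<Rightarrow> 'a::complex_hilbert_space \<Rightarrow> 'a"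
proof
  show "\<exists>K. \<forall>a (b::'a). norm (a *\<^sub>C b) \<le> norm a * norm b * K"
    by (rule exI[of _ 1]) (simp add: norm_scaleC)
qed (simp_all add: scaleC_add_left scaleC_add_right scaleR_eq_scaleC scaleC_scaleC
    scaleC_complex_def mult.commute)

lemma cinner_ext: "(\<And>y. cinner x y = cinner x' y) \<Longrightarrow> x = x'" for x x' :: "'a::complex_hilbert_space"
  using cinner_self[of "x - x'"] by (simp add: cinner.diff_left)

text \<open>The real part at \<open>-i h\<close> is the imaginary part at \<open>h\<close>. Thus
  conclusions about the real inner product carry over to the complex one on complex
  subspaces.\<close>

lemma inner_imp_cinner_eq:
  fixes u v :: "'a::complex_hilbert_space"
  assumes "complex_vector.subspace M" "\<And>h. h \<in> M \<Longrightarrow> inner u h = inner v h" "h \<in> M"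
  shows "cinner u h = cinner v h"
proof (rule complex_eqI)
  show "Re (cinner u h) = Re (cinner v h)" using assms by (simp add: Re_cinner)
  have "(- \<i>) *\<^sub>C h \<in> M" using assms complex_vector.subspace_scale by blast
  then have "Re (cinner u ((- \<i>) *\<^sub>C h)) = Re (cinner v ((- \<i>) *\<^sub>C h))"
    using assms(2) by (simp only: Re_cinner)
  then show "Im (cinner u h) = Im (cinner v h)" by (simp only: cinner_scaleC_right) simp
qed

section \<open>Riesz representation and adjoints\<close>

text \<open>The representative is the minimiser over \<open>M\<close> of half the squared norm minus
  \<open>f\<close>. One variational argument thus yields both the Riesz theorem
  (\<open>M = UNIV\<close>) and orthogonal projection onto \<open>M\<close>
  (\<open>f = inner x\<close>).\<close>

lemma riesz_on_subspace:
  fixes M :: "'a::complex_hilbert_space set"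
  assumes M: "complex_vector.subspace M" "closed M" and f: "bounded_linear f"
  shows "\<exists>u\<in>M. \<forall>h\<in>M. inner u h = (f h :: real)"
proof -
  interpret f: bounded_linear f by fact
  define \<phi> where "\<phi> x = inner x x / 2 - f x" for x
  have sub: "r *\<^sub>R x \<in> M" if "x \<in> M" for r x
    using that M complex_vector.subspace_scale by (simp add: scaleR_eq_scaleC)
  have add: "x + y \<in> M" if "x \<in> M" "y \<in> M" for x y
    using that M complex_vector.subspace_add by blast
  obtain K where K: "\<And>x. \<bar>f x\<bar> \<le> norm x * K" using f.bounded by auto
  have lower: "\<phi> x \<ge> - K\<^sup>2 / 2" for x
  proof -
    have "0 \<le> (norm x - K)\<^sup>2" by simp
    then show ?thesis
      using K[of x] by (simp add: \<phi>_def power2_norm_eq_inner[symmetric] power2_diff field_simps)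
  qed
  then have bdd: "bdd_below (\<phi> ` M)" by (auto simp: bdd_below_def)
  define m where "m = Inf (\<phi> ` M)"
  have m_le: "m \<le> \<phi> x" if "x \<in> M" for x
    unfolding m_def using bdd that by (simp add: cInf_lower)
  have ne: "\<phi> ` M \<noteq> {}" using complex_vector.subspace_0[OF M(1)] by auto
  have "\<exists>x\<in>M. \<phi> x < m + inverse (real (Suc n))" for n
    using cInf_lessD[OF ne, of "m + inverse (real (Suc n))"] by (auto simp: m_def)
  then obtain X where X: "\<And>n. X n \<in> M" "\<And>n. \<phi> (X n) < m + inverse (real (Suc n))" by metis
  \<comment> \<open>Parallelogram identity: the linear part of phi cancels, and the midpoint lies in
    \<open>M\<close>, so phi is at least \<open>m\<close> there.\<close>
  have para: "norm (x - y) ^ 2 / 4 \<le> \<phi> x + \<phi> y - 2 * m" if "x \<in> M" "y \<in> M" for x y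
  proof -
    have "norm (x - y) ^ 2 / 4 = \<phi> x + \<phi> y - 2 * \<phi> ((1/2) *\<^sub>R (x + y))"
      by (simp add: \<phi>_def power2_norm_eq_inner inner_diff_left inner_diff_right f.add f.scaleR
          inner_add_left inner_add_right inner_commute field_simps)
    then show ?thesis using m_le[OF sub[OF add[OF that], of "1/2"]] by simp
  qed
  have "Cauchy X"
  proof (rule CauchyI)
    fix e :: real assume "e > 0"
    \<comment> \<open>Two excesses below e^2/8 give |X n - X k|^2 / 4 < e^2/4.\<close>
    then obtain N where N: "inverse (real (Suc N)) < e\<^sup>2 / 8"
      using reals_Archimedean[of "e\<^sup>2 / 8"] by auto
    have "norm (X n - X k) < e" if "n \<ge> N" "k \<ge> N" for n k
    proof -
      have "inverse (real (Suc n)) \<le> inverse (real (Suc N))" "inverse (real (Suc k)) \<le> inverse (real (Suc N))"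
        using that by (simp_all add: field_simps)
      then have "norm (X n - X k) ^ 2 < e\<^sup>2"
        using para[OF X(1) X(1), of n k] X(2)[of n] X(2)[of k] N by linarith
      then show ?thesis using \<open>e > 0\<close> by (meson less_eq_real_def power2_less_imp_less)
    qed
    then show "\<exists>M. \<forall>m\<ge>M. \<forall>n\<ge>M. norm (X m - X n) < e" by blast
  qed
  then obtain u where u: "X \<longlonglongrightarrow> u" using Cauchy_convergent convergentD by blast
  have uM: "u \<in> M" using closed_sequentially[OF M(2)] X(1) u by blast
  have "(\<lambda>n. \<phi> (X n)) \<longlonglongrightarrow> \<phi> u"
    unfolding \<phi>_def by (intro tendsto_intros u f.tendsto) auto
  moreover have "(\<lambda>n. m + inverse (real (Suc n))) \<longlonglongrightarrow> m + 0"
    by (intro tendsto_intros LIMSEQ_inverse_real_of_nat)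
  ultimately have "\<phi> u \<le> m + 0"
    by (rule LIMSEQ_le) (use X(2) less_imp_le in blast)
  then have min: "\<phi> u \<le> \<phi> x" if "x \<in> M" for x using m_le[OF that] by simp
  have "inner u h = f h" if h: "h \<in> M" for h
  proof -
    define d where "d = inner u h - f h"
    have ineq: "0 \<le> t * d + t\<^sup>2 * (inner h h / 2)" for t
      using min[OF add[OF uM sub[OF h, of t]]]
      by (simp add: \<phi>_def d_def f.add f.scaleR inner_add_left inner_add_right inner_commute
          algebra_simps power2_eq_square add_divide_distrib)
    \<comment> \<open>The choice t = -d/k makes the quadratic expression negative unless d = 0; the
      summand 1 keeps \<open>k\<close> positive when h = 0.\<close>
    define k where "k = inner h h / 2 + 1"
    have k: "k > 0" "inner h h / 2 < k" by (simp_all add: k_def add_nonneg_pos)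
    have "0 \<le> (- (d / k)) * d + (- (d / k))\<^sup>2 * (inner h h / 2)" by (rule ineq)
    also have "\<dots> = (d / k)\<^sup>2 * (inner h h / 2 - k)"
      using k by (simp add: power2_eq_square field_simps)
    finally have "(d / k)\<^sup>2 * (k - inner h h / 2) \<le> 0" by (simp add: algebra_simps)
    then have "(d / k)\<^sup>2 \<le> 0" using k by (simp add: mult_le_0_iff)
    then have "d = 0" using k by simp
    then show ?thesis by (simp add: d_def)
  qed
  with uM show ?thesis by blast
qed

text \<open>The Riesz representative of \<open>inner x\<close> on \<open>M\<close> is the orthogonal
  projection \<open>u\<close> of \<open>x\<close>, and \<open>x - u\<close> is orthogonal to
  \<open>M\<close>.\<close>

lemma closed_subspace_eq_UNIV:
  fixes M :: "'a::complex_hilbert_space set"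
  assumes M: "complex_vector.subspace M" "closed M"
    and orth: "\<And>y. (\<And>x. x \<in> M \<Longrightarrow> cinner y x = 0) \<Longrightarrow> y = 0"
  shows "M = UNIV"
proof -
  have "x \<in> M" for x
  proof -
    obtain u where u: "u \<in> M" "\<And>h. h \<in> M \<Longrightarrow> inner u h = inner x h"
      using riesz_on_subspace[OF M bounded_linear_inner_right[of x]] by auto
    have "x - u = 0"
      by (rule orth) (use inner_imp_cinner_eq[OF M(1) u(2)] in \<open>simp add: cinner.diff_left\<close>)
    with u show ?thesis by simp
  qed
  then show ?thesis by blast
qed

lemma clinear_opD: "clinear_op T \<Longrightarrow> T (c *\<^sub>C x) = c *\<^sub>C T x"
  by (simp add: clinear_op_def)

text \<open>Since \<open>adj\<close> is a definite description, existence has to be shown: Riesz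
  applied for each \<open>x\<close>, then boundedness from |S x|^2 = (x, T S x).\<close>

lemma adj_exists:
  fixes T :: "'a::complex_hilbert_space oper"
  assumes "clinear_op T"
  shows "\<exists>S :: 'a oper. \<forall>x y. cinner (S x) y = cinner x (T y)"
proof -
  have "\<exists>u. \<forall>y. inner u y = inner x (T y)" for x
    using riesz_on_subspace[OF complex_vector.subspace_UNIV closed_UNIV
        bounded_linear_compose[OF bounded_linear_inner_right blinfun.bounded_linear_right], of x T]
    by blast
  then obtain S where S: "\<And>x y. inner (S x) y = inner x (T y)" by metis
  have c: "cinner (S x) y = cinner x (T y)" for x y
  proof (rule complex_eqI)
    show "Re (cinner (S x) y) = Re (cinner x (T y))" by (simp add: Re_cinner S)
    have "Re (cinner (S x) ((- \<i>) *\<^sub>C y)) = Re (cinner x (T ((- \<i>) *\<^sub>C y)))"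
      by (simp only: Re_cinner S)
    then show "Im (cinner (S x) y) = Im (cinner x (T y))"
      by (simp only: clinear_opD[OF assms] cinner_scaleC_right) simp
  qed
  have "bounded_linear S"
  proof (rule bounded_linear_intro[where K = "norm T"])
    show "S (x + y) = S x + S y" for x y
      by (rule cinner_ext) (simp add: c cinner_add_left)
    show "S (r *\<^sub>R x) = r *\<^sub>R S x" for r x
      by (rule cinner_ext) (simp add: c cinner.scaleR_left)
    show "norm (S x) \<le> norm x * norm T" for x
    proof (cases "S x = 0")
      case False
      have "norm (S x) ^ 2 = inner x (T (S x))"
        by (simp add: power2_norm_eq_inner S)
      also have "\<dots> \<le> norm x * norm (T (S x))" by (rule norm_cauchy_schwarz)
      also have "\<dots> \<le> norm x * (norm T * norm (S x))"
        by (intro mult_left_mono norm_blinfun) auto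
      finally show ?thesis using False by (simp add: power2_eq_square)
    qed simp
  qed
  then show ?thesis using c by (intro exI[of _ "Blinfun S"]) (simp add: bounded_linear_Blinfun_apply)
qed

lemma adj_eqI:
  fixes S T :: "'a::complex_hilbert_space oper"
  assumes "\<And>x y. cinner (S x) y = cinner x (T y)"
  shows "adj T = S"
  unfolding adj_def
proof (rule the_equality)
  show "\<forall>x y. cinner (S x) y = cinner x (T y)" using assms by blast
  fix S' :: "'a oper" assume "\<forall>x y. cinner (S' x) y = cinner x (T y)"
  then have "cinner (S' x) y = cinner (S x) y" for x y using assms by simp
  then show "S' = S" by (intro blinfun_eqI) (rule cinner_ext)
qed

lemma cinner_adj_left: "clinear_op T \<Longrightarrow> cinner (adj T x) y = cinner x (T y)"
  using adj_exists[of T] adj_eqI[of _ T] by metis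

lemma cinner_adj_right: "clinear_op T \<Longrightarrow> cinner x (adj T y) = cinner (T x) y"
  by (metis cinner_adj_left cinner_commute)

lemma clinear_adj [intro, simp]: "clinear_op T \<Longrightarrow> clinear_op (adj T)"
  unfolding clinear_op_def[of "adj T"]
  by (intro allI, rule cinner_ext) (simp add: cinner_adj_left cinner_scaleC_left)

lemma adj_adj [simp]: "clinear_op T \<Longrightarrow> adj (adj T) = T"
  by (rule adj_eqI) (simp add: cinner_adj_right)

section \<open>Algebra of complex-linear operators and their adjoints\<close>

lemma clinear_zero [intro, simp]: "clinear_op 0"
  by (simp add: clinear_op_def)

lemma clinear_id [intro, simp]: "clinear_op id_blinfun"
  by (simp add: clinear_op_def)

lemma clinear_add [intro]: "clinear_op S \<Longrightarrow> clinear_op T \<Longrightarrow> clinear_op (S + T)"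
  by (simp add: clinear_op_def blinfun.add_left scaleC_add_right)

lemma clinear_diff [intro]: "clinear_op S \<Longrightarrow> clinear_op T \<Longrightarrow> clinear_op (S - T)"
  by (simp add: clinear_op_def blinfun.diff_left scaleC.diff_right)

lemma clinear_scale [intro]: "clinear_op T \<Longrightarrow> clinear_op (c *\<^sub>O T)"
  by (simp add: clinear_op_def scale_op.rep_eq scaleC_scaleC mult.commute)

lemma clinear_minus [intro]: "clinear_op T \<Longrightarrow> clinear_op (- T)"
  by (simp add: clinear_op_def blinfun.minus_left scaleC.minus_right)

lemma clinear_scaleR [intro]: "clinear_op T \<Longrightarrow> clinear_op (r *\<^sub>R T)"
  by (simp add: clinear_op_def blinfun.scaleR_left scaleC.scaleR_right)

lemma clinear_compose [intro]: "clinear_op S \<Longrightarrow> clinear_op T \<Longrightarrow> clinear_op (S o\<^sub>L T)"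
  by (simp add: clinear_op_def)

lemma clinear_limit:
  assumes "\<And>n. clinear_op (X n)" "X \<longlonglongrightarrow> T"
  shows "clinear_op T"
proof -
  have "T (c *\<^sub>C x) = c *\<^sub>C T x" for c x
  proof (rule LIMSEQ_unique)
    show "(\<lambda>n. X n (c *\<^sub>C x)) \<longlonglongrightarrow> T (c *\<^sub>C x)"
      by (intro tendsto_intros assms)
    show "(\<lambda>n. X n (c *\<^sub>C x)) \<longlonglongrightarrow> c *\<^sub>C T x"
      unfolding clinear_opD[OF assms(1)] by (intro scaleC.tendsto tendsto_intros assms)
  qed
  then show ?thesis by (simp add: clinear_op_def)
qed

lemma adj_compose: "clinear_op S \<Longrightarrow> clinear_op T \<Longrightarrow> adj (S o\<^sub>L T) = adj T o\<^sub>L adj S"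
  by (rule adj_eqI) (simp add: cinner_adj_left)

lemma adj_id [simp]: "adj id_blinfun = id_blinfun"
  by (rule adj_eqI) simp

lemma adj_add: "clinear_op S \<Longrightarrow> clinear_op T \<Longrightarrow> adj (S + T) = adj S + adj T"
  by (rule adj_eqI) (simp add: cinner_adj_left blinfun.add_left cinner_add_left cinner_add_right)

lemma adj_diff: "clinear_op S \<Longrightarrow> clinear_op T \<Longrightarrow> adj (S - T) = adj S - adj T"
  by (rule adj_eqI) (simp add: cinner_adj_left blinfun.diff_left cinner.diff_left cinner.diff_right)

lemma adj_scaleR: "clinear_op T \<Longrightarrow> adj (r *\<^sub>R T) = r *\<^sub>R adj T"
  by (rule adj_eqI) (simp add: cinner_adj_left blinfun.scaleR_left cinner.scaleR_left cinner.scaleR_right)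

lemma adj_scale: "clinear_op T \<Longrightarrow> adj (c *\<^sub>O T) = cnj c *\<^sub>O adj T"
  by (rule adj_eqI) (simp add: cinner_adj_left scale_op.rep_eq cinner_scaleC_left cinner_scaleC_right)

lemma norm_adj_le:
  assumes T: "clinear_op T"
  shows "norm (adj T) \<le> norm T"
proof (rule norm_blinfun_bound)
  fix x
  show "norm (adj T x) \<le> norm T * norm x"
  proof (cases "adj T x = 0")
    case False
    have "norm (adj T x) ^ 2 = cmod (cinner (adj T x) (adj T x))"
      by (simp only: cinner_self norm_of_real abs_power2)
    also have "\<dots> = cmod (cinner x (T (adj T x)))" by (simp add: cinner_adj_left T)
    also have "\<dots> \<le> norm x * norm (T (adj T x))" by (rule cinner_norm_le)
    also have "\<dots> \<le> norm x * (norm T * norm (adj T x))"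
      by (intro mult_left_mono norm_blinfun) auto
    finally show ?thesis using False by (simp add: power2_eq_square mult.commute)
  qed simp
qed (rule norm_ge_zero)

section \<open>Bijectivity of coercive operators and resolvents\<close>

text \<open>A lower bound and a closed graph make the range closed; \<open>orth\<close> makes it
  dense. Admitting a domain \<open>D\<close> lets the lemma serve both bounded operators and
  \<open>A - z\<close> for unbounded \<open>A\<close>.\<close>

lemma coercive_bij:
  fixes A :: "'a::complex_hilbert_space \<Rightarrow> 'a"
  assumes D: "complex_vector.subspace D"
    and add: "\<And>x y. x \<in> D \<Longrightarrow> y \<in> D \<Longrightarrow> A (x + y) = A x + A y"
    and scale: "\<And>c x. x \<in> D \<Longrightarrow> A (c *\<^sub>C x) = c *\<^sub>C A x"
    and graph: "\<And>X x y. (\<And>n. X n \<in> D) \<Longrightarrow> X \<longlonglongrightarrow> x \<Longrightarrow> (\<lambda>n. A (X n)) \<longlonglongrightarrow> y \<Longrightarrow> x \<in> D \<and> A x = y"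
    and c: "c > 0" and coercive: "\<And>x. x \<in> D \<Longrightarrow> c * norm x \<le> norm (A x)"
    and orth: "\<And>y. (\<And>x. x \<in> D \<Longrightarrow> cinner y (A x) = 0) \<Longrightarrow> y = 0"
  shows "bij_betw A D UNIV" and "bounded_linear (inv_into D A)"
    and "norm (inv_into D A x) \<le> norm x / c"
proof -
  have D_add: "x + y \<in> D" if "x \<in> D" "y \<in> D" for x y
    using that D complex_vector.subspace_add by blast
  have D_scale: "a *\<^sub>C x \<in> D" if "x \<in> D" for a x
    using that D complex_vector.subspace_scale by blast
  have diff: "A (x - y) = A x - A y" "x - y \<in> D" if "x \<in> D" "y \<in> D" for x y
  proof -
    have *: "x - y = x + (-1) *\<^sub>C y" by simp
    show "x - y \<in> D" unfolding * using that by (intro D_add D_scale)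
    show "A (x - y) = A x - A y"
      unfolding * using that by (simp only: add D_scale scale) simp
  qed
  have inj: "inj_on A D"
  proof (rule inj_onI)
    fix x y assume "x \<in> D" "y \<in> D" "A x = A y"
    then have "c * norm (x - y) \<le> 0" using coercive[of "x - y"] diff by simp
    then show "x = y" using c by (simp add: mult_le_0_iff)
  qed
  have A0: "A 0 = 0" using scale[OF complex_vector.subspace_0[OF D], of 0] by simp
  have "A ` D = UNIV"
  proof (rule closed_subspace_eq_UNIV)
    show "complex_vector.subspace (A ` D)"
    proof (rule complex_vector.subspaceI)
      show "0 \<in> A ` D" using A0 complex_vector.subspace_0[OF D] by (metis imageI)
      show "u + v \<in> A ` D" if "u \<in> A ` D" "v \<in> A ` D" for u v
        using that add D_add by (metis (no_types, lifting) image_iff)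
      show "a *\<^sub>C u \<in> A ` D" if "u \<in> A ` D" for a u
        using that scale D_scale by (metis (no_types, lifting) image_iff)
    qed
    show "closed (A ` D)"
      unfolding closed_sequential_limits
    proof (intro allI impI, elim conjE)
      fix Y y assume "\<forall>n. Y n \<in> A ` D" and Y: "Y \<longlonglongrightarrow> y"
      then have "\<forall>n. \<exists>x. x \<in> D \<and> Y n = A x" by blast
      from choice[OF this] obtain X where X: "X n \<in> D" "Y n = A (X n)" for n by blast
      have "Cauchy X"
      proof (rule CauchyI)
        fix e :: real assume "e > 0"
        then have "e * c > 0" using c by simp
        moreover have "Cauchy Y" using Y LIMSEQ_imp_Cauchy by blast
        ultimately obtain N where N: "\<And>m n. m \<ge> N \<Longrightarrow> n \<ge> N \<Longrightarrow> norm (Y m - Y n) < e * c"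
          unfolding Cauchy_iff by meson
        have "norm (X m - X n) < e" if "m \<ge> N" "n \<ge> N" for m n
        proof -
          have "c * norm (X m - X n) \<le> norm (Y m - Y n)"
            using coercive[of "X m - X n"] diff X by simp
          also have "\<dots> < e * c" using N that by blast
          finally show ?thesis using c by (simp add: mult.commute)
        qed
        then show "\<exists>N. \<forall>m\<ge>N. \<forall>n\<ge>N. norm (X m - X n) < e" by blast
      qed
      then obtain x where "X \<longlonglongrightarrow> x" using Cauchy_convergent convergentD by blast
      moreover have "Y = (\<lambda>n. A (X n))" by (rule ext) (rule X(2))
      then have "(\<lambda>n. A (X n)) \<longlonglongrightarrow> y" using Y by simp
      ultimately show "y \<in> A ` D" using graph[of X x y] X(1) by blast
    qed
  qed (use orth in blast)
  with inj show bij: "bij_betw A D UNIV" by (simp add: bij_betw_def)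
  define R where "R = inv_into D A"
  have RD: "R y \<in> D" and AR: "A (R y) = y" for y
    using bij by (auto simp: R_def bij_betw_def inv_into_into f_inv_into_f)
  have eqI: "R y = x" if "x \<in> D" "A x = y" for x y
    using that inj by (auto simp: R_def)
  have bound: "norm (R y) \<le> norm y / c" for y
    using coercive[OF RD, of y] c by (simp add: AR pos_le_divide_eq mult.commute)
  then show "norm (inv_into D A x) \<le> norm x / c" by (simp add: R_def)
  show "bounded_linear (inv_into D A)"
    unfolding R_def[symmetric]
  proof (rule bounded_linear_intro[where K = "1 / c"])
    show "R (x + y) = R x + R y" for x y by (rule eqI) (simp_all add: D_add RD add AR)
    show "R (r *\<^sub>R x) = r *\<^sub>R R x" for r x
      unfolding scaleR_eq_scaleC by (rule eqI) (simp_all add: D_scale RD scale AR)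
    show "norm (R x) \<le> norm x * (1 / c)" for x using bound by simp
  qed
qed

text \<open>The lower bound for \<open>T\<close> gives injectivity and closed range, the one for
  \<open>adj T\<close> a trivial orthogonal complement of the range.\<close>

lemma coercive_invertible:
  fixes T :: "'a::complex_hilbert_space oper"
  assumes T: "clinear_op T" and c: "c > 0" and coercive: "\<And>x. c * norm x \<le> norm (T x)"
    and adj: "\<And>x. c * norm x \<le> norm (adj T x)"
  obtains S where "clinear_op S" "S o\<^sub>L T = id_blinfun" "T o\<^sub>L S = id_blinfun" "norm S \<le> 1 / c"
proof -
  have 1: "y = 0" if "\<And>x. cinner y (T x) = 0" for y
  proof -
    have "adj T y = 0" by (rule cinner_ext) (simp add: cinner_adj_left T that cinner.zero_left)
    then show ?thesis using adj[of y] c by (simp add: mult_le_0_iff)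
  qed
  have 2: "T x = y" if "X \<longlonglongrightarrow> x" "(\<lambda>n. T (X n)) \<longlonglongrightarrow> y" for X x y
    by (rule LIMSEQ_unique[OF _ that(2)]) (intro tendsto_intros that(1))
  have bij: "bij_betw T UNIV UNIV" and bl: "bounded_linear (inv T)"
    and nm: "\<And>x. norm (inv T x) \<le> norm x / c"
    by (rule coercive_bij[of UNIV "blinfun_apply T" c];
        (rule complex_vector.subspace_UNIV blinfun.add_right clinear_opD[OF T] c coercive
          | (rule conjI, rule UNIV_I, erule (1) 2) | (rule 1, simp)))+
  have inv: "T (inv T x) = x" "inv T (T x) = x" for x
    using bij by (simp_all add: bij_betw_def surj_f_inv_f)
  define S where "S = Blinfun (inv T)"
  have S: "S x = inv T x" for x using bl by (simp add: S_def bounded_linear_Blinfun_apply)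
  show thesis
  proof (rule that)
    show "clinear_op S"
      unfolding clinear_op_def S by (metis T clinear_opD inv)
    show "norm S \<le> 1 / c"
      by (rule norm_blinfun_bound) (use c nm in \<open>simp_all add: S\<close>)
  qed (auto intro!: blinfun_eqI simp: S inv)
qed

lemma blinfun_compose_eqD: "S o\<^sub>L T = U o\<^sub>L V \<Longrightarrow> S (T x) = U (V x)"
  by (drule arg_cong[where f = "\<lambda>W. blinfun_apply W x"]) simp

lemma blinfun_compose_idD: "S o\<^sub>L T = id_blinfun \<Longrightarrow> S (T x) = x"
  by (drule arg_cong[where f = "\<lambda>W. blinfun_apply W x"]) simp

lemma norm_blinfun_le: "norm T \<le> a \<Longrightarrow> norm x \<le> b \<Longrightarrow> norm (blinfun_apply T x) \<le> a * b"
  by (rule order_trans[OF norm_blinfun mult_mono]) (auto intro: order_trans[OF norm_ge_zero])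

lemma norm_blinfun_compose_le: "norm S \<le> a \<Longrightarrow> norm T \<le> b \<Longrightarrow> norm (S o\<^sub>L T) \<le> a * b"
  by (rule order_trans[OF norm_blinfun_compose mult_mono]) (auto intro: order_trans[OF norm_ge_zero])

section \<open>Resolvents of self-adjoint operators\<close>

lemma power2_norm_eq_cinner: "norm x ^ 2 = Re (cinner x x)" for x :: "'a::complex_hilbert_space"
  by (simp add: cinner_self)

lemma norm_diff_sq: "norm (x - y) ^ 2 = norm x ^ 2 - 2 * Re (cinner x y) + norm y ^ 2"
  for x y :: "'a::complex_hilbert_space"
  by (simp add: Re_cinner power2_norm_eq_inner inner_diff_left inner_diff_right inner_commute)

text \<open>\<open>resolvent\<close> is built from \<open>inv_into\<close> and
  \<open>Blinfun\<close> and is meaningful only off the spectrum. This relation collects what a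
  genuine resolvent satisfies, so that resolvent identities become purely algebraic.\<close>

definition resolves :: "'a::complex_hilbert_space set \<Rightarrow> ('a \<Rightarrow> 'a) \<Rightarrow> complex \<Rightarrow> 'a oper \<Rightarrow> bool"
  where "resolves D A z R \<longleftrightarrow> clinear_op R \<and> (\<forall>x. R x \<in> D) \<and> (\<forall>x. A (R x) - z *\<^sub>C R x = x) \<and>
    (\<forall>x\<in>D. R (A x - z *\<^sub>C x) = x)"

lemma resolves_clinear: "resolves D A z R \<Longrightarrow> clinear_op R"
  and resolves_mem: "resolves D A z R \<Longrightarrow> R x \<in> D"
  and resolves_right: "resolves D A z R \<Longrightarrow> A (R x) = x + z *\<^sub>C R x"
  and resolves_left: "resolves D A z R \<Longrightarrow> x \<in> D \<Longrightarrow> R (A x - z *\<^sub>C x) = x"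
  unfolding resolves_def by (auto simp: algebra_simps)

lemma self_adjoint_onD:
  assumes "self_adjoint_on D A"
  shows "complex_vector.subspace D"
    and "x \<in> D \<Longrightarrow> y \<in> D \<Longrightarrow> A (x + y) = A x + A y"
    and "x \<in> D \<Longrightarrow> A (c *\<^sub>C x) = c *\<^sub>C A x"
    and "x \<in> D \<Longrightarrow> y \<in> D \<Longrightarrow> cinner x (A y) = cinner (A x) y"
    and "(\<And>x. x \<in> D \<Longrightarrow> cinner v (A x) = cinner w x) \<Longrightarrow> v \<in> D \<and> A v = w"
proof -
  have *: "adjoint_graph D A = {(x, A x) | x. x \<in> D}"
    using assms by (simp add: self_adjoint_on_def)
  show "complex_vector.subspace D"
    and "x \<in> D \<Longrightarrow> y \<in> D \<Longrightarrow> A (x + y) = A x + A y"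
    and "x \<in> D \<Longrightarrow> A (c *\<^sub>C x) = c *\<^sub>C A x"
    using assms by (auto simp: self_adjoint_on_def)
  show "cinner x (A y) = cinner (A x) y" if "x \<in> D" "y \<in> D"
  proof -
    have "(x, A x) \<in> adjoint_graph D A" using * that by blast
    then show ?thesis using that by (simp add: adjoint_graph_def)
  qed
  show "v \<in> D \<and> A v = w" if "\<And>x. x \<in> D \<Longrightarrow> cinner v (A x) = cinner w x"
  proof -
    have "(v, w) \<in> adjoint_graph D A" using that by (simp add: adjoint_graph_def)
    then show ?thesis using * by auto
  qed
qed

lemma resolvent_resolves:
  assumes A: "self_adjoint_on D A" and z: "z \<notin> spec D A"
  shows "resolves D A z (resolvent D A z)"
proof -
  define B where "B = (\<lambda>x. A x - z *\<^sub>C x)"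
  have bij: "bij_betw B D UNIV" and bl: "bounded_linear (inv_into D B)"
    using z by (auto simp: spec_def B_def)
  have R: "resolvent D A z x = inv_into D B x" for x
    using bl by (simp add: resolvent_def B_def bounded_linear_Blinfun_apply)
  have mem: "inv_into D B x \<in> D" and BR: "B (inv_into D B x) = x" for x
    using bij by (auto simp: bij_betw_def inv_into_into f_inv_into_f)
  have RB: "inv_into D B (B x) = x" if "x \<in> D" for x
    using bij that by (auto simp: bij_betw_def)
  have "inv_into D B (c *\<^sub>C x) = c *\<^sub>C inv_into D B x" for c x
  proof -
    have "c *\<^sub>C inv_into D B x \<in> D"
      using mem self_adjoint_onD(1)[OF A] complex_vector.subspace_scale by blast
    moreover have "B (c *\<^sub>C y) = c *\<^sub>C B y" if "y \<in> D" for y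
      by (simp add: B_def self_adjoint_onD(3)[OF A that] scaleC.diff_right scaleC_scaleC mult.commute)
    ultimately show ?thesis using RB BR mem by metis
  qed
  then show ?thesis
    unfolding resolves_def clinear_op_def R
    using mem BR RB by (simp add: B_def)
qed

text \<open>The cross term vanishes because (A x, x) is real. This identity yields the bound 1/|Im
  z|, the comparison of resolvents on a vertical line, and the contractivity of A (A - i
  r)^-1.\<close>

lemma self_adjoint_norm_sq:
  assumes A: "self_adjoint_on D A" and x: "x \<in> D"
  shows "norm (A x - z *\<^sub>C x) ^ 2 = norm (A x - complex_of_real (Re z) *\<^sub>C x) ^ 2 + Im z ^ 2 * norm x ^ 2"
proof -
  define u where "u = A x - complex_of_real (Re z) *\<^sub>C x"
  have "cnj (cinner x (A x)) = cinner x (A x)"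
    using self_adjoint_onD(4)[OF A x x] cinner_commute by metis
  then have "Im (cinner (A x) x) = 0"
    using cinner_commute[of "A x" x] by (metis complex.sel(2) complex_cnj complex_surj neg_equal_zero)
  then have im: "Im (cinner u x) = 0"
    by (simp add: u_def cinner.diff_left cinner_scaleC_left cinner_self)
  have "A x - z *\<^sub>C x = u - (\<i> * Im z) *\<^sub>C x"
    by (subst complex_eq[of z]) (simp add: u_def scaleC_add_left)
  then have "norm (A x - z *\<^sub>C x) ^ 2 =
      (norm u)\<^sup>2 - 2 * Re (cinner u ((\<i> * Im z) *\<^sub>C x)) + norm ((\<i> * Im z) *\<^sub>C x) ^ 2"
    by (simp only: norm_diff_sq)
  also have "Re (cinner u ((\<i> * Im z) *\<^sub>C x)) = 0"
    by (simp add: cinner_scaleC_right im)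
  finally show ?thesis
    by (simp add: u_def norm_scaleC norm_mult power_mult_distrib)
qed

text \<open>Self-adjointness, as opposed to mere symmetry, enters twice: it closes the graph, and it
  turns a vector orthogonal to the range into an eigenvector for \<open>cnj z\<close>, which
  coercivity excludes.\<close>

lemma self_adjoint_resolves_nonreal:
  assumes A: "self_adjoint_on D A" and z: "Im z \<noteq> 0"
  shows "resolves D A z (resolvent D A z)" and "norm (resolvent D A z) \<le> 1 / \<bar>Im z\<bar>"
proof -
  note sub = self_adjoint_onD(1)[OF A]
  define B where "B = (\<lambda>x. A x - z *\<^sub>C x)"
  have add: "B (x + y) = B x + B y" if "x \<in> D" "y \<in> D" for x y
    using self_adjoint_onD(2)[OF A that] by (simp add: B_def scaleC_add_right)
  have scale: "B (c *\<^sub>C x) = c *\<^sub>C B x" if "x \<in> D" for c x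
    using self_adjoint_onD(3)[OF A that] by (simp add: B_def scaleC.diff_right scaleC_scaleC mult.commute)
  have coercive: "\<bar>Im w\<bar> * norm x \<le> norm (A x - w *\<^sub>C x)" if "x \<in> D" for w x
    by (rule power2_le_imp_le)
       (use self_adjoint_norm_sq[OF A that, of w] in \<open>simp_all add: power_mult_distrib\<close>)
  have graph: "x \<in> D \<and> B x = y"
    if X: "\<And>n. X n \<in> D" "X \<longlonglongrightarrow> x" "(\<lambda>n. B (X n)) \<longlonglongrightarrow> y" for X x y
  proof -
    have "(\<lambda>n. B (X n) + z *\<^sub>C X n) \<longlonglongrightarrow> y + z *\<^sub>C x"
      by (intro tendsto_intros X scaleC.tendsto)
    then have AX: "(\<lambda>n. A (X n)) \<longlonglongrightarrow> y + z *\<^sub>C x" by (simp add: B_def)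
    have "x \<in> D \<and> A x = y + z *\<^sub>C x"
    proof (rule self_adjoint_onD(5)[OF A])
      fix v assume v: "v \<in> D"
      have "(\<lambda>n. cinner (A (X n)) v) \<longlonglongrightarrow> cinner (y + z *\<^sub>C x) v"
        by (intro cinner.tendsto AX tendsto_intros)
      moreover have "(\<lambda>n. cinner (X n) (A v)) \<longlonglongrightarrow> cinner x (A v)"
        by (intro cinner.tendsto X tendsto_intros)
      moreover have "(\<lambda>n. cinner (A (X n)) v) = (\<lambda>n. cinner (X n) (A v))"
        using self_adjoint_onD(4)[OF A X(1) v] by simp
      ultimately show "cinner x (A v) = cinner (y + z *\<^sub>C x) v"
        using LIMSEQ_unique by metis
    qed
    then show ?thesis by (simp add: B_def)
  qed
  have orth: "y = 0" if y: "\<And>x. x \<in> D \<Longrightarrow> cinner y (B x) = 0" for y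
  proof -
    have "y \<in> D \<and> A y = cnj z *\<^sub>C y"
    proof (rule self_adjoint_onD(5)[OF A])
      fix x assume "x \<in> D"
      then show "cinner y (A x) = cinner (cnj z *\<^sub>C y) x"
        using y[of x] by (simp add: B_def cinner.diff_right cinner_scaleC_left cinner_scaleC_right)
    qed
    then have "\<bar>Im (cnj z)\<bar> * norm y \<le> 0" using coercive[of y "cnj z"] by simp
    then show ?thesis using z by (simp add: mult_le_0_iff)
  qed
  have c: "\<bar>Im z\<bar> > 0" using z by simp
  have coB: "\<bar>Im z\<bar> * norm x \<le> norm (B x)" if "x \<in> D" for x
    using coercive[OF that] by (simp add: B_def)
  have bij: "bij_betw B D UNIV" "bounded_linear (inv_into D B)"
    "norm (inv_into D B x) \<le> norm x / \<bar>Im z\<bar>" for x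
    by (rule coercive_bij[of D B "\<bar>Im z\<bar>"]; fact)+
  have "z \<notin> spec D A" using bij(1,2) by (simp add: spec_def B_def)
  then show "resolves D A z (resolvent D A z)" by (rule resolvent_resolves[OF A])
  show "norm (resolvent D A z) \<le> 1 / \<bar>Im z\<bar>"
  proof (rule norm_blinfun_bound)
    show "norm (resolvent D A z x) \<le> 1 / \<bar>Im z\<bar> * norm x" for x
      using bij(3)[of x] bij(2) by (simp add: resolvent_def bounded_linear_Blinfun_apply B_def)
  qed simp
qed

text \<open>Leaving the real axis vertically only increases |(A - w) y|. The resulting bound is
  uniform and supplies the majorant for the vertical limit.\<close>

lemma self_adjoint_resolves_near_real:
  assumes A: "self_adjoint_on D A" and R: "resolves D A z R" "Im z = 0"
    and R': "resolves D A w R'" "Re w = Re z"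
  shows "norm R' \<le> norm R"
proof (rule norm_blinfun_bound)
  fix x
  define y where "y = R' x"
  have y: "y \<in> D" "A y - w *\<^sub>C y = x"
    using resolves_mem[OF R'(1)] resolves_right[OF R'(1)] by (simp_all add: y_def)
  have zr: "complex_of_real (Re z) = z" using R(2) by (simp add: complex_eq_iff)
  have "norm (A y - z *\<^sub>C y) ^ 2 \<le> norm (A y - w *\<^sub>C y) ^ 2"
    using self_adjoint_norm_sq[OF A y(1), of w] by (simp add: R'(2) zr)
  then have "norm (A y - z *\<^sub>C y) \<le> norm x"
    using y(2) power2_le_imp_le norm_ge_zero by blast
  then have "norm R * norm (A y - z *\<^sub>C y) \<le> norm R * norm x"
    by (intro mult_left_mono) auto
  moreover have "norm y \<le> norm R * norm (A y - z *\<^sub>C y)"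
    using norm_blinfun[of R "A y - z *\<^sub>C y"] resolves_left[OF R(1) y(1)] by simp
  ultimately show "norm (R' x) \<le> norm R * norm x" by (simp add: y_def)
qed simp

lemma adj_resolves:
  assumes A: "self_adjoint_on D A" and R: "resolves D A z R" "resolves D A (cnj z) R'"
  shows "adj R = R'"
proof (rule adj_eqI)
  fix x y
  have "cinner (R' x) y = cinner (R' x) (A (R y) - z *\<^sub>C R y)"
    by (simp add: resolves_right[OF R(1)])
  also have "\<dots> = cinner (A (R' x) - cnj z *\<^sub>C R' x) (R y)"
    using self_adjoint_onD(4)[OF A resolves_mem[OF R(2)] resolves_mem[OF R(1)]]
    by (simp add: cinner.diff_left cinner.diff_right cinner_scaleC_left cinner_scaleC_right)
  also have "\<dots> = cinner x (R y)" by (simp add: resolves_right[OF R(2)])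
  finally show "cinner (R' x) y = cinner x (R y)" .
qed

lemma diff_eq_flip: "a = b - c \<Longrightarrow> b - a = c" for a b c :: "'a::ab_group_add"
  by simp

lemma resolvent_identity:
  assumes R: "resolves D A z R" and S: "resolves D A w S"
  shows "R x - S x = (z - w) *\<^sub>C R (S x)"
proof -
  have "S x = R (A (S x) - z *\<^sub>C S x)"
    by (rule resolves_left[OF R resolves_mem[OF S], symmetric])
  also have "A (S x) - z *\<^sub>C S x = x - (z - w) *\<^sub>C S x"
    by (simp add: resolves_right[OF S] scaleC.diff_left)
  also have "R \<dots> = R x - (z - w) *\<^sub>C R (S x)"
    by (simp add: blinfun.diff_right clinear_opD[OF resolves_clinear[OF R]])
  finally show ?thesis by (rule diff_eq_flip)
qed

lemma resolvent_perturb: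
  assumes R: "resolves D A z R" and S: "resolves D (perturb A V) z S"
  shows "S x - R x = - R (V (S x))" and "S x - R x = - S (V (R x))"
proof -
  have "S x = R (A (S x) - z *\<^sub>C S x)"
    by (rule resolves_left[OF R resolves_mem[OF S], symmetric])
  also have "A (S x) - z *\<^sub>C S x = x - V (S x)"
    using resolves_right[OF S, of x] by (simp add: perturb_def algebra_simps)
  finally have "S x = R x - R (V (S x))" by (simp only: blinfun.diff_right)
  then show "S x - R x = - R (V (S x))" using diff_eq_flip minus_diff_eq by metis
  have "R x = S (perturb A V (R x) - z *\<^sub>C R x)"
    by (rule resolves_left[OF S resolves_mem[OF R], symmetric])
  also have "perturb A V (R x) - z *\<^sub>C R x = x + V (R x)"
    by (simp add: perturb_def resolves_right[OF R])
  finally have "R x = S x - (- S (V (R x)))" by (simp only: blinfun.add_right diff_minus_eq_add)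
  then show "S x - R x = - S (V (R x))" by (rule diff_eq_flip)
qed

text \<open>Adding a bounded symmetric \<open>V\<close> shears the adjoint graph by
  \<open>V\<close>, exactly as it shears the graph itself.\<close>

lemma self_adjoint_perturb:
  assumes A: "self_adjoint_on D A" and V: "clinear_op V" "adj V = V"
  shows "self_adjoint_on D (perturb A V)"
proof -
  have sym: "cinner x (V y) = cinner (V x) y" for x y
    using cinner_adj_left[OF V(1)] V(2) by simp
  have "(v, w) \<in> adjoint_graph D (perturb A V) \<longleftrightarrow> (v, w - V v) \<in> adjoint_graph D A" for v w
    by (auto simp: adjoint_graph_def perturb_def cinner.add_right cinner.diff_left sym algebra_simps)
  moreover have "adjoint_graph D A = {(x, A x) | x. x \<in> D}"
    using A by (simp add: self_adjoint_on_def)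
  ultimately have "adjoint_graph D (perturb A V) = {(x, perturb A V x) | x. x \<in> D}"
    by (auto simp: perturb_def algebra_simps)
  then show ?thesis
    using A by (auto simp: self_adjoint_on_def perturb_def blinfun.add_right clinear_opD[OF V(1)] scaleC_add_right)
qed

section \<open>Positive operators and square roots\<close>

lemma positive_op_clinear: "positive_op T \<Longrightarrow> clinear_op T"
  by (simp add: positive_op_def)

lemma positive_op_Re: "positive_op T \<Longrightarrow> Re (cinner x (T x)) \<ge> 0"
  and positive_op_Im: "positive_op T \<Longrightarrow> Im (cinner x (T x)) = 0"
  by (auto simp: positive_op_def complex_nonneg_Reals_iff)

lemma positive_opI:
  "clinear_op T \<Longrightarrow> (\<And>x. Re (cinner x (T x)) \<ge> 0) \<Longrightarrow> (\<And>x. Im (cinner x (T x)) = 0) \<Longrightarrow> positive_op T"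
  by (auto simp: positive_op_def complex_nonneg_Reals_iff)

text \<open>Polarisation: the quadratic form is real at x + y and at x + i y.\<close>

lemma positive_op_adj:
  assumes T: "positive_op T"
  shows "adj T = T"
proof (rule adj_eqI)
  fix x y
  define b where "b x y = cinner x (T y)" for x y
  have bxx: "Im (b u u) = 0" for u using T by (simp add: b_def positive_op_Im)
  have 1: "Im (b x y + b y x) = 0"
    using bxx[of "x + y"] bxx[of x] bxx[of y]
    by (simp add: b_def blinfun.add_right cinner_add_left cinner_add_right)
  have 2: "Re (b x y - b y x) = 0"
    using bxx[of "x + \<i> *\<^sub>C y"] bxx[of x] bxx[of y]
    by (simp add: b_def blinfun.add_right cinner_add_left cinner_add_right cinner_scaleC_left
        cinner_scaleC_right clinear_opD[OF positive_op_clinear[OF T]])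
  have "cinner (T x) y = cnj (b y x)" by (metis b_def cinner_commute)
  also have "\<dots> = b x y" using 1 2 by (simp add: complex_eq_iff)
  finally show "cinner (T x) y = cinner x (T y)" by (simp add: b_def)
qed

lemma positive_op_sym: "positive_op T \<Longrightarrow> cinner (T x) y = cinner x (T y)"
  using cinner_adj_left[OF positive_op_clinear, of T] positive_op_adj[of T] by simp

text \<open>Positivity of the form at x - t T x, with t = 1 / norm T minimising the resulting
  quadratic bound. It replaces spectral calculus in the construction of square roots.\<close>

lemma positive_op_norm_sq_le:
  assumes T: "positive_op T"
  shows "norm (T x) ^ 2 \<le> norm T * Re (cinner x (T x))"
proof (cases "norm T = 0")
  case False
  define t where "t = 1 / norm T"
  have t: "t > 0" using False by (simp add: t_def)
  define N where "N = norm (T x) ^ 2"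
  have a: "Re (cinner x (T (T x))) = N"
    by (simp add: N_def positive_op_sym[OF T, symmetric] cinner_self)
  have b: "Re (cinner (T x) (T x)) = N"
    by (simp add: N_def cinner_self)
  have c: "Re (cinner (T x) (T (T x))) \<le> norm T * N"
  proof -
    have "Re (cinner (T x) (T (T x))) \<le> norm (T x) * norm (T (T x))"
      by (simp add: Re_cinner norm_cauchy_schwarz)
    also have "\<dots> \<le> norm (T x) * (norm T * norm (T x))"
      by (intro mult_left_mono norm_blinfun) auto
    finally show ?thesis by (simp add: N_def power2_eq_square algebra_simps)
  qed
  have "0 \<le> Re (cinner (x - t *\<^sub>R T x) (T (x - t *\<^sub>R T x)))" by (rule positive_op_Re[OF T])
  also have "\<dots> = Re (cinner x (T x)) - 2 * t * N + t\<^sup>2 * Re (cinner (T x) (T (T x)))"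
    by (simp add: blinfun.diff_right blinfun.scaleR_right cinner.diff_left cinner.diff_right
        cinner.scaleR_left cinner.scaleR_right a b power2_eq_square algebra_simps)
  also have "\<dots> \<le> Re (cinner x (T x)) - 2 * t * N + t\<^sup>2 * (norm T * N)"
    using c by (intro add_left_mono mult_left_mono) auto
  also have "t\<^sup>2 * (norm T * N) = t * N"
    using False by (simp add: t_def power2_eq_square)
  finally have "t * N \<le> Re (cinner x (T x))" by (simp add: mult.commute)
  then show ?thesis using False by (simp add: t_def N_def field_simps)
qed simp

text \<open>A fixed point of S = (B + S^2)/2 satisfies (1 - S)^2 = 1 - B. For norm B = 1 the map
  need not be a strict contraction, so the iterates are compared with the scalar iteration
  \<open>s\<close> for B = 1: it is increasing and bounded by 1, and its increments dominate those
  of \<open>X\<close>. Whatever commutes with \<open>B\<close> commutes with every iterate and so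
  with the limit.\<close>

lemma sqrt_iteration:
  fixes B :: "'a::complex_hilbert_space oper"
  assumes B: "norm B \<le> 1" "clinear_op B" "adj B = B"
  obtains S where "clinear_op S" "adj S = S" "norm S \<le> 1" "(id_blinfun - S) o\<^sub>L (id_blinfun - S) = id_blinfun - B"
    "\<And>C. C o\<^sub>L B = B o\<^sub>L C \<Longrightarrow> C o\<^sub>L S = S o\<^sub>L C"
proof -
  define s :: "nat \<Rightarrow> real" where "s = rec_nat 0 (\<lambda>_ x. (1 + x\<^sup>2) / 2)"
  define X :: "nat \<Rightarrow> 'a oper" where "X = rec_nat 0 (\<lambda>_ T. (1/2) *\<^sub>R (B + (T o\<^sub>L T)))"
  have s: "s 0 = 0" "\<And>n. s (Suc n) = (1 + (s n)\<^sup>2) / 2" by (simp_all add: s_def)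
  have X: "X 0 = 0" "\<And>n. X (Suc n) = (1/2) *\<^sub>R (B + (X n o\<^sub>L X n))" by (simp_all add: X_def)
  have s01: "0 \<le> s n \<and> s n \<le> 1" for n
    by (induction n) (auto simp: s abs_square_le_1)
  have s_mono: "s n \<le> s (Suc n)" for n
  proof -
    have "0 \<le> (s n - 1)\<^sup>2" by simp
    then show ?thesis by (simp add: s power2_diff)
  qed
  have X_le: "norm (X n) \<le> s n" for n
  proof (induction n)
    case (Suc n)
    have "norm (X (Suc n)) \<le> (norm B + norm (X n o\<^sub>L X n)) / 2"
      using norm_triangle_ineq[of B "X n o\<^sub>L X n"] by (simp add: X)
    also have "\<dots> \<le> (1 + norm (X n) * norm (X n)) / 2"
      using B norm_blinfun_compose[of "X n" "X n"] by simp
    also have "\<dots> \<le> (1 + s n * s n) / 2"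
      using Suc s01[of n] by (intro divide_right_mono add_left_mono mult_mono) auto
    finally show ?case by (simp add: s power2_eq_square)
  qed (simp add: s X)
  have diff_sq: "(1/2) *\<^sub>R (B + (T o\<^sub>L T)) - (1/2) *\<^sub>R (B + (U o\<^sub>L U)) =
      (1/2) *\<^sub>R (((T - U) o\<^sub>L T) + (U o\<^sub>L (T - U)))" for T U :: "'a oper"
    by (rule blinfun_eqI) (simp add: blinfun.diff_left blinfun.diff_right blinfun.add_left
        blinfun.scaleR_left scaleR_diff_right scaleR_add_right)
  have dX: "norm (X (Suc n) - X n) \<le> s (Suc n) - s n" for n
  proof (induction n)
    case 0
    then show ?case using B by (simp add: X s)
  next
    case (Suc n)
    have "X (Suc (Suc n)) - X (Suc n) =
        (1/2) *\<^sub>R (((X (Suc n) - X n) o\<^sub>L X (Suc n)) + (X n o\<^sub>L (X (Suc n) - X n)))"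
      unfolding diff_sq[symmetric] by (simp only: X(2))
    then have "norm (X (Suc (Suc n)) - X (Suc n)) \<le>
        (norm ((X (Suc n) - X n) o\<^sub>L X (Suc n)) + norm (X n o\<^sub>L (X (Suc n) - X n))) / 2"
      using norm_triangle_ineq[of "(X (Suc n) - X n) o\<^sub>L X (Suc n)" "X n o\<^sub>L (X (Suc n) - X n)"] by simp
    also have "\<dots> \<le> (norm (X (Suc n) - X n) * norm (X (Suc n)) + norm (X n) * norm (X (Suc n) - X n)) / 2"
      using norm_blinfun_compose[of "X (Suc n) - X n" "X (Suc n)"] norm_blinfun_compose[of "X n" "X (Suc n) - X n"]
      by simp
    also have "\<dots> \<le> ((s (Suc n) - s n) * s (Suc n) + s n * (s (Suc n) - s n)) / 2"
      using Suc X_le s01 s_mono by (intro divide_right_mono add_mono mult_mono) auto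
    \<comment> \<open>The bound is (s(n+1)^2 - s(n)^2) / 2, which the recursion identifies with the
      next increment.\<close>
    also have "\<dots> = s (Suc (Suc n)) - s (Suc n)"
      unfolding s(2)[of "Suc n"] by (subst (5) s(2)) (simp only: power2_eq_square, simp add: power2_eq_square field_simps)
    finally show ?case .
  qed
  have dX': "norm (X (n + k) - X n) \<le> s (n + k) - s n" for n k
  proof (induction k)
    case (Suc k)
    have "norm (X (n + Suc k) - X n) \<le> norm (X (Suc (n + k)) - X (n + k)) + norm (X (n + k) - X n)"
      using norm_triangle_ineq[of "X (Suc (n + k)) - X (n + k)" "X (n + k) - X n"] by simp
    then show ?case using Suc dX[of "n + k"] by simp
  qed simp
  have "Cauchy s"
  proof -
    have "incseq s" by (rule incseq_SucI) (rule s_mono)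
    then have "convergent s"
      using s01 by (intro Bseq_monoseq_convergent BseqI'[where K = 1]) (auto simp: incseq_imp_monoseq)
    then show ?thesis by (rule convergent_Cauchy)
  qed
  have "Cauchy X"
  proof (rule CauchyI')
    fix e :: real assume "e > 0"
    with \<open>Cauchy s\<close> obtain M where M: "\<And>m n. m \<ge> M \<Longrightarrow> n \<ge> M \<Longrightarrow> norm (s m - s n) < e"
      unfolding Cauchy_iff by meson
    have "norm (X m - X n) < e" if "m \<ge> M" "n > m" for m n
    proof -
      have "norm (X m - X n) \<le> s n - s m"
        using dX'[of m "n - m"] that by (simp add: norm_minus_commute)
      then show ?thesis using M[of n m] that by simp
    qed
    then show "\<exists>M. \<forall>m\<ge>M. \<forall>n>m. dist (X m) (X n) < e" by (auto simp: dist_norm)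
  qed
  then obtain S where S: "X \<longlonglongrightarrow> S" using Cauchy_convergent convergentD by blast
  show thesis
  proof (rule that)
    have cl: "clinear_op (X n)" for n
      by (induction n) (auto simp: X intro: B)
    show S_cl: "clinear_op S" by (rule clinear_limit[OF cl S])
    have Xadj: "adj (X n) = X n" for n
    proof (induction n)
      case 0
      show ?case by (rule adj_eqI) (simp add: X cinner.zero_left)
    next
      case (Suc n)
      have 1: "clinear_op (X n o\<^sub>L X n)" by (intro clinear_compose cl)
      have 2: "clinear_op (B + (X n o\<^sub>L X n))" by (intro clinear_add B 1)
      show ?case by (simp add: X adj_scaleR[OF 2] adj_add[OF B(2) 1] adj_compose[OF cl cl] B Suc)
    qed
    show "adj S = S"
    proof (rule adj_eqI)
      fix x y
      have 1: "(\<lambda>n. cinner (X n x) y) \<longlonglongrightarrow> cinner (S x) y"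
        by (intro cinner.tendsto tendsto_intros S)
      have 2: "(\<lambda>n. cinner x (X n y)) \<longlonglongrightarrow> cinner x (S y)"
        by (intro cinner.tendsto tendsto_intros S)
      have "(\<lambda>n. cinner (X n x) y) = (\<lambda>n. cinner x (X n y))"
        using cinner_adj_left[OF cl] by (simp add: Xadj)
      with 1 2 show "cinner (S x) y = cinner x (S y)" using LIMSEQ_unique by metis
    qed
    show "norm S \<le> 1"
      by (rule LIMSEQ_le_const2[OF tendsto_norm[OF S]])
         (use X_le s01 order_trans in blast)
    have "(\<lambda>n. X (Suc n)) \<longlonglongrightarrow> (1/2) *\<^sub>R (B + (S o\<^sub>L S))"
      unfolding X by (intro tendsto_intros S bounded_bilinear.tendsto[OF bounded_bilinear_blinfun_compose])
    then have S_eq: "S = (1/2) *\<^sub>R (B + (S o\<^sub>L S))"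
      using LIMSEQ_unique LIMSEQ_Suc[OF S] by blast
    have "S x + S x = B x + S (S x)" for x
      by (subst (1 2) S_eq) (simp add: blinfun.scaleR_left blinfun.add_left scaleR_add_right[symmetric]
          scaleR_2[symmetric])
    then show "(id_blinfun - S) o\<^sub>L (id_blinfun - S) = id_blinfun - B"
      by (intro blinfun_eqI) (simp add: blinfun.diff_left blinfun.diff_right algebra_simps)
    show "C o\<^sub>L S = S o\<^sub>L C" if C: "C o\<^sub>L B = B o\<^sub>L C" for C
    proof -
      have CB: "C (B x) = B (C x)" for x
        by (rule blinfun_compose_eqD[OF C])
      have "C (X n x) = X n (C x)" for n x
        by (induction n arbitrary: x)
           (simp_all add: X blinfun.scaleR_left blinfun.scaleR_right blinfun.add_left blinfun.add_right CB)
      then have *: "(\<lambda>n. C o\<^sub>L X n) = (\<lambda>n. X n o\<^sub>L C)"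
        by (intro ext blinfun_eqI) simp
      have "(\<lambda>n. C o\<^sub>L X n) \<longlonglongrightarrow> (C o\<^sub>L S)" "(\<lambda>n. X n o\<^sub>L C) \<longlonglongrightarrow> (S o\<^sub>L C)"
        by (intro tendsto_intros S bounded_bilinear.tendsto[OF bounded_bilinear_blinfun_compose])+
      then show ?thesis using * LIMSEQ_unique by metis
    qed
  qed
qed

text \<open>After division by \<open>r = norm A\<close>, the operator B = 1 - A/r is a contraction
  by \<open>positive_op_norm_sq_le\<close>, so the iteration applies. The commutation clause is
  exported for the proof of uniqueness.\<close>

lemma positive_sqrt_exists:
  fixes A :: "'a::complex_hilbert_space oper"
  assumes A: "positive_op A"
  obtains S where "positive_op S" "S o\<^sub>L S = A" "\<And>C. C o\<^sub>L A = A o\<^sub>L C \<Longrightarrow> C o\<^sub>L S = S o\<^sub>L C"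
proof (cases "A = 0")
  case True
  have "positive_op (0 :: 'a oper)" by (simp add: positive_op_def)
  then show ?thesis using True that[of 0] by (simp add: blinfun_eqI)
next
  case False
  define r where "r = norm A"
  have r: "r > 0" using False by (simp add: r_def)
  define A' where "A' = (1 / r) *\<^sub>R A"
  have clA: "clinear_op A" "clinear_op A'"
    using A by (auto simp: A'_def positive_op_clinear)
  have qA': "cinner x (A' x) = cinner x (A x) / r" for x
    by (simp add: A'_def blinfun.scaleR_left cinner.scaleR_right scaleR_conv_of_real)
  have posA': "positive_op A'"
    by (rule positive_opI[OF clA(2)]) (use r in \<open>simp_all add: qA' positive_op_Re[OF A] positive_op_Im[OF A]\<close>)
  have nA': "norm A' = 1" using r by (simp add: A'_def r_def)
  define B where "B = id_blinfun - A'"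
  have B: "norm B \<le> 1" "clinear_op B" "adj B = B"
  proof -
    show "norm B \<le> 1"
    proof (rule norm_blinfun_bound)
      fix x
      have "norm (B x) ^ 2 = norm x ^ 2 - 2 * Re (cinner x (A' x)) + norm (A' x) ^ 2"
        by (simp add: B_def blinfun.diff_left norm_diff_sq)
      also have "\<dots> \<le> norm x ^ 2"
        using positive_op_norm_sq_le[OF posA', of x] positive_op_Re[OF posA', of x] by (simp add: nA')
      finally show "norm (B x) \<le> 1 * norm x" using power2_le_imp_le by fastforce
    qed simp
    show "clinear_op B" unfolding B_def by (intro clinear_diff clA clinear_id)
    show "adj B = B" unfolding B_def by (subst adj_diff) (simp_all add: clA positive_op_adj[OF posA'])
  qed
  obtain S where S: "clinear_op S" "adj S = S" "norm S \<le> 1"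
    "(id_blinfun - S) o\<^sub>L (id_blinfun - S) = id_blinfun - B"
    "\<And>C. C o\<^sub>L B = B o\<^sub>L C \<Longrightarrow> C o\<^sub>L S = S o\<^sub>L C"
    using sqrt_iteration[OF B] by blast
  define Q where "Q = sqrt r *\<^sub>R (id_blinfun - S)"
  have Qx: "Q x = sqrt r *\<^sub>R (x - S x)" for x
    by (simp add: Q_def blinfun.scaleR_left blinfun.diff_left)
  have imS: "Im (cinner x (S x)) = 0" for x
  proof -
    have "cinner x (S x) = cinner (S x) x" using cinner_adj_left[OF S(1), of x x] S(2) by simp
    then have "cnj (cinner x (S x)) = cinner x (S x)" using cinner_commute by metis
    then show ?thesis by (simp add: complex_eq_iff)
  qed
  have reS: "Re (cinner x (S x)) \<le> norm x ^ 2" for x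
  proof -
    have "Re (cinner x (S x)) \<le> norm x * norm (S x)" by (simp add: Re_cinner norm_cauchy_schwarz)
    also have "norm (S x) \<le> 1 * norm x"
      using norm_blinfun[of S x] S(3) mult_right_mono[OF S(3) norm_ge_zero[of x]] by linarith
    finally show ?thesis by (simp add: power2_eq_square mult_left_mono)
  qed
  have qQ: "cinner x (Q x) = complex_of_real (sqrt r) * (complex_of_real (norm x ^ 2) - cinner x (S x))" for x
    by (simp add: Qx cinner.scaleR_right cinner.diff_right cinner_self scaleR_conv_of_real)
  show thesis
  proof (rule that)
    show "positive_op Q"
    proof (rule positive_opI)
      show "clinear_op Q" unfolding Q_def by (intro clinear_scaleR clinear_diff S clinear_id)
      show "0 \<le> Re (cinner x (Q x))" for x using r reS[of x] by (simp add: qQ)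
      show "Im (cinner x (Q x)) = 0" for x using imS[of x] by (simp add: qQ)
    qed
    show "Q o\<^sub>L Q = A"
    proof (rule blinfun_eqI)
      fix x
      have "x - S x - S (x - S x) = A' x"
        using arg_cong[OF S(4), of "\<lambda>T. T x"] by (simp add: B_def blinfun.diff_left blinfun.diff_right)
      then have "Q (Q x) = sqrt r *\<^sub>R sqrt r *\<^sub>R A' x"
        by (simp only: Qx blinfun.scaleR_right blinfun.diff_right flip: scaleR_diff_right)
      then show "(Q o\<^sub>L Q) x = A x" using r by (simp add: A'_def blinfun.scaleR_left)
    qed
    show "C o\<^sub>L Q = Q o\<^sub>L C" if C: "C o\<^sub>L A = A o\<^sub>L C" for C
    proof -
      have "C (A x) = A (C x)" for x by (rule blinfun_compose_eqD[OF C])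
      then have "C o\<^sub>L B = B o\<^sub>L C"
        by (intro blinfun_eqI) (simp add: B_def A'_def blinfun.diff_left blinfun.diff_right
            blinfun.scaleR_left blinfun.scaleR_right)
      then have "C (S x) = S (C x)" for x by (rule blinfun_compose_eqD[OF S(5)])
      then show ?thesis by (intro blinfun_eqI) (simp add: Qx blinfun.diff_right blinfun.scaleR_right)
    qed
  qed
qed

lemma positive_op_zero_imp: "positive_op T \<Longrightarrow> Re (cinner x (T x)) = 0 \<Longrightarrow> T x = 0"
  using positive_op_norm_sq_le[of T x] by simp

text \<open>With d = S - Q, commutation gives d S + d Q = S^2 - Q^2 = 0. Hence the nonnegative forms
  of \<open>S\<close> and \<open>Q\<close> at d x add up to 0 and both vanish; then d^2 = 0, and d =
  0 because d is symmetric.\<close>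

lemma positive_sqrt_unique:
  fixes S Q :: "'a::complex_hilbert_space oper"
  assumes S: "positive_op S" and Q: "positive_op Q" and eq: "S o\<^sub>L S = Q o\<^sub>L Q"
    and comm: "S o\<^sub>L Q = Q o\<^sub>L S"
  shows "S = Q"
proof (rule blinfun_eqI)
  fix x
  define d where "d v = S v - Q v" for v
  have SS: "S (S v) = Q (Q v)" and SQ: "S (Q v) = Q (S v)" for v
    by (rule blinfun_compose_eqD[OF eq], rule blinfun_compose_eqD[OF comm])
  have d_sym: "cinner (d u) v = cinner u (d v)" for u v
    by (simp add: d_def cinner.diff_left cinner.diff_right positive_op_sym S Q)
  have "cinner (d x) (S (d x)) + cinner (d x) (Q (d x)) = cinner x (d (S (d x)) + d (Q (d x)))"
    by (simp add: d_sym cinner_add_right)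
  also have "d (S v) + d (Q v) = 0" for v
    by (simp add: d_def SS SQ)
  finally have "Re (cinner (d x) (S (d x))) + Re (cinner (d x) (Q (d x))) = 0"
    by (metis cinner_zero_right plus_complex.sel(1) zero_complex.sel(1))
  then have "Re (cinner (d x) (S (d x))) = 0" "Re (cinner (d x) (Q (d x))) = 0"
    using positive_op_Re[OF S, of "d x"] positive_op_Re[OF Q, of "d x"] by linarith+
  then have "S (d x) = 0" "Q (d x) = 0" using S Q positive_op_zero_imp by blast+
  then have "d (d x) = 0" by (simp add: d_def)
  then have "cinner (d x) (d x) = 0" by (simp add: d_sym)
  then show "S x = Q x" by (simp add: cinner_self d_def)
qed

text \<open>Any competing root \<open>Q\<close> commutes with its own square and therefore with
  \<open>S\<close>, which is the commutation that \<open>positive_sqrt_unique\<close>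
  requires.\<close>

lemma abs_op_works:
  assumes T: "clinear_op T"
  shows "positive_op (abs_op T)" and "abs_op T o\<^sub>L abs_op T = adj T o\<^sub>L T"
proof -
  define A where "A = adj T o\<^sub>L T"
  have A: "positive_op A"
  proof (rule positive_opI)
    show "clinear_op A" unfolding A_def using T by auto
    show "0 \<le> Re (cinner x (A x))" "Im (cinner x (A x)) = 0" for x
      by (simp_all add: A_def cinner_adj_right T cinner_self)
  qed
  obtain S where S: "positive_op S" "S o\<^sub>L S = A" "\<And>C. C o\<^sub>L A = A o\<^sub>L C \<Longrightarrow> C o\<^sub>L S = S o\<^sub>L C"
    using positive_sqrt_exists[OF A] by blast
  have "abs_op T = S"
    unfolding abs_op_def A_def[symmetric]
  proof (rule the_equality)
    show "positive_op S \<and> S o\<^sub>L S = A" using S by blast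
    fix Q assume Q: "positive_op Q \<and> Q o\<^sub>L Q = A"
    then have A': "A = Q o\<^sub>L Q" by simp
    have "Q o\<^sub>L S = S o\<^sub>L Q"
      by (rule S(3), rule blinfun_eqI) (simp add: A')
    then show "Q = S"
      by (rule positive_sqrt_unique[OF conjunct1[OF Q] S(1) trans[OF conjunct2[OF Q] S(2)[symmetric]]])
  qed
  then show "positive_op (abs_op T)" "abs_op T o\<^sub>L abs_op T = adj T o\<^sub>L T"
    using S(1,2) by (simp_all add: A_def)
qed

text \<open>Both \<open>T\<close> and \<open>abs_op T\<close> are positive roots of T^2. They are
  compared through the constructed root \<open>S\<close>, with which each of them commutes.\<close>

lemma abs_op_positive:
  assumes T: "positive_op T"
  shows "abs_op T = T"
proof -
  note T' = positive_op_clinear[OF T]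
  obtain S where S: "positive_op S" "S o\<^sub>L S = T o\<^sub>L T"
    "\<And>C. C o\<^sub>L (T o\<^sub>L T) = (T o\<^sub>L T) o\<^sub>L C \<Longrightarrow> C o\<^sub>L S = S o\<^sub>L C"
  proof -
    have "cinner x (T (T x)) = complex_of_real (norm (T x) ^ 2)" for x
      by (simp only: positive_op_sym[OF T, of x "T x", symmetric] cinner_self)
    then have "positive_op (T o\<^sub>L T)"
      by (intro positive_opI clinear_compose T') (simp_all add: power2_eq_square)
    then show thesis using positive_sqrt_exists that by blast
  qed
  have uniq: "Q = S" if "positive_op Q" "Q o\<^sub>L Q = T o\<^sub>L T" for Q
  proof -
    have "Q o\<^sub>L S = S o\<^sub>L Q"
      by (rule S(3), rule blinfun_eqI) (simp add: that(2)[symmetric])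
    then show ?thesis
      by (rule positive_sqrt_unique[OF that(1) S(1) trans[OF that(2) S(2)[symmetric]]])
  qed
  have "abs_op T = S"
    using uniq[of "abs_op T"] abs_op_works[OF T'] by (simp add: positive_op_adj[OF T])
  also have "S = T" using uniq[of T] T by simp
  finally show ?thesis .
qed

section \<open>Orthonormal bases as sequences\<close>

definition projection :: "'a::complex_hilbert_space oper \<Rightarrow> bool"
  where "projection P \<longleftrightarrow> clinear_op P \<and> P o\<^sub>L P = P \<and> adj P = P"

lemma projection_id [simp]: "projection id_blinfun"
  by (simp add: projection_def blinfun_eqI)

lemma projection_clinear: "projection P \<Longrightarrow> clinear_op P"
  by (simp add: projection_def)

lemma projection_idem: "projection P \<Longrightarrow> P (P x) = P x"
  unfolding projection_def by (metis blinfun_apply_blinfun_compose)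

lemma projection_sym: "projection P \<Longrightarrow> cinner (P x) y = cinner x (P y)"
  using cinner_adj_left[of P x y] by (simp add: projection_def)

lemma projection_cinner: "projection P \<Longrightarrow> cinner x (P x) = complex_of_real (norm (P x) ^ 2)"
  by (metis cinner_self projection_idem projection_sym)

lemma projection_norm_le:
  assumes "projection P"
  shows "norm (P x) \<le> norm x"
proof (cases "P x = 0")
  case False
  have "norm (P x) ^ 2 = cmod (cinner x (P x))"
    by (simp add: projection_cinner[OF assms] norm_power)
  also have "\<dots> \<le> norm x * norm (P x)" by (rule cinner_norm_le)
  finally show ?thesis using False by (simp add: power2_eq_square)
qed simp

text \<open>A Parseval frame of \<open>range P\<close>, the sequence form of an orthonormal basis.\<close>

definition frame :: "'a::complex_hilbert_space oper \<Rightarrow> (nat \<Rightarrow> 'a) \<Rightarrow> bool"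
  where "frame P e \<longleftrightarrow> (\<forall>x y. ((\<lambda>n. cinner x (e n) * cinner (e n) y) has_sum cinner x (P y)) UNIV)"

lemma onb_best_approximation:
  fixes F :: "'a::complex_hilbert_space set"
  assumes F: "finite F" and on: "\<And>e f. e \<in> F \<Longrightarrow> f \<in> F \<Longrightarrow> cinner e f = (if e = f then 1 else 0)"
    and u: "u \<in> complex_vector.span F"
  shows "norm (v - (\<Sum>e\<in>F. cinner e v *\<^sub>C e)) \<le> norm (v - u)"
proof -
  define p where "p = (\<Sum>e\<in>F. cinner e v *\<^sub>C e)"
  have "cinner f (v - p) = 0" if f: "f \<in> F" for f
  proof -
    have "cinner f p = (\<Sum>e\<in>F. cinner e v * (if f = e then 1 else 0))"
      unfolding p_def cinner.sum_right cinner_scaleC_right using on f by (intro sum.cong) auto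
    also have "\<dots> = cinner f v"
      using F f by (simp add: if_distrib[of "\<lambda>x. _ * x"] sum.delta cong: if_cong)
    finally show ?thesis by (simp add: cinner.diff_right)
  qed
  then have orth: "cinner (v - p) f = 0" if "f \<in> F" for f
    using cinner_commute[of "v - p" f] that by simp
  have "complex_vector.subspace {x. cinner (v - p) x = 0}"
    by (rule complex_vector.subspaceI) (simp_all add: cinner_add_right cinner_scaleC_right)
  then have "complex_vector.span F \<subseteq> {x. cinner (v - p) x = 0}"
    using orth by (intro complex_vector.span_minimal) auto
  moreover have "p - u \<in> complex_vector.span F"
    unfolding p_def using u
    by (intro complex_vector.span_diff u complex_vector.span_sum complex_vector.span_scale complex_vector.span_base)
  ultimately have 0: "cinner (v - p) (u - p) = 0"
    using cinner.minus_right[of "v - p" "p - u"] by auto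
  have "norm (v - p - (u - p)) ^ 2 = norm (v - p) ^ 2 + norm (u - p) ^ 2"
    unfolding norm_diff_sq 0 by simp
  then have "norm (v - p) ^ 2 \<le> norm (v - u) ^ 2" by simp
  then show ?thesis unfolding p_def by (rule power2_le_imp_le) simp
qed

text \<open>Density only provides some nearby \<open>u\<close> in the span of a finite
  \<open>F\<close>. By best approximation the Fourier sum over every finite set containing
  \<open>F\<close> is at least as close, which is unordered convergence.\<close>

lemma onb_expansion:
  assumes B: "is_onb M B" and v: "v \<in> M"
  shows "((\<lambda>e. cinner e v *\<^sub>C e) has_sum v) B"
  unfolding has_sum_def tendsto_iff eventually_finite_subsets_at_top
proof (intro allI impI)
  fix r :: real assume "r > 0"
  have on: "\<And>e f. e \<in> B \<Longrightarrow> f \<in> B \<Longrightarrow> cinner e f = (if e = f then 1 else 0)"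
    and cl: "closure (complex_vector.span B) = M"
    using B by (auto simp: is_onb_def)
  obtain u where u: "u \<in> complex_vector.span B" "dist u v < r"
    using v cl \<open>r > 0\<close> closure_approachable by metis
  obtain F c where F: "finite F" "F \<subseteq> B" and uF: "u = (\<Sum>a\<in>F. c a *\<^sub>C a)"
    using u(1) unfolding complex_vector.span_explicit by auto
  have "dist (\<Sum>e\<in>G. cinner e v *\<^sub>C e) v < r" if G: "finite G \<and> F \<subseteq> G \<and> G \<subseteq> B" for G
  proof -
    have onG: "cinner e f = (if e = f then 1 else 0)" if "e \<in> G" "f \<in> G" for e f
      by (rule on) (use that G in blast)+
    have "u \<in> complex_vector.span G"
      unfolding uF using G
      by (intro complex_vector.span_sum complex_vector.span_scale complex_vector.span_base) auto
    then have "norm (v - (\<Sum>e\<in>G. cinner e v *\<^sub>C e)) \<le> norm (v - u)"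
      using G onG by (intro onb_best_approximation) auto
    then show ?thesis using u(2) by (simp add: dist_norm norm_minus_commute)
  qed
  with F show "\<exists>X. finite X \<and> X \<subseteq> B \<and> (\<forall>Y. finite Y \<and> X \<subseteq> Y \<and> Y \<subseteq> B \<longrightarrow> dist (\<Sum>e\<in>Y. cinner e v *\<^sub>C e) v < r)"
    by blast
qed

lemma onb_subset: "is_onb M B \<Longrightarrow> B \<subseteq> M"
  unfolding is_onb_def using closure_subset complex_vector.span_superset by blast

text \<open>Distinct basis vectors have distance sqrt 2, so balls of radius 1/2 around them are
  disjoint, and separability allows only countably many.\<close>

lemma onb_countable:
  fixes B :: "'a::{complex_hilbert_space, second_countable_topology} set"
  assumes "is_onb M B"
  shows "countable B"
proof -
  have dist: "dist e f > 1" if "e \<in> B" "f \<in> B" "e \<noteq> f" for e f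
  proof -
    have "cinner e e = 1" "cinner f f = 1" "cinner e f = 0"
      using assms that by (auto simp: is_onb_def)
    then have "norm (e - f) ^ 2 = 2"
      unfolding norm_diff_sq by (simp add: power2_norm_eq_cinner)
    then have "1\<^sup>2 < norm (e - f) ^ 2" by simp
    then show ?thesis unfolding dist_norm by (rule power2_less_imp_less) simp
  qed
  have disj: "disjnt (ball e (1/2)) (ball f (1/2))" if "e \<in> B" "f \<in> B" "e \<noteq> f" for e f
  proof -
    have False if "dist e x < 1/2" "dist f x < 1/2" for x
      using dist_triangle2[of e f x] dist[OF \<open>e \<in> B\<close> \<open>f \<in> B\<close> \<open>e \<noteq> f\<close>] that by linarith
    then show ?thesis by (auto simp: disjnt_iff)
  qed
  have "inj_on (\<lambda>e. ball e (1/2 :: real)) B"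
  proof (rule inj_onI)
    fix e f assume ef: "e \<in> B" "f \<in> B" "ball e (1/2 :: real) = ball f (1/2)"
    moreover have "e \<in> ball e (1/2)" by simp
    ultimately show "e = f" using disj[of e f] by (auto simp: disjnt_iff)
  qed
  moreover have "countable ((\<lambda>e. ball e (1/2 :: real)) ` B)"
    by (rule countable_disjoint_open_subsets) (use disj in \<open>auto simp: pairwise_def\<close>)
  ultimately show ?thesis using countable_image_inj_on by blast
qed

text \<open>Padding with zeros treats finite and infinite bases alike: zero vectors do not contribute to
  any of the sums below.\<close>

definition padded_seq :: "'a::zero set \<Rightarrow> nat \<Rightarrow> 'a"
  where "padded_seq B n = (if n \<in> to_nat_on B ` B then from_nat_into B n else 0)"

lemma padded_seq_mem: "countable B \<Longrightarrow> padded_seq B n \<in> insert 0 B"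
  unfolding padded_seq_def by (auto simp: from_nat_into_to_nat_on)

lemma has_sum_padded_seq:
  fixes f :: "'a::zero \<Rightarrow> 'b::{comm_monoid_add, topological_space}"
  assumes "countable B" "f 0 = 0"
  shows "((\<lambda>n. f (padded_seq B n)) has_sum c) UNIV \<longleftrightarrow> (f has_sum c) B"
proof -
  have "((\<lambda>n. f (padded_seq B n)) has_sum c) UNIV \<longleftrightarrow>
      ((\<lambda>n. f (from_nat_into B n)) has_sum c) (to_nat_on B ` B)"
    by (rule has_sum_cong_neutral) (auto simp: padded_seq_def assms)
  also have "\<dots> \<longleftrightarrow> (((\<lambda>n. f (from_nat_into B n)) \<circ> to_nat_on B) has_sum c) B"
    by (rule has_sum_reindex) (simp add: assms inj_on_to_nat_on)
  also have "\<dots> \<longleftrightarrow> (f has_sum c) B"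
    by (rule has_sum_cong) (simp add: assms)
  finally show ?thesis .
qed

lemma frame_onb:
  fixes B :: "'a::{complex_hilbert_space, second_countable_topology} set"
  assumes P: "projection P" and B: "is_onb (range P) B"
  shows "frame P (padded_seq B)"
  unfolding frame_def
proof (intro allI)
  fix x y
  have eq: "cinner e (P y) = cinner e y" if "e \<in> B" for e
    using onb_subset[OF B] that by (auto simp: projection_sym[OF P, symmetric] projection_idem[OF P])
  have "((\<lambda>e. cinner e (P y) *\<^sub>C e) has_sum P y) B"
    by (rule onb_expansion[OF B]) simp
  then have "((\<lambda>e. cinner x (cinner e (P y) *\<^sub>C e)) has_sum cinner x (P y)) B"
    by (rule has_sum_bounded_linear[OF cinner.bounded_linear_right])
  also have "?this \<longleftrightarrow> ((\<lambda>e. cinner x e * cinner e y) has_sum cinner x (P y)) B"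
    by (rule has_sum_cong) (simp add: cinner_scaleC_right eq)
  finally show "((\<lambda>n. cinner x (padded_seq B n) * cinner (padded_seq B n) y) has_sum cinner x (P y)) UNIV"
    by (subst has_sum_padded_seq[where f = "\<lambda>e. cinner x e * cinner e y"])
       (simp_all add: onb_countable[OF B])
qed

lemma frame_parseval:
  assumes P: "projection P" and e: "frame P e"
  shows "((\<lambda>n. cmod (cinner (e n) x) ^ 2) has_sum norm (P x) ^ 2) UNIV"
proof -
  have "((\<lambda>n. cinner x (e n) * cinner (e n) x) has_sum cinner x (P x)) UNIV"
    using e by (simp add: frame_def)
  moreover have "cinner x (e n) * cinner (e n) x = complex_of_real (cmod (cinner (e n) x) ^ 2)" for n
    by (subst cinner_commute) (simp add: complex_norm_square[symmetric] mult.commute)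
  ultimately have "((\<lambda>n. complex_of_real (cmod (cinner (e n) x) ^ 2)) has_sum
      complex_of_real (norm (P x) ^ 2)) UNIV"
    by (simp only: projection_cinner[OF P])
  then show ?thesis by (simp only: has_sum_of_real_iff)
qed

section \<open>Hilbert-Schmidt operators and traces of products\<close>

text \<open>Both sums are iterated sums of the nonnegative array |(f m, T e n)|^2. This is the basis
  independence of the Hilbert-Schmidt norm, with \<open>P\<close> and \<open>Q\<close> appearing
  because the frames may span proper subspaces.\<close>

lemma frame_swap_summable:
  fixes T P Q :: "'a::complex_hilbert_space oper"
  assumes PQ: "projection P" "projection Q" and e: "frame P e" and f: "frame Q f"
    and T: "clinear_op T" and sum: "((\<lambda>n. norm (Q (T (e n))) ^ 2) has_sum c) UNIV"
  shows "((\<lambda>(n, m). cmod (cinner (f m) (T (e n))) ^ 2) has_sum c) (UNIV \<times> UNIV)"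
    and "((\<lambda>m. norm (P (adj T (f m))) ^ 2) has_sum c) UNIV"
proof -
  define g where "g = (\<lambda>(n, m). cmod (cinner (f m) (T (e n))) ^ 2)"
  have inner: "((\<lambda>m. g (n, m)) has_sum norm (Q (T (e n))) ^ 2) UNIV" for n
    unfolding g_def using frame_parseval[OF PQ(2) f] by simp
  have "g summable_on (UNIV \<times> UNIV)"
    by (rule summable_on_SigmaI[OF inner]) (use sum in \<open>auto simp: g_def summable_on_def\<close>)
  with inner sum have g: "(g has_sum c) (UNIV \<times> UNIV)"
    by (intro has_sum_SigmaI) auto
  then show "((\<lambda>(n, m). cmod (cinner (f m) (T (e n))) ^ 2) has_sum c) (UNIV \<times> UNIV)"
    by (simp add: g_def)
  from g have "((\<lambda>(m, n). g (n, m)) has_sum c) (UNIV \<times> UNIV)"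
    by (subst (asm) has_sum_swap)
  then show "((\<lambda>m. norm (P (adj T (f m))) ^ 2) has_sum c) UNIV"
  proof (rule has_sum_SigmaD)
    fix m
    have "cmod (cinner (e n) (adj T (f m))) = cmod (cinner (f m) (T (e n)))" for n
      by (metis T cinner_adj_right cinner_commute complex_mod_cnj)
    then show "((\<lambda>n. case (m, n) of (m, n) \<Rightarrow> g (n, m)) has_sum norm (P (adj T (f m))) ^ 2) UNIV"
      using frame_parseval[OF PQ(1) e, of "adj T (f m)"] by (simp add: g_def)
  qed
qed

text \<open>The squared Hilbert-Schmidt norm of \<open>T\<close> is at most \<open>c\<close>; quantifying over all frames builds
  basis independence into the definition.\<close>

definition hs_le :: "'a::complex_hilbert_space oper \<Rightarrow> real \<Rightarrow> bool"
  where "hs_le T c \<longleftrightarrow> clinear_op T \<and> (\<forall>P e. projection P \<longrightarrow> frame P e \<longrightarrow>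
    (\<lambda>n. norm (T (e n)) ^ 2) summable_on UNIV \<and> (\<Sum>\<^sub>\<infinity>n. norm (T (e n)) ^ 2) \<le> c)"

lemma hs_le_clinear: "hs_le T c \<Longrightarrow> clinear_op T"
  by (simp add: hs_le_def)

lemma hs_leD:
  fixes T P :: "'a::complex_hilbert_space oper"
  assumes "hs_le T c" "projection P" "frame P e"
  shows "(\<lambda>n. norm (T (e n)) ^ 2) summable_on UNIV" and "(\<Sum>\<^sub>\<infinity>n. norm (T (e n)) ^ 2) \<le> c"
  using assms by (simp_all add: hs_le_def)

text \<open>Swapping turns the sum over an arbitrary frame of ran P into one over \<open>E\<close>
  with an extra \<open>P\<close> in front of \<open>adj T\<close>, and projecting only decreases
  it.\<close>

lemma hs_le_from_adj:
  fixes T :: "'a::complex_hilbert_space oper"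
  assumes E: "frame (id_blinfun :: 'a oper) E" and T: "clinear_op T"
    and sum: "(\<lambda>n. norm (adj T (E n)) ^ 2) summable_on UNIV" "(\<Sum>\<^sub>\<infinity>n. norm (adj T (E n)) ^ 2) \<le> c"
  shows "hs_le T c"
  unfolding hs_le_def
proof (intro conjI allI impI)
  fix P and e :: "nat \<Rightarrow> 'a" assume P: "projection P" "frame P e"
  have le: "norm (P (adj T (E n))) ^ 2 \<le> norm (adj T (E n)) ^ 2" for n
    by (intro power_mono projection_norm_le P) auto
  have s: "(\<lambda>n. norm (P (adj T (E n))) ^ 2) summable_on UNIV"
    by (rule summable_on_comparison_test[OF sum(1)]) (use le in auto)
  have "((\<lambda>n. norm (T (e n)) ^ 2) has_sum (\<Sum>\<^sub>\<infinity>n. norm (P (adj T (E n))) ^ 2)) UNIV"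
    using frame_swap_summable(2)[OF projection_id P(1) E P(2) clinear_adj[OF T] has_sum_infsum[OF s]] T
    by simp
  moreover have "(\<Sum>\<^sub>\<infinity>n. norm (P (adj T (E n))) ^ 2) \<le> (\<Sum>\<^sub>\<infinity>n. norm (adj T (E n)) ^ 2)"
    by (rule infsum_mono[OF s sum(1)]) (use le in auto)
  ultimately show "(\<lambda>n. norm (T (e n)) ^ 2) summable_on UNIV" "(\<Sum>\<^sub>\<infinity>n. norm (T (e n)) ^ 2) \<le> c"
    using sum(2) by (auto simp: has_sum_iff)
qed (fact T)

lemma hs_le_adj:
  fixes T :: "'a::complex_hilbert_space oper"
  assumes E: "frame (id_blinfun :: 'a oper) E" and T: "hs_le T c"
  shows "hs_le (adj T) c"
  by (rule hs_le_from_adj[OF E])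
     (use hs_leD[OF T projection_id E] in \<open>simp_all add: hs_le_clinear[OF T]\<close>)

text \<open>Passing to the adjoint twice transports a bound known for the single frame
  \<open>E\<close> to all frames.\<close>

lemma hs_leI:
  fixes T :: "'a::complex_hilbert_space oper"
  assumes E: "frame (id_blinfun :: 'a oper) E" and T: "clinear_op T"
    and sum: "(\<lambda>n. norm (T (E n)) ^ 2) summable_on UNIV"
  shows "hs_le T (\<Sum>\<^sub>\<infinity>n. norm (T (E n)) ^ 2)"
proof -
  have "hs_le (adj T) (\<Sum>\<^sub>\<infinity>n. norm (T (E n)) ^ 2)"
    by (rule hs_le_from_adj[OF E]) (use T sum in simp_all)
  then show ?thesis using hs_le_adj[OF E, of "adj T"] T by simp
qed

lemma hs_le_compose_left:
  fixes T :: "'a::complex_hilbert_space oper"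
  assumes T: "hs_le T c" and S: "clinear_op S" and k: "norm S \<le> k"
  shows "hs_le (S o\<^sub>L T) (k\<^sup>2 * c)"
  unfolding hs_le_def
proof (intro conjI allI impI)
  show "clinear_op (S o\<^sub>L T)" using S T hs_le_clinear by auto
  fix P and e :: "nat \<Rightarrow> 'a" assume P: "projection P" "frame P e"
  note sum = hs_leD[OF T P]
  have le: "norm ((S o\<^sub>L T) (e n)) ^ 2 \<le> k\<^sup>2 * norm (T (e n)) ^ 2" for n
  proof -
    have "norm (S (T (e n))) \<le> k * norm (T (e n))" by (rule norm_blinfun_le[OF k order_refl])
    then show ?thesis by (simp add: power_mult_distrib[symmetric] power_mono)
  qed
  have s2: "(\<lambda>n. k\<^sup>2 * norm (T (e n)) ^ 2) summable_on UNIV"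
    by (intro summable_on_cmult_right sum)
  show s: "(\<lambda>n. norm ((S o\<^sub>L T) (e n)) ^ 2) summable_on UNIV"
    by (rule summable_on_comparison_test[OF s2]) (use le in auto)
  have "(\<Sum>\<^sub>\<infinity>n. norm ((S o\<^sub>L T) (e n)) ^ 2) \<le> (\<Sum>\<^sub>\<infinity>n. k\<^sup>2 * norm (T (e n)) ^ 2)"
    by (rule infsum_mono[OF s s2]) (rule le)
  also have "\<dots> \<le> k\<^sup>2 * c"
    using sum by (simp add: infsum_cmult_right mult_left_mono)
  finally show "(\<Sum>\<^sub>\<infinity>n. norm ((S o\<^sub>L T) (e n)) ^ 2) \<le> k\<^sup>2 * c" .
qed

lemma hs_le_compose_right:
  fixes T :: "'a::complex_hilbert_space oper"
  assumes E: "frame (id_blinfun :: 'a oper) E" and T: "hs_le T c" and S: "clinear_op S" and k: "norm S \<le> k"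
  shows "hs_le (T o\<^sub>L S) (k\<^sup>2 * c)"
proof -
  note T' = hs_le_clinear[OF T]
  have "hs_le (adj S o\<^sub>L adj T) (k\<^sup>2 * c)"
    using norm_adj_le[OF S] k by (intro hs_le_compose_left hs_le_adj[OF E T] clinear_adj S) auto
  then have "hs_le (adj (adj S o\<^sub>L adj T)) (k\<^sup>2 * c)" by (rule hs_le_adj[OF E])
  then show ?thesis by (simp add: adj_compose S T')
qed

lemma mult_le_mean_squares: "a * b \<le> (a\<^sup>2 + b\<^sup>2) / 2" for a b :: real
  using sum_squares_bound[of a b] by simp

text \<open>Both series are iterated sums of (e n, X f m) (f m, Y e n), which is absolutely summable
  because each factor is square summable. Summing out one frame leaves its projection between the
  two operators.\<close>

lemma trace_cyclic:
  fixes X Y P :: "'a::complex_hilbert_space oper" and f :: "nat \<Rightarrow> 'a"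
  assumes PQ: "projection P" "projection Q" and e: "frame P e" and f: "frame Q f"
    and X: "hs_le X a" and Y: "hs_le Y b"
  obtains S where "((\<lambda>n. cinner (e n) (X (Q (Y (e n))))) has_sum S) UNIV"
    and "((\<lambda>m. cinner (f m) (Y (P (X (f m))))) has_sum S) UNIV"
proof -
  note cl = hs_le_clinear[OF X] hs_le_clinear[OF Y]
  define g where "g = (\<lambda>(n, m). cinner (e n) (X (f m)) * cinner (f m) (Y (e n)))"
  have summ: "(\<lambda>n. norm (R (T (h n))) ^ 2) summable_on UNIV"
    if "projection R" "projection R'" "frame R' h" "hs_le T d" for R R' h T d
    by (rule summable_on_comparison_test[OF hs_leD(1)[OF that(4,2,3)]])
       (auto intro!: power_mono projection_norm_le that)
  have s1: "(\<lambda>(n, m). cmod (cinner (f m) (Y (e n))) ^ 2) summable_on (UNIV \<times> UNIV)"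
    using frame_swap_summable(1)[OF PQ e f cl(2) has_sum_infsum[OF summ[OF PQ(2,1) e Y]]]
    by (auto simp: summable_on_def)
  have "(\<lambda>(m, n). cmod (cinner (e n) (X (f m))) ^ 2) summable_on (UNIV \<times> UNIV)"
    using frame_swap_summable(1)[OF PQ(2,1) f e cl(1) has_sum_infsum[OF summ[OF PQ f X]]]
    by (auto simp: summable_on_def)
  then have s2: "(\<lambda>(n, m). cmod (cinner (e n) (X (f m))) ^ 2) summable_on (UNIV \<times> UNIV)"
    by (subst (asm) summable_on_swap) simp
  have "(\<lambda>x. ((\<lambda>(n, m). cmod (cinner (e n) (X (f m))) ^ 2) x + (\<lambda>(n, m). cmod (cinner (f m) (Y (e n))) ^ 2) x) / 2)
      summable_on (UNIV \<times> UNIV)"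
    unfolding divide_inverse by (intro summable_on_cmult_left summable_on_add s1 s2)
  then have "(\<lambda>x. norm (g x)) summable_on (UNIV \<times> UNIV)"
    by (rule Infinite_Sum.abs_summable_on_comparison_test')
       (use mult_le_mean_squares in \<open>fastforce simp only: g_def norm_mult split: prod.splits\<close>)
  then have sg: "g summable_on (UNIV \<times> UNIV)" by (rule abs_summable_summable)
  define S where "S = infsum g (UNIV \<times> UNIV)"
  have gS: "(g has_sum S) (UNIV \<times> UNIV)" unfolding S_def by (rule has_sum_infsum[OF sg])
  have fr: "((\<lambda>m. cinner x (f m) * cinner (f m) y) has_sum cinner x (Q y)) UNIV"
    "((\<lambda>m. cinner x (e m) * cinner (e m) y) has_sum cinner x (P y)) UNIV" for x y
    using e f by (simp_all add: frame_def)
  show thesis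
  proof (rule that)
    show "((\<lambda>n. cinner (e n) (X (Q (Y (e n))))) has_sum S) UNIV"
    proof (rule has_sum_SigmaD[OF gS])
      show "((\<lambda>m. g (n, m)) has_sum cinner (e n) (X (Q (Y (e n))))) UNIV" for n
        using fr(1)[of "adj X (e n)" "Y (e n)"] by (simp add: g_def cinner_adj_left cl)
    qed
    from gS have "((\<lambda>(m, n). g (n, m)) has_sum S) (UNIV \<times> UNIV)"
      by (subst (asm) has_sum_swap)
    then show "((\<lambda>m. cinner (f m) (Y (P (X (f m))))) has_sum S) UNIV"
    proof (rule has_sum_SigmaD)
      show "((\<lambda>n. case (m, n) of (m, n) \<Rightarrow> g (n, m)) has_sum cinner (f m) (Y (P (X (f m))))) UNIV" for m
        using fr(2)[of "adj Y (f m)" "X (f m)"] by (simp add: g_def cinner_adj_left cl mult.commute)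
    qed
  qed
qed

text \<open>The arithmetic mean is cruder than the product of Hilbert-Schmidt norms but needs no
  square roots; what matters is that the bound does not depend on the frame.\<close>

lemma trace_product_bound:
  fixes X Y P :: "'a::complex_hilbert_space oper"
  assumes E: "frame (id_blinfun :: 'a oper) E" and P: "projection P" "frame P e" and X: "hs_le X a" and Y: "hs_le Y b"
  shows "(\<lambda>n. cmod (cinner (e n) (X (Y (e n))))) summable_on UNIV"
    and "(\<Sum>\<^sub>\<infinity>n. cmod (cinner (e n) (X (Y (e n))))) \<le> (a + b) / 2"
proof -
  note sX = hs_leD[OF hs_le_adj[OF E X] P] and sY = hs_leD[OF Y P]
  have le: "cmod (cinner (e n) (X (Y (e n)))) \<le> (norm (adj X (e n)) ^ 2 + norm (Y (e n)) ^ 2) / 2" for n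
  proof -
    have "cmod (cinner (e n) (X (Y (e n)))) \<le> norm (adj X (e n)) * norm (Y (e n))"
      using cinner_norm_le[of "adj X (e n)" "Y (e n)"] by (simp add: cinner_adj_left hs_le_clinear[OF X])
    then show ?thesis using mult_le_mean_squares order_trans by blast
  qed
  have s: "(\<lambda>n. (norm (adj X (e n)) ^ 2 + norm (Y (e n)) ^ 2) / 2) summable_on UNIV"
    unfolding divide_inverse by (intro summable_on_cmult_left summable_on_add sX sY)
  show 1: "(\<lambda>n. cmod (cinner (e n) (X (Y (e n))))) summable_on UNIV"
    by (rule Infinite_Sum.abs_summable_on_comparison_test'[OF s]) (rule le)
  have "(\<Sum>\<^sub>\<infinity>n. cmod (cinner (e n) (X (Y (e n))))) \<le>
      (\<Sum>\<^sub>\<infinity>n. (norm (adj X (e n)) ^ 2 + norm (Y (e n)) ^ 2) / 2)"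
    by (rule infsum_mono[OF 1 s]) (rule le)
  also have "\<dots> = ((\<Sum>\<^sub>\<infinity>n. norm (adj X (e n)) ^ 2) + (\<Sum>\<^sub>\<infinity>n. norm (Y (e n)) ^ 2)) / 2"
    unfolding divide_inverse
    by (subst infsum_cmult_left) (auto intro!: summable_on_add sX sY simp: infsum_add[OF sX(1) sY(1)])
  also have "\<dots> \<le> (a + b) / 2" using sX sY by simp
  finally show "(\<Sum>\<^sub>\<infinity>n. cmod (cinner (e n) (X (Y (e n))))) \<le> (a + b) / 2" .
qed

text \<open>\<open>trace_class\<close> promises summability along some basis while
  \<open>op_trace\<close> sums along a chosen one. With T = Q^2 the trace is a sum of |Q e n|^2, and
  swapping from \<open>e\<close> to \<open>E\<close> and back to \<open>e'\<close> preserves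
  it.\<close>

lemma positive_trace_basis_independent:
  fixes T :: "'a::complex_hilbert_space oper"
  assumes E: "frame (id_blinfun :: 'a oper) E" and P: "projection P" and e: "frame P e" "frame P e'"
    and T: "positive_op T" and sum: "((\<lambda>n. cinner (e n) (T (e n))) has_sum c) UNIV"
  shows "((\<lambda>n. cinner (e' n) (T (e' n))) has_sum c) UNIV"
proof -
  obtain Q where Q: "positive_op Q" "Q o\<^sub>L Q = T" using positive_sqrt_exists[OF T] by blast
  note clQ = positive_op_clinear[OF Q(1)] and adjQ = positive_op_adj[OF Q(1)]
  have q: "cinner x (T x) = complex_of_real (norm (Q x) ^ 2)" for x
    using positive_op_sym[OF Q(1), of x "Q x"] by (simp add: Q(2)[symmetric] cinner_self)
  have sum': "((\<lambda>n. complex_of_real (norm (Q (e n)) ^ 2)) has_sum c) UNIV"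
    using sum by (simp only: q)
  have "((\<lambda>n. Im (complex_of_real (norm (Q (e n)) ^ 2))) has_sum Im c) UNIV"
    by (rule has_sum_bounded_linear[OF bounded_linear_Im sum'])
  from infsumI[OF this] have "Im c = 0" by simp
  then have c_real: "c = complex_of_real (Re c)" by (simp add: complex_eq_iff)
  then have "((\<lambda>n. complex_of_real (norm (Q (e n)) ^ 2)) has_sum complex_of_real (Re c)) UNIV"
    using sum' by metis
  then have "((\<lambda>n. norm (Q (e n)) ^ 2) has_sum Re c) UNIV"
    by (simp only: has_sum_of_real_iff)
  note c = this c_real
  have "((\<lambda>n. norm (id_blinfun (Q (e n))) ^ 2) has_sum Re c) UNIV" using c by simp
  then have "((\<lambda>m. norm (P (adj Q (E m))) ^ 2) has_sum Re c) UNIV"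
    by (rule frame_swap_summable(2)[OF P projection_id e(1) E clQ])
  then have "((\<lambda>m. norm (P (Q (E m))) ^ 2) has_sum Re c) UNIV" by (simp only: adjQ)
  then have "((\<lambda>m. norm (id_blinfun (adj Q (e' m))) ^ 2) has_sum Re c) UNIV"
    by (rule frame_swap_summable(2)[OF projection_id P E e(2) clQ])
  then have "((\<lambda>m. norm (Q (e' m)) ^ 2) has_sum Re c) UNIV" by (simp add: adjQ)
  then have "((\<lambda>m. complex_of_real (norm (Q (e' m)) ^ 2)) has_sum complex_of_real (Re c)) UNIV"
    by (simp only: has_sum_of_real_iff)
  then show ?thesis using c(2) by (simp only: q)
qed

section \<open>Products of Hilbert-Schmidt operators are trace class\<close>

lemma positive_op_self_adjoint_on:
  assumes T: "positive_op T"
  shows "self_adjoint_on UNIV (blinfun_apply T)"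
proof -
  have "(y, w) \<in> adjoint_graph UNIV (blinfun_apply T) \<longleftrightarrow> w = T y" for y w
  proof
    assume "(y, w) \<in> adjoint_graph UNIV (blinfun_apply T)"
    then have "cinner w x = cinner (T y) x" for x
      by (simp add: adjoint_graph_def positive_op_sym[OF T])
    then show "w = T y" by (rule cinner_ext)
  qed (simp add: adjoint_graph_def positive_op_sym[OF T])
  then show ?thesis
    by (auto simp: self_adjoint_on_def blinfun.add_right clinear_opD[OF positive_op_clinear[OF T]])
qed

text \<open>With \<open>A = |T|\<close>, the contraction \<open>W = T (A - i r)\<^sup>-\<^sup>1\<close> replaces the partial isometry of the polar
  decomposition: \<open>W\<^sup>* T\<close> differs from \<open>A\<close> by at most \<open>r\<close> in norm.\<close>

lemma trace_abs_partial_sums: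
  fixes X Y :: "'a::complex_hilbert_space oper"
  assumes E: "frame (id_blinfun :: 'a oper) E" and e: "frame (id_blinfun :: 'a oper) e"
    and X: "hs_le X a" and Y: "hs_le Y b" and r: "r > 0" and F: "finite F"
  shows "(\<Sum>n\<in>F. Re (cinner (e n) (abs_op (X o\<^sub>L Y) (e n)))) \<le> (a + b) / 2 + r * (\<Sum>n\<in>F. norm (e n) ^ 2)"
proof -
  define T where "T = X o\<^sub>L Y"
  have T: "clinear_op T" using X Y by (auto simp: T_def hs_le_clinear)
  define A where "A = abs_op T"
  have A: "positive_op A" "A o\<^sub>L A = adj T o\<^sub>L T"
    using abs_op_works[OF T] by (simp_all add: A_def)
  note sa = positive_op_self_adjoint_on[OF A(1)]
  define R where "R = resolvent UNIV (blinfun_apply A) (\<i> * r)"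
  define R' where "R' = resolvent UNIV (blinfun_apply A) (- (\<i> * r))"
  have R: "resolves UNIV (blinfun_apply A) (\<i> * r) R" and R': "resolves UNIV (blinfun_apply A) (- (\<i> * r)) R'"
    unfolding R_def R'_def using r by (auto intro!: self_adjoint_resolves_nonreal(1)[OF sa])
  have adjR: "adj R = R'" by (rule adj_resolves[OF sa R]) (use R' in simp)
  \<comment> \<open>For purely imaginary z the norm identity reads |x|^2 = |A S x|^2 + |z S
    x|^2.\<close>
  have contr: "norm (A (S x)) \<le> norm x"
    if S: "resolves UNIV (blinfun_apply A) z S" "Re z = 0" for S z x
  proof -
    have "norm (A (S x) - z *\<^sub>C S x) ^ 2 = norm (A (S x)) ^ 2 + Im z ^ 2 * norm (S x) ^ 2"
      using self_adjoint_norm_sq[OF sa, of "S x" z] S(2) by simp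
    then have "norm (A (S x)) ^ 2 \<le> norm x ^ 2" using resolves_right[OF S(1), of x] by simp
    then show ?thesis by (rule power2_le_imp_le) simp
  qed
  define W where "W = T o\<^sub>L R"
  have clR: "clinear_op R" "clinear_op R'" using R R' resolves_clinear by blast+
  have W: "clinear_op W" unfolding W_def using T clR by blast
  have normW: "norm W \<le> 1"
  proof (rule norm_blinfun_bound)
    fix x
    \<comment> \<open>\<open>T\<close> and its absolute value have equal norms on every vector, so
      \<open>W\<close> inherits contractivity from A R.\<close>
    have "complex_of_real (norm (T y) ^ 2) = complex_of_real (norm (A y) ^ 2)" for y
      using blinfun_compose_eqD[OF A(2), of y]
      by (metis T cinner_adj_right cinner_self positive_op_sym[OF A(1)])
    then have "norm (T y) ^ 2 = norm (A y) ^ 2" for y by (simp only: of_real_eq_iff)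
    then have "norm (T y) = norm (A y)" for y by (simp add: power2_eq_iff_nonneg)
    then show "norm (W x) \<le> 1 * norm x" using contr[OF R, of x] by (simp add: W_def)
  qed simp
  have key: "Re (cinner x (A x)) \<le> cmod (cinner x (adj W (T x))) + r * norm x ^ 2" for x
  proof -
    have 1: "R' (A y) = y - (\<i> * r) *\<^sub>C R' y" for y
      using resolves_left[OF R', of y] by (simp add: blinfun.add_right clinear_opD[OF clR(2)] eq_diff_eq)
    have 2: "A (R' y) = y - (\<i> * r) *\<^sub>C R' y" for y
      using resolves_right[OF R', of y] by simp
    have "adj W (T x) = R' (A (A x))"
      using blinfun_compose_eqD[OF A(2), of x] by (simp add: W_def adj_compose T clR adjR)
    \<comment> \<open>The two one-sided resolvent equations at -i r leave the error i r A R', where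
      A R' is again a contraction.\<close>
    also have "\<dots> = A x - (\<i> * r) *\<^sub>C A (R' x)" by (simp add: 1[of "A x"] 1[of x] 2)
    finally have "A x = adj W (T x) + (\<i> * r) *\<^sub>C A (R' x)" by simp
    then have "Re (cinner x (A x)) = Re (cinner x (adj W (T x))) + Re (cinner x ((\<i> * r) *\<^sub>C A (R' x)))"
      by (simp add: cinner_add_right)
    also have "Re (cinner x ((\<i> * r) *\<^sub>C A (R' x))) \<le> norm x * norm ((\<i> * r) *\<^sub>C A (R' x))"
      by (simp add: Re_cinner norm_cauchy_schwarz)
    also have "norm ((\<i> * r) *\<^sub>C A (R' x)) = r * norm (A (R' x))"
      using r by (simp add: norm_scaleC norm_mult)
    also have "norm x * (r * norm (A (R' x))) \<le> norm x * (r * norm x)"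
      using contr[OF R', of x] r by (intro mult_left_mono) auto
    finally show ?thesis
      using complex_Re_le_cmod[of "cinner x (adj W (T x))"] by (simp add: power2_eq_square algebra_simps)
  qed
  have X': "hs_le (adj W o\<^sub>L X) a"
    using hs_le_compose_left[OF X clinear_adj[OF W], of 1] norm_adj_le[OF W] normW by simp
  note tb = trace_product_bound[OF E projection_id e X' Y]
  have "(\<Sum>n\<in>F. Re (cinner (e n) (A (e n)))) \<le>
      (\<Sum>n\<in>F. cmod (cinner (e n) ((adj W o\<^sub>L X) (Y (e n)))) + r * norm (e n) ^ 2)"
    using key by (intro sum_mono) (simp add: T_def)
  also have "\<dots> = (\<Sum>n\<in>F. cmod (cinner (e n) ((adj W o\<^sub>L X) (Y (e n))))) + r * (\<Sum>n\<in>F. norm (e n) ^ 2)"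
    by (simp only: sum.distrib sum_distrib_left)
  also have "(\<Sum>n\<in>F. cmod (cinner (e n) ((adj W o\<^sub>L X) (Y (e n))))) \<le>
      (\<Sum>\<^sub>\<infinity>n. cmod (cinner (e n) ((adj W o\<^sub>L X) (Y (e n)))))"
    by (rule finite_sum_le_infsum[OF tb(1) F]) auto
  finally show ?thesis using tb(2) unfolding A_def T_def by linarith
qed

text \<open>For a fixed finite set of indices the error term of
  \<open>trace_abs_partial_sums\<close> can be made arbitrarily small, so all partial sums of the
  trace of the absolute value are bounded by (a + b)/2.\<close>

lemma trace_class_product:
  fixes X Y :: "'a::{complex_hilbert_space, second_countable_topology} oper" and B :: "'a set"
  assumes B: "is_onb UNIV B" and X: "hs_le X a" and Y: "hs_le Y b"
  shows "trace_class id_blinfun (X o\<^sub>L Y)"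
proof -
  define T where "T = X o\<^sub>L Y"
  have T: "clinear_op T" using X Y by (auto simp: T_def hs_le_clinear)
  have ran: "range (blinfun_apply (id_blinfun :: 'a oper)) = UNIV" by simp
  define e where "e = padded_seq B"
  have e: "frame (id_blinfun :: 'a oper) e"
    unfolding e_def by (rule frame_onb) (use B in simp_all)
  note A = abs_op_works(1)[OF T]
  define f where "f n = Re (cinner (e n) (abs_op T (e n)))" for n
  have "sum f F \<le> (a + b) / 2" if F: "finite F" for F
  proof -
    \<comment> \<open>The summand 1 allows division by \<open>c\<close> even if \<open>F\<close>
      meets only padding zeros.\<close>
    define c where "c = (\<Sum>n\<in>F. norm (e n) ^ 2) + 1"
    have c: "c > 0" by (simp add: c_def add_nonneg_pos sum_nonneg)
    show ?thesis
    proof (rule field_le_epsilon)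
      fix d :: real assume "d > 0"
      then have "d / c > 0" using c by simp
      then have "sum f F \<le> (a + b) / 2 + d / c * (\<Sum>n\<in>F. norm (e n) ^ 2)"
        unfolding f_def T_def by (rule trace_abs_partial_sums[OF e e X Y _ F])
      also have "d / c * (\<Sum>n\<in>F. norm (e n) ^ 2) \<le> d / c * c"
        using c \<open>d > 0\<close> by (intro mult_left_mono) (auto simp: c_def)
      finally show "sum f F \<le> (a + b) / 2 + d" using c by simp
    qed
  qed
  then have "f summable_on UNIV"
    by (intro nonneg_bdd_above_summable_on) (auto simp: f_def positive_op_Re[OF A] intro!: bdd_aboveI[where M = "(a + b) / 2"])
  then have "(f has_sum infsum f UNIV) UNIV" by (rule has_sum_infsum)
  then have "((\<lambda>n. complex_of_real (f n)) has_sum complex_of_real (infsum f UNIV)) UNIV"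
    by (simp only: has_sum_of_real_iff)
  moreover have "complex_of_real (f n) = cinner (e n) (abs_op T (e n))" for n
    by (simp add: f_def complex_eq_iff positive_op_Im[OF A])
  ultimately have "((\<lambda>n. cinner (e n) (abs_op T (e n))) has_sum complex_of_real (infsum f UNIV)) UNIV"
    by simp
  then have "((\<lambda>x. cinner x (abs_op T x)) has_sum complex_of_real (infsum f UNIV)) B"
    unfolding e_def by (subst (asm) has_sum_padded_seq) (simp_all add: onb_countable[OF B])
  then have "\<exists>B. is_onb (range (blinfun_apply (id_blinfun :: 'a oper))) B \<and> (\<lambda>e. cinner e (abs_op T e)) summable_on B"
    using B ran by (auto simp: summable_on_def)
  moreover have "oper_in id_blinfun T" using T by (simp add: oper_in_def blinfun_eqI)
  ultimately show ?thesis unfolding trace_class_def T_def by blast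
qed

text \<open>This enumerates the very basis that the choice operator selects inside
  \<open>op_trace\<close>, so that op_trace becomes a sum over natural numbers.\<close>

definition trace_seq :: "'a::complex_hilbert_space oper \<Rightarrow> nat \<Rightarrow> 'a"
  where "trace_seq P = padded_seq (SOME B. is_onb (range P) B)"

lemma
  fixes P :: "'a::{complex_hilbert_space, second_countable_topology} oper"
  assumes P: "projection P" and ex: "\<exists>B. is_onb (range P) B"
  shows frame_trace_seq: "frame P (trace_seq P)"
    and trace_seq_in_range: "P (trace_seq P n) = trace_seq P n"
    and op_trace_eq: "op_trace P T = (\<Sum>\<^sub>\<infinity>n. cinner (trace_seq P n) (T (trace_seq P n)))"
    and op_traceI: "((\<lambda>n. cinner (trace_seq P n) (T (trace_seq P n))) has_sum c) UNIV \<Longrightarrow> op_trace P T = c"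
proof -
  define B where "B = (SOME B. is_onb (range P) B)"
  have B: "is_onb (range P) B" unfolding B_def using ex by (rule someI_ex)
  have cnt: "countable B" using onb_countable[OF B] .
  have seq: "trace_seq P = padded_seq B" by (simp add: trace_seq_def B_def)
  show "frame P (trace_seq P)" unfolding seq by (rule frame_onb[OF P B])
  have "P x = x" if "x \<in> insert 0 B" for x
    using that onb_subset[OF B] projection_idem[OF P] by (auto simp: blinfun.zero_right)
  then show "P (trace_seq P n) = trace_seq P n"
    using padded_seq_mem[OF cnt] unfolding seq by blast
  have *: "((\<lambda>n. cinner (trace_seq P n) (T (trace_seq P n))) has_sum c) UNIV \<longleftrightarrow>
      ((\<lambda>e. cinner e (T e)) has_sum c) B" for c
    unfolding seq by (rule has_sum_padded_seq[OF cnt]) simp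
  show eq: "op_trace P T = (\<Sum>\<^sub>\<infinity>n. cinner (trace_seq P n) (T (trace_seq P n)))"
  proof (cases "(\<lambda>e. cinner e (T e)) summable_on B")
    case True
    then have "((\<lambda>e. cinner e (T e)) has_sum op_trace P T) B"
      unfolding op_trace_def B_def[symmetric] by (rule has_sum_infsum)
    then show ?thesis unfolding *[symmetric] by (rule infsumI[symmetric])
  next
    \<comment> \<open>Without summability both infinite sums have the default value 0, so the
      equation holds for every \<open>T\<close>.\<close>
    case False
    then have "\<not> (\<lambda>n. cinner (trace_seq P n) (T (trace_seq P n))) summable_on UNIV"
      unfolding summable_on_def * .
    with False show ?thesis
      by (simp add: op_trace_def B_def[symmetric] infsum_not_exists)
  qed
  show "op_trace P T = c" if "((\<lambda>n. cinner (trace_seq P n) (T (trace_seq P n))) has_sum c) UNIV"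
    unfolding eq by (rule infsumI[OF that])
qed

section \<open>Integrals over the half line\<close>

text \<open>The common majorant of the half-line integrals: each integrand carries two factors of
  order 1/(1 + t).\<close>

lemma has_integral_inverse_square: "((\<lambda>t::real. C / (1 + t)\<^sup>2) has_integral C) {0..}"
proof -
  have *: "((\<lambda>t. 1 / (1 + t)\<^sup>2) has_integral (- inverse (1 + y) - (- inverse (1 + 0)))) {0..y}"
    if "y \<ge> 0" for y :: real
    using that
    by (intro fundamental_theorem_of_calculus)
       (auto intro!: derivative_eq_intros simp: power2_eq_square field_simps
         simp flip: has_real_derivative_iff_has_vector_derivative)
  have "((\<lambda>t::real. 1 / (1 + t)\<^sup>2) has_integral 1) {0..}"
  proof (rule has_integral_to_inf)
    show "(\<lambda>t. 1 / (1 + t)\<^sup>2) integrable_on {0..y}" for y :: real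
      using * by (cases "y \<ge> 0") auto
    have "((\<lambda>y::real. 1 - inverse (1 + y)) \<longlongrightarrow> 1 - 0) at_top"
      by (intro tendsto_intros tendsto_inverse_0_at_top
          filterlim_tendsto_add_at_top[OF tendsto_const filterlim_ident])
    moreover have "eventually (\<lambda>y::real. 1 - inverse (1 + y) = integral {0..y} (\<lambda>t. 1 / (1 + t)\<^sup>2)) at_top"
      using eventually_ge_at_top[of 0]
      by eventually_elim (use * in \<open>fastforce dest: integral_unique\<close>)
    ultimately show "((\<lambda>y. integral {0..y} (\<lambda>t::real. 1 / (1 + t)\<^sup>2)) \<longlongrightarrow> 1) at_top"
      using Lim_transform_eventually by force
  qed auto
  from has_integral_mult_right[OF this, of C] show ?thesis by simp
qed

lemma halfline_integrable:
  fixes f :: "real \<Rightarrow> 'a::banach"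
  assumes cont: "continuous_on {0..} f" and bound: "\<And>t. t \<ge> 0 \<Longrightarrow> norm (f t) \<le> C / (1 + t)\<^sup>2"
  shows "f integrable_on {0..}"
proof (rule integrable_on_all_intervals_integrable_bound)
  show "(\<lambda>x. if x \<in> {0..} then f x else 0) integrable_on cbox a b" for a b
  proof -
    have "{0..} \<inter> cbox a b = {max 0 a..b}" by auto
    moreover have "f integrable_on {max 0 a..b}"
      by (rule integrable_continuous_interval) (rule continuous_on_subset[OF cont], auto)
    ultimately show ?thesis by (simp only: integrable_restrict_Int)
  qed
  show "norm (f x) \<le> C / (1 + x)\<^sup>2" if "x \<in> {0..}" for x using bound that by simp
  show "(\<lambda>x. C / (1 + x)\<^sup>2) integrable_on {0..}" using has_integral_inverse_square by blast
qed

text \<open>Dominated convergence for the partial sums. The bound on sums of absolute values is the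
  form in which \<open>trace_product_bound\<close> delivers it.\<close>

lemma halfline_sums:
  fixes g :: "nat \<Rightarrow> real \<Rightarrow> complex"
  assumes cont: "\<And>n. continuous_on {0..} (g n)"
    and bound: "\<And>t k. t \<ge> 0 \<Longrightarrow> (\<Sum>n<k. cmod (g n t)) \<le> C / (1 + t)\<^sup>2"
    and sums: "\<And>t. t \<ge> 0 \<Longrightarrow> (\<lambda>n. g n t) sums G t"
  shows "(\<lambda>n. integral {0..} (g n)) sums integral {0..} G"
proof -
  have int: "g n integrable_on {0..}" for n
  proof (rule halfline_integrable[OF cont])
    fix t :: real assume "t \<ge> 0"
    have "cmod (g n t) \<le> (\<Sum>n<Suc n. cmod (g n t))" by (rule member_le_sum) auto
    then show "cmod (g n t) \<le> C / (1 + t)\<^sup>2" using bound[OF \<open>t \<ge> 0\<close>] order_trans by blast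
  qed
  have "(\<lambda>k. integral {0..} (\<lambda>t. \<Sum>n<k. g n t)) \<longlonglongrightarrow> integral {0..} G"
  proof (rule dominated_convergence(2))
    show "(\<lambda>t. \<Sum>n<k. g n t) integrable_on {0..}" for k
      by (intro integrable_sum int) auto
    show "(\<lambda>t. C / (1 + t)\<^sup>2) integrable_on {0::real..}" using has_integral_inverse_square by blast
    show "cmod (\<Sum>n<k. g n t) \<le> C / (1 + t)\<^sup>2" if "t \<in> {0..}" for k t
      using bound[of t k] that norm_sum[of "\<lambda>n. g n t" "{..<k}"] by simp
    show "(\<lambda>k. \<Sum>n<k. g n t) \<longlonglongrightarrow> G t" if "t \<in> {0..}" for t
      using sums[of t] that by (simp add: sums_def)
  qed
  then show ?thesis by (simp add: sums_def integral_sum int)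
qed

lemma halfline_integral_limit:
  fixes f :: "real \<Rightarrow> complex"
  assumes cont: "continuous_on {0..} f" and bound: "\<And>t. t \<ge> 0 \<Longrightarrow> cmod (f t) \<le> C / (1 + t)\<^sup>2"
  shows "(\<lambda>n. integral {0..real n} f) \<longlonglongrightarrow> integral {0..} f"
proof -
  define h where "h n t = (if t \<in> {0..real n} then f t else 0)" for n t
  have sub: "{0..real n} \<inter> {0..} = {0..real n}" for n by auto
  have "(\<lambda>n. integral {0..} (h n)) \<longlonglongrightarrow> integral {0..} f"
  proof (rule dominated_convergence(2))
    show "h n integrable_on {0..}" for n
      unfolding h_def integrable_restrict_Int sub
      by (rule integrable_continuous_interval, rule continuous_on_subset[OF cont]) auto
    show "(\<lambda>t. C / (1 + t)\<^sup>2) integrable_on {0::real..}" using has_integral_inverse_square by blast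
    show "cmod (h n t) \<le> C / (1 + t)\<^sup>2" if "t \<in> {0..}" for n t
      using bound[of t] that order_trans[OF norm_ge_zero bound[of t]] by (simp add: h_def)
    show "(\<lambda>n. h n t) \<longlonglongrightarrow> f t" if "t \<in> {0..}" for t
    proof (rule tendsto_eventually)
      obtain N where "t \<le> real N" using real_arch_simple by blast
      then show "\<forall>\<^sub>F n in sequentially. h n t = f t"
        using that unfolding h_def eventually_sequentially by (intro exI[of _ N]) auto
    qed
  qed
  moreover have "integral {0..} (h n) = integral {0..real n} f" for n
    unfolding h_def integral_restrict_Int sub by simp
  ultimately show ?thesis by simp
qed

section \<open>Kernels on the real line\<close>

text \<open>From t^2 <= 2 (t - Re z)^2 + 2 (Re z)^2; the remainder 1 + 2 a^2 is absorbed by (Im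
  z)^2. The constant depends on \<open>Re z\<close> only through \<open>a\<close>, hence is uniform
  along real increments.\<close>

lemma resolvent_kernel_bound:
  fixes z :: complex and t a :: real
  assumes "Im z \<noteq> 0" "\<bar>Re z\<bar> \<le> a"
  shows "1 + t\<^sup>2 \<le> (2 + (1 + 2 * a\<^sup>2) / Im z ^ 2) * cmod (of_real t - z) ^ 2"
proof -
  define y2 where "y2 = Im z ^ 2"
  define d2 where "d2 = (t - Re z)\<^sup>2"
  have y2: "y2 > 0" using assms by (simp add: y2_def)
  have "Re z ^ 2 \<le> a\<^sup>2" using assms(2) power_mono[of "\<bar>Re z\<bar>" a 2] by simp
  moreover have "t\<^sup>2 \<le> 2 * d2 + 2 * Re z ^ 2"
  proof -
    have "0 \<le> (t - 2 * Re z)\<^sup>2" by simp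
    then show ?thesis unfolding d2_def by (simp add: power2_eq_square algebra_simps)
  qed
  ultimately have "1 + t\<^sup>2 \<le> 2 * d2 + (1 + 2 * a\<^sup>2)" by linarith
  also have "\<dots> = 2 * d2 + (1 + 2 * a\<^sup>2) / y2 * y2" using y2 by simp
  also have "\<dots> \<le> (2 + (1 + 2 * a\<^sup>2) / y2) * (d2 + y2)"
  proof -
    have "(1 + 2 * a\<^sup>2) / y2 * d2 \<ge> 0" using y2 by (auto simp: d2_def)
    then show ?thesis using y2 by (simp only: distrib_left distrib_right)
  qed
  finally show ?thesis by (simp add: cmod_power2 d2_def y2_def)
qed

text \<open>This kernel is the difference quotient of 1/(t - z) between \<open>z\<close> and
  \<open>w\<close>. The bound is the geometric mean of the two single-point bounds.\<close>

lemma resolvent_kernel_product_bound: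
  fixes z w :: complex and t a :: real
  assumes "Im z \<noteq> 0" "Im w = Im z" "\<bar>Re z\<bar> \<le> a" "\<bar>Re w\<bar> \<le> a"
  shows "cmod (1 / ((of_real t - z) * (of_real t - w))) \<le>
    (2 + (1 + 2 * a\<^sup>2) / Im z ^ 2) / (1 + t\<^sup>2)"
proof -
  define K where "K = 2 + (1 + 2 * a\<^sup>2) / Im z ^ 2"
  define p q where "p = cmod (of_real t - z)" and "q = cmod (of_real t - w)"
  have pq: "p > 0" "q > 0"
    using assms by (auto simp: p_def q_def complex_eq_iff)
  have "1 + t\<^sup>2 > 0" by (simp add: add_pos_nonneg)
  moreover have "(1 + t\<^sup>2) * (1 + t\<^sup>2) \<le> (K * p\<^sup>2) * (K * q\<^sup>2)"
    using resolvent_kernel_bound[of z a t] resolvent_kernel_bound[of w a t] assms calculation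
    by (intro mult_mono) (auto simp: K_def p_def q_def intro!: mult_nonneg_nonneg add_nonneg_nonneg)
  then have "(1 + t\<^sup>2)\<^sup>2 \<le> (K * (p * q))\<^sup>2" by (simp add: power2_eq_square ac_simps)
  then have "1 + t\<^sup>2 \<le> K * (p * q)"
    by (rule power2_le_imp_le) (use pq in \<open>auto simp: K_def intro!: mult_nonneg_nonneg add_nonneg_nonneg\<close>)
  ultimately show ?thesis
    using pq unfolding K_def[symmetric] norm_divide norm_mult p_def[symmetric] q_def[symmetric]
    by (simp add: divide_le_eq le_divide_eq mult.commute)
qed

lemma resolvent_kernel_square_bound:
  fixes z :: complex and t :: real
  assumes "Im z \<noteq> 0"
  shows "cmod (1 / (of_real t - z)\<^sup>2) \<le> (2 + (1 + 2 * Re z ^ 2) / Im z ^ 2) / (1 + t\<^sup>2)"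
  using resolvent_kernel_product_bound[of z z "\<bar>Re z\<bar>" t] assms by (simp add: power2_eq_square)

text \<open>The kernel equals (1 + t z) / ((t - z) (1 + t^2)), and (1 + t z)/(t - z) = z + (1 +
  z^2)/(t - z) is bounded by \<open>K\<close>.\<close>

lemma nevanlinna_kernel_bound:
  fixes z :: complex and t :: real
  assumes "Im z \<noteq> 0"
  obtains K where "\<And>t::real. cmod (1 / (of_real t - z) - complex_of_real (t / (1 + t\<^sup>2))) \<le> K / (1 + t\<^sup>2)"
proof -
  define K where "K = cmod z + cmod (1 + z * z) / \<bar>Im z\<bar>"
  have "cmod (1 / (of_real t - z) - complex_of_real (t / (1 + t\<^sup>2))) \<le> K / (1 + t\<^sup>2)" for t :: real
  proof -
    define u where "u = of_real t - z"
    have u: "u \<noteq> 0" "\<bar>Im z\<bar> \<le> cmod u"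
      using assms abs_Im_le_cmod[of u] by (auto simp: u_def complex_eq_iff)
    have pos: "1 + t\<^sup>2 > 0" by (simp add: add_pos_nonneg)
    then have "complex_of_real (1 + t\<^sup>2) \<noteq> 0" by (simp only: of_real_eq_0_iff)
    then have nz: "1 + (u + z)\<^sup>2 \<noteq> 0" by (simp add: u_def)
    have "1 / u - (u + z) / (1 + (u + z)\<^sup>2) = (z + (1 + z * z) / u) / (1 + (u + z)\<^sup>2)"
      using u(1) nz by (simp add: frac_eq_eq diff_frac_eq add_frac_eq add_divide_eq_iff) (simp add: power2_eq_square algebra_simps)
    then have "1 / u - complex_of_real (t / (1 + t\<^sup>2)) = (z + (1 + z * z) / u) / complex_of_real (1 + t\<^sup>2)"
      by (simp add: u_def)
    then have "cmod (1 / u - complex_of_real (t / (1 + t\<^sup>2))) = cmod (z + (1 + z * z) / u) / (1 + t\<^sup>2)"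
      using pos by (simp only: norm_divide norm_of_real abs_of_pos)
    also have "cmod (z + (1 + z * z) / u) \<le> K"
      unfolding K_def
      by (rule order_trans[OF norm_triangle_ineq add_left_mono])
         (use u assms in \<open>auto simp: norm_divide intro!: divide_left_mono\<close>)
    finally show ?thesis using pos by (simp add: u_def divide_right_mono)
  qed
  then show thesis by (rule that)
qed

section \<open>The perturbation determinant of a definite perturbation\<close>

lemma norm_scale_op_le: "norm (c *\<^sub>O T) \<le> cmod c * norm T"
  by (rule norm_blinfun_bound)
     (auto simp: scale_op.rep_eq norm_scaleC mult.assoc intro!: mult_left_mono norm_blinfun)

lemma self_adjoint_Im_zero:
  assumes "self_adjoint_on D A" "u \<in> D"
  shows "Im (cinner (A u) u) = 0"
proof -
  have "cnj (cinner (A u) u) = cinner (A u) u"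
    using self_adjoint_onD(4)[OF assms(1,2,2)] cinner_commute by metis
  then show ?thesis by (simp add: complex_eq_iff)
qed

text \<open>The sign of the imaginary part gives t |x| <= |y|. For t m <= 1/2 the shift is a small
  perturbation of the invertible \<open>W\<close>; for larger t the first bound already implies |x|
  <= 2 m |y|. Adding the two gives decay of order 1/(1 + t) for the inverse. The sign
  \<open>r\<close> covers \<open>W\<close> and its adjoint alike.\<close>

lemma shifted_coercive:
  fixes W S :: "'a::complex_hilbert_space oper" and m t r :: real
  assumes inv: "\<And>x. S (W x) = x" and S: "norm S \<le> m" "m \<ge> 1" and t: "t \<ge> 0" and r: "r = 1 \<or> r = -1"
    and Im: "\<And>x. r * Im (cinner x (W x)) \<ge> 0"
  shows "(1 + t) / (2 * m + 1) * norm x \<le> norm (W x + (\<i> * (r * t)) *\<^sub>C x)"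
proof -
  define y where "y = W x + (\<i> * (r * t)) *\<^sub>C x"
  have 1: "t * norm x \<le> norm y"
  proof (cases "x = 0")
    case False
    have "Im (cinner x y) = Im (cinner x (W x)) + r * t * norm x ^ 2"
      by (simp add: y_def cinner_add_right cinner_scaleC_right cinner_self)
    then have "r * Im (cinner x y) = r * Im (cinner x (W x)) + t * norm x ^ 2"
      using r by auto
    then have "t * norm x ^ 2 \<le> r * Im (cinner x y)" using Im[of x] by linarith
    also have "\<dots> \<le> \<bar>Im (cinner x y)\<bar>" using r by auto
    also have "\<dots> \<le> norm x * norm y"
      using abs_Im_le_cmod cinner_norm_le order_trans by blast
    finally show ?thesis using False by (simp add: power2_eq_square)
  qed (simp add: y_def)
  have 2: "norm x \<le> 2 * m * norm y"
  proof (cases "t * m \<le> 1 / 2")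
    case True
    have "norm x \<le> norm S * norm (W x)" using norm_blinfun[of S "W x"] by (simp add: inv)
    also have "\<dots> \<le> m * norm (W x)" using S by (intro mult_right_mono) auto
    also have "norm (W x) \<le> norm y + t * norm x"
    proof -
      have "norm (W x) \<le> norm y + norm ((\<i> * (r * t)) *\<^sub>C x)"
        using norm_triangle_ineq4[of y "(\<i> * (r * t)) *\<^sub>C x"] by (simp add: y_def)
      also have "norm ((\<i> * (r * t)) *\<^sub>C x) = t * norm x"
        using r t by (auto simp: norm_scaleC norm_mult)
      finally show ?thesis .
    qed
    finally have "norm x \<le> m * norm y + t * m * norm x" using S by (simp add: algebra_simps)
    also have "t * m * norm x \<le> 1 / 2 * norm x" using True by (intro mult_right_mono) auto
    finally show ?thesis by simp
  next
    case False
    then have "norm x \<le> 2 * (t * m) * norm x" using mult_right_mono[of 1 "2 * (t * m)" "norm x"] by simp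
    also have "\<dots> = 2 * m * (t * norm x)" by simp
    also have "\<dots> \<le> 2 * m * norm y" using 1 S by (intro mult_left_mono) auto
    finally show ?thesis .
  qed
  have "(1 + t) * norm x \<le> (2 * m + 1) * norm y" using 1 2 by (simp add: algebra_simps)
  then show ?thesis using S by (simp add: y_def field_simps)
qed

text \<open>Instantiated with \<open>L\<close> = K composed with \<open>P\<close>, so that L (adj L)
  = K P (adj K), and \<open>LP\<close> says that \<open>L\<close> vanishes on the complement of ran
  P.\<close>

locale definite_perturbation =
  fixes D :: "'a::{complex_hilbert_space, second_countable_topology} set" and A :: "'a \<Rightarrow> 'a"
    and P L :: "'a oper" and s a :: real and E :: "nat \<Rightarrow> 'a"
  assumes sa: "self_adjoint_on D A" and P: "projection P" and L: "hs_le L a" and LP: "L o\<^sub>L P = L"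
    and s: "s = 1 \<or> s = -1" and E: "frame (id_blinfun :: 'a oper) E"
begin

abbreviation R :: "complex \<Rightarrow> 'a oper" where "R \<equiv> resolvent D A"

definition A1 :: "'a \<Rightarrow> 'a" where "A1 = perturb A (s *\<^sub>R (L o\<^sub>L adj L))"

abbreviation R1 :: "complex \<Rightarrow> 'a oper" where "R1 \<equiv> resolvent D A1"

definition G :: "complex \<Rightarrow> 'a oper" where "G z = s *\<^sub>R (adj L o\<^sub>L R z o\<^sub>L L)"

text \<open>It acts on the whole space: as Phi + i t on ran P and as the scalar 1 + i t on the
  complement. Inverses are thus ordinary ones, and compression to ran P is postponed to
  \<open>inverse_in_eq\<close>.\<close>

definition W :: "complex \<Rightarrow> real \<Rightarrow> 'a oper" where "W z t = id_blinfun + G z + (\<i> * t) *\<^sub>O id_blinfun"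

text \<open>This is 2 m + 1 from \<open>shifted_coercive\<close>, with m the bound for
  \<open>S0\<close>. It depends on \<open>z\<close> only through \<open>Im z\<close>, hence is
  constant along real increments.\<close>

definition M :: "complex \<Rightarrow> real" where "M z = 3 + 2 * (norm L ^ 2 / \<bar>Im z\<bar>)"

text \<open>The inverse of \<^term>\<open>W z t\<close>; at \<open>t = 0\<close> it is explicitly given by the resolvent of the
  perturbed operator, so no Fredholm theory is needed.\<close>

definition S :: "complex \<Rightarrow> real \<Rightarrow> 'a oper"
  where "S z t = (SOME S. clinear_op S \<and> S o\<^sub>L W z t = id_blinfun \<and> W z t o\<^sub>L S = id_blinfun \<and>
    norm S \<le> M z / (1 + t))"

definition S0 :: "complex \<Rightarrow> 'a oper" where "S0 z = id_blinfun - s *\<^sub>R (adj L o\<^sub>L R1 z o\<^sub>L L)"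

lemma clL: "clinear_op L" by (rule hs_le_clinear[OF L])

lemma res: "Im z \<noteq> 0 \<Longrightarrow> resolves D A z (R z)" and norm_R: "Im z \<noteq> 0 \<Longrightarrow> norm (R z) \<le> 1 / \<bar>Im z\<bar>"
  by (simp_all add: self_adjoint_resolves_nonreal[OF sa])

lemma sa1: "self_adjoint_on D A1"
  unfolding A1_def
proof (rule self_adjoint_perturb[OF sa])
  show "clinear_op (s *\<^sub>R (L o\<^sub>L adj L))" using clL by blast
  show "adj (s *\<^sub>R (L o\<^sub>L adj L)) = s *\<^sub>R (L o\<^sub>L adj L)"
    using clL by (simp add: adj_scaleR clinear_compose adj_compose)
qed

lemma res1: "Im z \<noteq> 0 \<Longrightarrow> resolves D A1 z (R1 z)" and norm_R1: "Im z \<noteq> 0 \<Longrightarrow> norm (R1 z) \<le> 1 / \<bar>Im z\<bar>"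
  by (simp_all add: self_adjoint_resolves_nonreal[OF sa1])

lemma L_P: "L (P x) = L x" using LP blinfun_apply_blinfun_compose[of L P x] by simp

lemma P_adj_L: "P (adj L x) = adj L x"
proof (rule cinner_ext)
  fix y
  show "cinner (P (adj L x)) y = cinner (adj L x) y"
    by (simp add: projection_sym[OF P] cinner_adj_left[OF clL] L_P)
qed

lemma G_apply: "G z x = s *\<^sub>R adj L (R z (L x))"
  by (simp add: G_def blinfun.scaleR_left)

lemma W_apply: "W z t x = x + G z x + (\<i> * t) *\<^sub>C x"
  by (simp add: W_def blinfun.add_left scale_op.rep_eq)

lemma clR: "Im z \<noteq> 0 \<Longrightarrow> clinear_op (R z)" by (rule resolves_clinear[OF res])

lemma clR1: "Im z \<noteq> 0 \<Longrightarrow> clinear_op (R1 z)" by (rule resolves_clinear[OF res1])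

lemma clG: "Im z \<noteq> 0 \<Longrightarrow> clinear_op (G z)" unfolding G_def using clL clR by blast

lemma clW: "Im z \<noteq> 0 \<Longrightarrow> clinear_op (W z t)" unfolding W_def using clG by blast

lemma clS0: "Im z \<noteq> 0 \<Longrightarrow> clinear_op (S0 z)" unfolding S0_def using clL clR1 by blast

lemma norm_sandwich_le:
  assumes "norm (T :: 'a oper) \<le> k"
  shows "norm (adj L o\<^sub>L T o\<^sub>L L) \<le> norm L ^ 2 * k"
  using norm_blinfun_compose_le[OF norm_blinfun_compose_le[OF norm_adj_le[OF clL] assms] order_refl[of "norm L"]]
  by (simp add: power2_eq_square ac_simps)

lemma norm_S0: "Im z \<noteq> 0 \<Longrightarrow> norm (S0 z) \<le> 1 + norm L ^ 2 / \<bar>Im z\<bar>"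
proof -
  assume z: "Im z \<noteq> 0"
  have "norm (S0 z) \<le> norm (id_blinfun :: 'a oper) + norm (s *\<^sub>R (adj L o\<^sub>L R1 z o\<^sub>L L))"
    unfolding S0_def by (rule norm_triangle_ineq4)
  also have "norm (id_blinfun :: 'a oper) \<le> 1" by (rule norm_blinfun_bound) auto
  also have "norm (s *\<^sub>R (adj L o\<^sub>L R1 z o\<^sub>L L)) \<le> norm L ^ 2 * (1 / \<bar>Im z\<bar>)"
    using norm_sandwich_le[OF norm_R1[OF z]] s by auto
  finally show ?thesis by simp
qed

lemma resolvent_A1:
  assumes z: "Im z \<noteq> 0"
  shows "R1 z y - R z y = - (s *\<^sub>R R z (L (adj L (R1 z y))))"
    and "R1 z y - R z y = - (s *\<^sub>R R1 z (L (adj L (R z y))))"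
  using resolvent_perturb[OF res[OF z] res1[OF z, unfolded A1_def], folded A1_def, of y]
  by (simp_all add: blinfun.scaleR_left blinfun.scaleR_right)

text \<open>Absorbing \<open>S0\<close> into the perturbed resolvent is what finally turns the
  logarithmic derivative R L S0 (adj L) R into R1 L (adj L) R, a multiple of R1 - R.\<close>

lemma R_L_S0:
  assumes z: "Im z \<noteq> 0"
  shows "R z (L (S0 z x)) = R1 z (L x)"
  using resolvent_A1(1)[OF z, of "L x"]
  by (simp add: S0_def blinfun.diff_left blinfun.scaleR_left blinfun.diff_right blinfun.scaleR_right
      diff_eq_eq)

text \<open>The two orders of the second resolvent equation yield the two one-sided
  inverses.\<close>

lemma S0_inverse:
  assumes z: "Im z \<noteq> 0"
  shows "S0 z x + G z (S0 z x) = x" and "S0 z (x + G z x) = x"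
proof -
  show "S0 z x + G z (S0 z x) = x"
    by (simp add: G_apply R_L_S0[OF z]) (simp add: S0_def blinfun.diff_left blinfun.scaleR_left)
  define v where "v = R z (L x)"
  have Gx: "G z x = s *\<^sub>R adj L v" by (simp add: G_apply v_def)
  have "R1 z (L (x + G z x)) = R1 z (L x) + s *\<^sub>R R1 z (L (adj L v))"
    by (simp add: Gx blinfun.add_right blinfun.scaleR_right)
  also have "\<dots> = v" using resolvent_A1(2)[OF z, of "L x"] by (simp add: v_def diff_eq_eq)
  finally show "S0 z (x + G z x) = x"
    by (simp add: S0_def Gx blinfun.diff_left blinfun.scaleR_left)
qed

text \<open>The sign of s Im z decides the sign of the imaginary part. Hence s Im z > 0 is the half
  plane in which \<open>log_in\<close> takes its first branch: the upper one for s = 1, the lower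
  one for s = -1.\<close>

lemma Im_G: 
  assumes z: "Im z \<noteq> 0"
  shows "Im (cinner x (G z x)) = s * Im z * norm (R z (L x)) ^ 2"
proof -
  define u where "u = R z (L x)"
  have u: "u \<in> D" "L x = A u - z *\<^sub>C u"
    using resolves_mem[OF res[OF z]] resolves_right[OF res[OF z]] by (simp_all add: u_def)
  have "cinner x (G z x) = of_real s * cinner (L x) u"
    by (simp add: G_apply u_def cinner.scaleR_right cinner_adj_right clL scaleR_conv_of_real)
  then have "Im (cinner x (G z x)) = s * Im (cinner (A u - z *\<^sub>C u) u)"
    by (simp add: u(2))
  also have "Im (cinner (A u - z *\<^sub>C u) u) = Im z * norm u ^ 2"
    by (simp add: cinner.diff_left cinner_scaleC_left self_adjoint_Im_zero[OF sa u(1)] cinner_self)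
  finally show ?thesis by (simp add: u_def)
qed

section \<open>Inverses and the logarithm in the half plane s Im z > 0\<close>

context
  fixes z :: complex assumes z: "s * Im z > 0"
begin

lemma Im_z: "Im z \<noteq> 0" using z by auto

lemma S_ex:
  assumes t: "t \<ge> 0"
  shows "\<exists>S. clinear_op S \<and> S o\<^sub>L W z t = id_blinfun \<and> W z t o\<^sub>L S = id_blinfun \<and> norm S \<le> M z / (1 + t)"
proof -
  define m where "m = 1 + norm L ^ 2 / \<bar>Im z\<bar>"
  have m: "m \<ge> 1" "2 * m + 1 = M z" by (simp_all add: m_def M_def)
  define W0 where "W0 = id_blinfun + G z"
  have W0: "W0 x = x + G z x" for x by (simp add: W0_def blinfun.add_left)
  have cl: "clinear_op W0" unfolding W0_def using clG[OF Im_z] by blast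
  have Im: "Im (cinner x (W0 x)) \<ge> 0" for x
    using z by (simp add: W0 cinner_add_right cinner_self Im_G[OF Im_z] mult_nonneg_nonneg)
  have 1: "(1 + t) / M z * norm x \<le> norm (W z t x)" for x
    using shifted_coercive[of "S0 z" W0 m t 1 x] S0_inverse(2)[OF Im_z] norm_S0[OF Im_z] m t Im
    by (simp add: W0 W_apply m_def)
  \<comment> \<open>\<open>S0\<close> is a right inverse of \<open>W0\<close>, so its adjoint is a
    left inverse of \<open>adj W0\<close>; the adjoint has the opposite imaginary sign, which is the
    case r = -1.\<close>
  have inv: "adj (S0 z) (adj W0 x) = x" for x
  proof (rule cinner_ext)
    show "cinner (adj (S0 z) (adj W0 x)) y = cinner x y" for y
      using S0_inverse(1)[OF Im_z, of y] by (simp add: cinner_adj_left clS0[OF Im_z] cl W0)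
  qed
  have Im': "Im (cinner x (adj W0 x)) \<le> 0" for x
  proof -
    have "cinner x (adj W0 x) = cnj (cinner x (W0 x))"
      by (metis cinner_adj_right cinner_commute cl)
    then show ?thesis using Im[of x] by simp
  qed
  have adjW: "adj (W z t) x = adj W0 x + (\<i> * (- 1 * t)) *\<^sub>C x" for x
  proof -
    have "W z t = W0 + (\<i> * t) *\<^sub>O id_blinfun" by (simp add: W_def W0_def)
    then have "adj (W z t) = adj W0 + cnj (\<i> * t) *\<^sub>O id_blinfun"
      using cl by (simp add: adj_add adj_scale clinear_scale)
    then show ?thesis by (simp add: blinfun.add_left scale_op.rep_eq)
  qed
  have 2: "(1 + t) / M z * norm x \<le> norm (adj (W z t) x)" for x
    using shifted_coercive[of "adj (S0 z)" "adj W0" m t "-1" x] inv norm_S0[OF Im_z]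
      norm_adj_le[OF clS0[OF Im_z]] m t Im'
    by (simp only: adjW) (auto simp: m_def)
  have pos: "(1 + t) / M z > 0" using t m by (intro divide_pos_pos) linarith+
  obtain S where "clinear_op S" "S o\<^sub>L W z t = id_blinfun" "W z t o\<^sub>L S = id_blinfun"
      "norm S \<le> 1 / ((1 + t) / M z)"
    using coercive_invertible[OF clW[OF Im_z] pos 1 2] by blast
  then show ?thesis by auto
qed

lemma
  assumes t: "t \<ge> 0"
  shows clS: "clinear_op (S z t)" and S_left: "S z t (W z t x) = x" and S_right: "W z t (S z t x) = x"
    and norm_S: "norm (S z t) \<le> M z / (1 + t)"
proof -
  have *: "clinear_op (S z t) \<and> S z t o\<^sub>L W z t = id_blinfun \<and> W z t o\<^sub>L S z t = id_blinfun \<and>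
      norm (S z t) \<le> M z / (1 + t)"
    unfolding S_def by (rule someI_ex[OF S_ex[OF t]])
  then show "clinear_op (S z t)" "norm (S z t) \<le> M z / (1 + t)" by blast+
  show "S z t (W z t x) = x" "W z t (S z t x) = x"
    using * blinfun_compose_idD by blast+
qed

lemma S_zero: "S z 0 = S0 z"
proof (rule blinfun_eqI)
  fix x
  have "S z 0 (W z 0 (S0 z x)) = S0 z x" by (simp add: S_left)
  moreover have "W z 0 (S0 z x) = x" using S0_inverse(1)[OF Im_z] by (simp add: W_apply)
  ultimately show "S z 0 x = S0 z x" by simp
qed

lemma W_P: "W z t (P x) = P (W z t x)"
  by (simp add: W_apply G_apply blinfun.add_right blinfun.scaleR_right P_adj_L L_P
      clinear_opD[OF projection_clinear[OF P]])

lemma S_P: "t \<ge> 0 \<Longrightarrow> S z t (P x) = P (S z t x)"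
  using S_left[of t "P (S z t x)"] S_right[of t x] W_P[of t "S z t x"] by simp

text \<open>Resolvent identity in the variable i t. It gives Lipschitz continuity in
  \<open>t\<close> and an exact difference quotient.\<close>

lemma S_diff_shift:
  assumes t: "t \<ge> 0" "u \<ge> 0"
  shows "S z t x - S z u x = (\<i> * (u - t)) *\<^sub>C S z t (S z u x)"
proof -
  define y where "y = S z u x"
  have "x = W z u y" using S_right[OF t(2)] by (simp add: y_def)
  also have "\<dots> = W z t y + (\<i> * (u - t)) *\<^sub>C y"
    by (simp add: W_apply scaleC_add_left[symmetric] algebra_simps)
  finally have "S z t x = y + (\<i> * (u - t)) *\<^sub>C S z t y"
    by (metis S_left[OF t(1)] blinfun.add_right clS[OF t(1)] clinear_opD)
  then show ?thesis by (simp add: y_def)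
qed

lemma norm_S_const:
  assumes t: "t \<ge> 0"
  shows "norm (S z t) \<le> M z"
proof -
  have "M z / (1 + t) \<le> M z / 1" by (rule divide_left_mono) (use t in \<open>auto simp: M_def\<close>)
  then show ?thesis using norm_S[OF t] by simp
qed

lemma continuous_S: "continuous_on {0..} (S z)"
proof -
  have "(M z * M z)-lipschitz_on {0..} (S z)"
  proof (rule lipschitz_onI)
    fix t u :: real assume t: "t \<in> {0..}" "u \<in> {0..}"
    have "S z t - S z u = (\<i> * (u - t)) *\<^sub>O (S z t o\<^sub>L S z u)"
      using t by (intro blinfun_eqI) (simp add: blinfun.diff_left S_diff_shift scale_op.rep_eq)
    then have "norm (S z t - S z u) \<le> cmod (\<i> * (u - t)) * norm (S z t o\<^sub>L S z u)"
      by (simp add: norm_scale_op_le)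
    also have "\<dots> \<le> \<bar>u - t\<bar> * (M z * M z)"
    proof (rule mult_mono)
      show "norm (S z t o\<^sub>L S z u) \<le> M z * M z"
        by (rule norm_blinfun_compose_le) (use t norm_S_const in auto)
    qed (auto simp: norm_mult simp flip: of_real_diff)
    finally show "dist (S z t) (S z u) \<le> M z * M z * dist t u"
      by (simp add: dist_norm mult.commute abs_minus_commute)
  qed (simp add: M_def)
  then show ?thesis by (rule lipschitz_on_continuous_on)
qed

text \<open>\<open>W\<close> commutes with \<open>P\<close>, so its inverse does too and compresses
  to the inverse in ran P.\<close>

lemma inverse_in_eq:
  assumes t: "t \<ge> 0"
  shows "inverse_in P (P + G z + (\<i> * t) *\<^sub>O P) = P o\<^sub>L S z t"
  unfolding inverse_in_def
proof (rule the_equality)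
  define T where "T = P + G z + (\<i> * t) *\<^sub>O P"
  have T: "T x = W z t (P x)" "T x = P (W z t x)" for x
  proof -
    show "T x = W z t (P x)"
      by (simp add: T_def W_apply G_apply L_P blinfun.add_left scale_op.rep_eq)
    then show "T x = P (W z t x)" by (simp add: W_P)
  qed
  have PS: "P (S z t (P x)) = P (S z t x)" for x by (simp add: S_P[OF t] projection_idem[OF P])
  show "oper_in P (P o\<^sub>L S z t) \<and> (P o\<^sub>L S z t) o\<^sub>L (P + G z + (\<i> * t) *\<^sub>O P) = P \<and>
      (P + G z + (\<i> * t) *\<^sub>O P) o\<^sub>L (P o\<^sub>L S z t) = P"
    unfolding T_def[symmetric] oper_in_def
  proof (intro conjI)
    show "clinear_op (P o\<^sub>L S z t)" using projection_clinear[OF P] clS[OF t] by blast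
    show "P o\<^sub>L (P o\<^sub>L S z t) o\<^sub>L P = P o\<^sub>L S z t"
      by (rule blinfun_eqI) (simp add: projection_idem[OF P] PS)
    show "(P o\<^sub>L S z t) o\<^sub>L T = P"
      by (rule blinfun_eqI) (simp add: T(1) S_left[OF t] projection_idem[OF P])
    show "T o\<^sub>L (P o\<^sub>L S z t) = P"
      by (rule blinfun_eqI) (simp add: T(1) projection_idem[OF P] W_P S_right[OF t])
  qed
  fix S' assume S': "oper_in P S' \<and> S' o\<^sub>L (P + G z + (\<i> * t) *\<^sub>O P) = P \<and>
      (P + G z + (\<i> * t) *\<^sub>O P) o\<^sub>L S' = P"
  show "S' = P o\<^sub>L S z t"
  proof (rule blinfun_eqI)
    fix x
    have "T (S' x) = P x"
      using S' blinfun_apply_blinfun_compose[of T S' x] by (simp add: T_def)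
    then have "S z t (W z t (P (S' x))) = S z t (P x)" by (simp add: T)
    then have "P (S' x) = P (S z t x)" by (simp add: S_left[OF t] S_P[OF t])
    moreover have "P (S' x) = S' x"
    proof -
      have "P (S' (P y)) = S' y" for y
        using S' blinfun_apply_blinfun_compose[of "P o\<^sub>L S'" P y] by (simp add: oper_in_def)
      then show ?thesis by (metis projection_idem[OF P])
    qed
    ultimately show "S' x = (P o\<^sub>L S z t) x" by simp
  qed
qed

lemma log_in_eq_log_upper: "log_in P (P + G z) = log_upper P (P + G z)"
proof -
  have cl: "clinear_op (P + G z)" using projection_clinear[OF P] clG[OF Im_z] by blast
  have "cinner x (Im_op (P + G z) x) = complex_of_real (Im (cinner x ((P + G z) x)))" for x
  proof -
    have "cinner x (Im_op (P + G z) x) = 1 / (2 * \<i>) * (cinner x ((P + G z) x) - cinner x (adj (P + G z) x))"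
      by (simp add: Im_op_def scale_op.rep_eq blinfun.diff_left cinner_scaleC_right cinner.diff_right
          cinner.minus_right)
    also have "cinner x (adj (P + G z) x) = cnj (cinner x ((P + G z) x))"
      by (metis cinner_adj_right[OF cl] cinner_commute)
    also have "1 / (2 * \<i>) * (c - cnj c) = complex_of_real (Im c)" for c
      by (simp add: complex_eq_iff)
    finally show ?thesis .
  qed
  moreover have "Im (cinner x ((P + G z) x)) \<ge> 0" for x
    using z by (simp add: blinfun.add_left cinner_add_right projection_cinner[OF P] Im_G[OF Im_z] mult_nonneg_nonneg)
  moreover have "clinear_op (Im_op (P + G z))"
    unfolding Im_op_def using cl by blast
  ultimately have "positive_op (Im_op (P + G z))"
    by (intro positive_opI) auto
  then show ?thesis by (simp add: log_in_def)
qed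

lemma cmod_one_plus_ge: "t \<ge> 0 \<Longrightarrow> (1 + t) / 2 \<le> cmod (1 + \<i> * t)" for t :: real
  using abs_Re_le_cmod[of "1 + \<i> * t"] abs_Im_le_cmod[of "1 + \<i> * t"] by simp

text \<open>The subtracted scalar term cancels the leading 1/t decay: the difference is -(1 + i
  t)^-1 P S G, with two factors of order 1/(1 + t).\<close>

lemma log_integrand_bound:
  assumes t: "t \<ge> 0"
  shows "norm ((P o\<^sub>L S z t) - (1 / (1 + \<i> * t)) *\<^sub>O P) \<le> (2 * (norm P * M z * norm (G z))) / (1 + t)\<^sup>2"
proof -
  have nz: "1 + \<i> * t \<noteq> 0" using cmod_one_plus_ge[OF t] t by auto
  have "(P o\<^sub>L S z t) - (1 / (1 + \<i> * t)) *\<^sub>O P = (- (1 / (1 + \<i> * t))) *\<^sub>O (P o\<^sub>L (S z t o\<^sub>L G z))"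
  proof (rule blinfun_eqI)
    fix x
    have "x = S z t (x + G z x + (\<i> * t) *\<^sub>C x)" using S_left[OF t, of x] by (simp add: W_apply)
    then have "x = (1 + \<i> * t) *\<^sub>C S z t x + S z t (G z x)"
      by (simp add: blinfun.add_right clinear_opD[OF clS[OF t]] scaleC_add_left algebra_simps)
    then have "(1 / (1 + \<i> * t)) *\<^sub>C x = S z t x + (1 / (1 + \<i> * t)) *\<^sub>C S z t (G z x)"
      using nz by (metis scaleC_add_right scaleC_scaleC nonzero_eq_divide_eq scaleC_one)
    then have "P ((1 / (1 + \<i> * t)) *\<^sub>C x) = P (S z t x + (1 / (1 + \<i> * t)) *\<^sub>C S z t (G z x))" by simp
    then show "((P o\<^sub>L S z t) - (1 / (1 + \<i> * t)) *\<^sub>O P) x =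
        ((- (1 / (1 + \<i> * t))) *\<^sub>O (P o\<^sub>L (S z t o\<^sub>L G z))) x"
      by (simp add: blinfun.diff_left scale_op.rep_eq blinfun.add_right scaleC.minus_left
          clinear_opD[OF projection_clinear[OF P]])
  qed
  then have "norm ((P o\<^sub>L S z t) - (1 / (1 + \<i> * t)) *\<^sub>O P) \<le>
      cmod (- (1 / (1 + \<i> * t))) * norm (P o\<^sub>L (S z t o\<^sub>L G z))"
    by (simp only: norm_scale_op_le)
  also have "\<dots> \<le> (2 / (1 + t)) * (norm P * (M z / (1 + t) * norm (G z)))"
  proof (rule mult_mono)
    show "cmod (- (1 / (1 + \<i> * t))) \<le> 2 / (1 + t)"
      using cmod_one_plus_ge[OF t] t nz by (simp add: norm_divide field_simps)
    show "norm (P o\<^sub>L (S z t o\<^sub>L G z)) \<le> norm P * (M z / (1 + t) * norm (G z))"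
      by (intro norm_blinfun_compose_le norm_S t order_refl)
  qed (use t in auto)
  finally show ?thesis by (simp add: power2_eq_square)
qed

text \<open>Evaluation at \<open>x\<close> is a bounded linear functional of the operator, so it may
  be moved into the norm integral. The factor i removes the -i in the definition of the
  logarithm.\<close>

lemma log_form:
  assumes x: "P x = x"
  shows "((\<lambda>t. cinner x (S z t x) - 1 / (1 + \<i> * t) * cinner x x) has_integral
    \<i> * cinner x (log_in P (P + G z) x)) {0..}"
proof -
  define K where "K t = (P o\<^sub>L S z t) - (1 / (1 + \<i> * of_real t)) *\<^sub>O P" for t
  have nz: "1 + \<i> * of_real t \<noteq> 0" for t by (simp add: complex_eq_iff)
  have scale_cont: "continuous_on {0..} (\<lambda>t. (1 / (1 + \<i> * of_real t)) *\<^sub>O P)"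
  proof -
    have "bounded_linear (\<lambda>c. c *\<^sub>O P)"
      by (rule bounded_linear_intro[where K = "norm P"])
         (auto intro!: blinfun_eqI norm_scale_op_le[THEN order_trans]
           simp: scale_op.rep_eq blinfun.add_left blinfun.scaleR_left scaleC_add_left scaleC.scaleR_left)
    then show ?thesis
      by (rule bounded_linear.continuous_on) (intro continuous_intros ballI nz)
  qed
  have "K integrable_on {0..}"
  proof (rule halfline_integrable)
    show "continuous_on {0..} K"
      unfolding K_def
      by (intro continuous_on_diff scale_cont
          bounded_bilinear.continuous_on[OF bounded_bilinear_blinfun_compose] continuous_S continuous_on_const)
    show "norm (K t) \<le> 2 * (norm P * M z * norm (G z)) / (1 + t)\<^sup>2" if "t \<ge> 0" for t
      unfolding K_def by (rule log_integrand_bound[OF that])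
  qed
  then have K: "(K has_integral integral {0..} K) {0..}" by (rule integrable_integral)
  have "log_in P (P + G z) = (- \<i>) *\<^sub>O integral {0..} K"
    unfolding log_in_eq_log_upper log_upper_def
    by (rule arg_cong[where f = "\<lambda>T. (- \<i>) *\<^sub>O T"], rule integral_cong)
       (simp add: K_def inverse_in_eq)
  then have "\<i> * cinner x (log_in P (P + G z) x) = cinner x (integral {0..} K x)"
    by (simp add: scale_op.rep_eq cinner_scaleC_right cinner.minus_right)
  moreover have "bounded_linear (\<lambda>T :: 'a oper. cinner x (T x))"
    by (rule bounded_linear_compose[OF cinner.bounded_linear_right blinfun.bounded_linear_left])
  from has_integral_linear[OF K this]
  have "((\<lambda>t. cinner x (K t x)) has_integral cinner x (integral {0..} K x)) {0..}"
    by (simp add: o_def)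
  moreover have "cinner x (K t x) = cinner x (S z t x) - 1 / (1 + \<i> * t) * cinner x x" for t
    using projection_sym[OF P, of x "S z t x"] x
    by (simp add: K_def blinfun.diff_left cinner.diff_right scale_op.rep_eq cinner_scaleC_right)
  ultimately show ?thesis by simp
qed

end

section \<open>Variation of the logarithm along real increments\<close>

lemma M_cong: "Im w = Im z \<Longrightarrow> M w = M z"
  by (simp add: M_def)

lemma S_diff_resolvent:
  assumes z: "s * Im z > 0" and w: "s * Im w > 0" and t: "t \<ge> 0"
  shows "S z t x - S w t x = (- (of_real s * (z - w))) *\<^sub>C S z t (adj L (R z (R w (L (S w t x)))))"
proof -
  note Imz = Im_z[OF z] and Imw = Im_z[OF w]
  define y where "y = S w t x"
  have "x = W w t y" using S_right[OF w t] by (simp add: y_def)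
  also have "\<dots> = W z t y + (G w y - G z y)" by (simp add: W_apply)
  also have "G w y - G z y = - (s *\<^sub>R adj L (R z (L y) - R w (L y)))"
    by (simp add: G_apply blinfun.diff_right scaleR_diff_right)
  also have "R z (L y) - R w (L y) = (z - w) *\<^sub>C R z (R w (L y))"
    by (rule resolvent_identity[OF res[OF Imz] res[OF Imw]])
  also have "- (s *\<^sub>R adj L ((z - w) *\<^sub>C R z (R w (L y)))) = (- (of_real s * (z - w))) *\<^sub>C adj L (R z (R w (L y)))"
    by (simp add: clinear_opD[OF clinear_adj[OF clL]] scaleR_eq_scaleC scaleC_scaleC scaleC.minus_left)
  finally have "S z t x = y + (- (of_real s * (z - w))) *\<^sub>C S z t (adj L (R z (R w (L y))))"
    by (metis S_left[OF z t] blinfun.add_right clS[OF z t] clinear_opD)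
  then show ?thesis by (simp add: y_def)
qed

text \<open>Up to the factor -s, the difference quotient of (x, S x) between \<open>z\<close> and
  \<open>w\<close>; at w = z it is a diagonal element of S (adj L) R R L S.\<close>

definition q :: "complex \<Rightarrow> complex \<Rightarrow> 'a \<Rightarrow> real \<Rightarrow> complex"
  where "q z w x t = cinner x (S z t (adj L (R z (R w (L (S w t x))))))"

lemma
  assumes z: "s * Im z > 0" and w: "Im w = Im z"
  shows q_bound: "t \<ge> 0 \<Longrightarrow> cmod (q z w x t) \<le> (M z ^ 2 * norm L ^ 2 / Im z ^ 2 * norm x ^ 2) / (1 + t)\<^sup>2"
    and q_continuous: "continuous_on {0..} (q z w x)"
proof -
  have w': "s * Im w > 0" using z w by simp
  note Imz = Im_z[OF z] and Imw = Im_z[OF w']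
  show "continuous_on {0..} (q z w x)"
    unfolding q_def
    by (intro cinner.continuous_on blinfun.continuous_on continuous_on_const continuous_S z w')
  show "cmod (q z w x t) \<le> (M z ^ 2 * norm L ^ 2 / Im z ^ 2 * norm x ^ 2) / (1 + t)\<^sup>2" if t: "t \<ge> 0"
  proof -
    have "norm (S z t (adj L (R z (R w (L (S w t x)))))) \<le>
        M z / (1 + t) * (norm L * (1 / \<bar>Im z\<bar> * (1 / \<bar>Im z\<bar> * (norm L * (M z / (1 + t) * norm x)))))"
      using norm_S[OF z t] norm_S[OF w' t] M_cong[OF w] norm_R[OF Imz] norm_R[OF Imw] w norm_adj_le[OF clL]
      by (intro norm_blinfun_le) auto
    then have "cmod (q z w x t) \<le> norm x * (M z / (1 + t) * (norm L * (1 / \<bar>Im z\<bar> * (1 / \<bar>Im z\<bar> * (norm L * (M z / (1 + t) * norm x))))))"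
      unfolding q_def by (rule order_trans[OF cinner_norm_le mult_left_mono]) simp
    also have "\<dots> = (M z ^ 2 * norm L ^ 2 / Im z ^ 2 * norm x ^ 2) / (1 + t)\<^sup>2"
      unfolding power2_abs[symmetric, of "Im z"] power2_eq_square
      by (simp add: ac_simps)
    finally show ?thesis .
  qed
qed

lemma q_integrable: "s * Im z > 0 \<Longrightarrow> Im w = Im z \<Longrightarrow> q z w x integrable_on {0..}"
  by (rule halfline_integrable[OF q_continuous q_bound])

text \<open>The scalar terms of the two logarithms do not depend on the spectral parameter and
  cancel.\<close>

lemma log_difference:
  assumes z: "s * Im z > 0" and w: "Im w = Im z" and x: "P x = x"
  shows "cinner x (log_in P (P + G z) x) - cinner x (log_in P (P + G w) x) =
    \<i> * (of_real s * (z - w)) * integral {0..} (q z w x)"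
proof -
  have w': "s * Im w > 0" using z w by simp
  have "((\<lambda>t. (cinner x (S z t x) - 1 / (1 + \<i> * t) * cinner x x) - (cinner x (S w t x) - 1 / (1 + \<i> * t) * cinner x x))
      has_integral (\<i> * cinner x (log_in P (P + G z) x) - \<i> * cinner x (log_in P (P + G w) x))) {0..}"
    by (intro has_integral_diff log_form z w' x)
  moreover have "(cinner x (S z t x) - 1 / (1 + \<i> * t) * cinner x x) - (cinner x (S w t x) - 1 / (1 + \<i> * t) * cinner x x) =
      (- (of_real s * (z - w))) * q z w x t" if "t \<in> {0..}" for t
    using S_diff_resolvent[OF z w', of t x] that
    by (simp add: q_def cinner_scaleC_right cinner.diff_right[symmetric] cinner.minus_right)
  ultimately have "((\<lambda>t. (- (of_real s * (z - w))) * q z w x t) has_integral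
      (\<i> * cinner x (log_in P (P + G z) x) - \<i> * cinner x (log_in P (P + G w) x))) {0..}"
    by (rule has_integral_eq[rotated])
  moreover have "((\<lambda>t. (- (of_real s * (z - w))) * q z w x t) has_integral (- (of_real s * (z - w))) * integral {0..} (q z w x)) {0..}"
    by (intro has_integral_mult_right integrable_integral q_integrable z w)
  ultimately have "\<i> * cinner x (log_in P (P + G z) x) - \<i> * cinner x (log_in P (P + G w) x) =
      (- (of_real s * (z - w))) * integral {0..} (q z w x)"
    by (rule has_integral_unique)
  \<comment> \<open>Multiplication by i clears the factor i on the left, since i^2 = -1.\<close>
  then have "\<i> * (\<i> * cinner x (log_in P (P + G z) x) - \<i> * cinner x (log_in P (P + G w) x)) =
      \<i> * ((- (of_real s * (z - w))) * integral {0..} (q z w x))" by simp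
  then show ?thesis by (simp add: algebra_simps)
qed

end

section \<open>Trace formula for a definite perturbation\<close>

text \<open>Turns integrability of the weighted trace norm into a majorant for any kernel of order
  1/(1 + t^2), for single coefficients and traces alike.\<close>

lemma weighted_integrable:
  fixes f k :: "real \<Rightarrow> complex" and \<theta> :: "real \<Rightarrow> real"
  assumes f: "f \<in> borel_measurable lebesgue" and le: "AE t in lebesgue. cmod (f t) \<le> \<theta> t"
    and \<theta>: "integrable lebesgue (\<lambda>t. \<theta> t / (1 + t\<^sup>2))"
    and k: "k \<in> borel_measurable borel" and K: "\<And>t. cmod (k t) \<le> K / (1 + t\<^sup>2)"
  shows "integrable lebesgue (\<lambda>t. f t * k t)"
    and "AE t in lebesgue. cmod (f t * k t) \<le> K * (\<theta> t / (1 + t\<^sup>2))"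
proof -
  have [measurable]: "f \<in> borel_measurable lebesgue" "k \<in> borel_measurable lebesgue"
    using f measurable_completion[of k lborel borel] k by simp_all
  show *: "AE t in lebesgue. cmod (f t * k t) \<le> K * (\<theta> t / (1 + t\<^sup>2))"
    using le
  proof eventually_elim
    case (elim t)
    have "cmod (f t * k t) \<le> \<theta> t * (K / (1 + t\<^sup>2))"
      unfolding norm_mult by (rule mult_mono[OF elim K order_trans[OF norm_ge_zero elim] norm_ge_zero])
    then show ?case by (simp add: mult.commute)
  qed
  show "integrable lebesgue (\<lambda>t. f t * k t)"
  proof (rule Bochner_Integration.integrable_bound)
    show "integrable lebesgue (\<lambda>t. K * (\<theta> t / (1 + t\<^sup>2)))" by (intro integrable_mult_right \<theta>)
    show "AE t in lebesgue. norm (f t * k t) \<le> norm (K * (\<theta> t / (1 + t\<^sup>2)))"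
      using * by eventually_elim (metis abs_ge_self order_trans real_norm_def)
  qed measurable
qed

lemma shift_family_onb: "shift_family P c F \<Xi> \<Longrightarrow> \<exists>B. is_onb (range P) B"
  unfolding shift_family_def trace_class_def by blast

text \<open>A positive operator is its own absolute value, so trace and trace norm agree. Hence the
  trace norm hypothesis controls the traces in xi and dominates all partial sums of the
  diagonal.\<close>

lemma positive_trace_class_trace:
  fixes P T :: "'a::{complex_hilbert_space, second_countable_topology} oper"
  assumes E: "frame (id_blinfun :: 'a oper) E" and P: "projection P" and T: "positive_op T"
    and tc: "trace_class P T"
  shows "op_trace P T = complex_of_real (trace_norm P T)"
    and "((\<lambda>n. cmod (cinner (trace_seq P n) (T (trace_seq P n)))) has_sum trace_norm P T) UNIV"
    and "((\<lambda>n. cinner (trace_seq P n) (T (trace_seq P n))) has_sum complex_of_real (trace_norm P T)) UNIV"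
proof -
  obtain B where B: "is_onb (range P) B" and sum: "(\<lambda>e. cinner e (T e)) summable_on B"
    using tc abs_op_positive[OF T] by (auto simp: trace_class_def)
  have ex: "\<exists>B. is_onb (range P) B" using B by blast
  obtain c where "((\<lambda>e. cinner e (T e)) has_sum c) B" using sum by (auto simp: summable_on_def)
  then have "((\<lambda>n. cinner (padded_seq B n) (T (padded_seq B n))) has_sum c) UNIV"
    by (subst has_sum_padded_seq) (simp_all add: onb_countable[OF B])
  then have c: "((\<lambda>n. cinner (trace_seq P n) (T (trace_seq P n))) has_sum c) UNIV"
    by (rule positive_trace_basis_independent[OF E P frame_onb[OF P B] frame_trace_seq[OF P ex] T])
  then have tr: "op_trace P T = c" by (rule op_traceI[OF P ex])
  then have tn: "trace_norm P T = Re c" by (simp add: trace_norm_def abs_op_positive[OF T])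
  have real: "cinner x (T x) = complex_of_real (cmod (cinner x (T x)))" for x
    using positive_op_Re[OF T, of x] positive_op_Im[OF T, of x] by (simp add: complex_eq_iff cmod_eq_Re)
  have "((\<lambda>n. Im (cinner (trace_seq P n) (T (trace_seq P n)))) has_sum Im c) UNIV"
    by (rule has_sum_bounded_linear[OF bounded_linear_Im c])
  then have "Im c = 0" using infsumI by (fastforce simp: positive_op_Im[OF T])
  then have cr: "complex_of_real (Re c) = c" by (simp add: complex_eq_iff)
  show "op_trace P T = complex_of_real (trace_norm P T)" by (simp add: tr tn cr)
  show "((\<lambda>n. cinner (trace_seq P n) (T (trace_seq P n))) has_sum complex_of_real (trace_norm P T)) UNIV"
    using c by (simp add: tn cr)
  then have "((\<lambda>n. complex_of_real (cmod (cinner (trace_seq P n) (T (trace_seq P n))))) has_sum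
      complex_of_real (trace_norm P T)) UNIV"
    by (simp only: real[symmetric])
  then show "((\<lambda>n. cmod (cinner (trace_seq P n) (T (trace_seq P n)))) has_sum trace_norm P T) UNIV"
    by (simp only: has_sum_of_real_iff)
qed

lemma null_diff_tendsto:
  fixes X :: "nat \<Rightarrow> 'b::real_normed_vector"
  assumes "\<And>k. norm (l - X k) \<le> C * h k" "h \<longlonglongrightarrow> 0"
  shows "X \<longlonglongrightarrow> l"
proof -
  have "(\<lambda>k. C * h k) \<longlonglongrightarrow> C * 0" by (intro tendsto_intros assms)
  then have lim: "(\<lambda>k. C * h k) \<longlonglongrightarrow> 0" by simp
  have "(\<lambda>k. l - X k) \<longlonglongrightarrow> 0"
    by (rule Lim_null_comparison[OF _ lim]) (simp add: assms(1))
  from tendsto_diff[OF tendsto_const[of l] this] show ?thesis by simp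
qed

context definite_perturbation
begin

lemma q_tendsto:
  assumes z: "s * Im z > 0" and t: "t \<ge> 0"
    and w: "\<And>k. Im (w k) = Im z" "w \<longlonglongrightarrow> z"
  shows "(\<lambda>k. q z (w k) x t) \<longlonglongrightarrow> q z z x t"
proof -
  have w': "s * Im (w k) > 0" for k using z w by simp
  note Imz = Im_z[OF z] and Imw = Im_z[OF w']
  define h where "h k = cmod (z - w k)" for k
  have h: "h \<longlonglongrightarrow> 0"
    unfolding h_def using tendsto_norm[OF tendsto_diff[OF tendsto_const[of z] w(2)]] by simp
  have "norm (R z - R (w k)) \<le> (1 / \<bar>Im z\<bar> * (1 / \<bar>Im z\<bar>)) * h k" for k
  proof -
    have "R z - R (w k) = (z - w k) *\<^sub>O (R z o\<^sub>L R (w k))"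
      by (rule blinfun_eqI)
         (simp add: blinfun.diff_left scale_op.rep_eq resolvent_identity[OF res[OF Imz] res[OF Imw]])
    then have 1: "norm (R z - R (w k)) \<le> h k * norm (R z o\<^sub>L R (w k))"
      by (simp add: norm_scale_op_le h_def)
    have 2: "norm (R z o\<^sub>L R (w k)) \<le> 1 / \<bar>Im z\<bar> * (1 / \<bar>Im z\<bar>)"
      by (rule norm_blinfun_compose_le) (use norm_R[OF Imz] norm_R[OF Imw, of k] w in auto)
    have "h k * norm (R z o\<^sub>L R (w k)) \<le> h k * (1 / \<bar>Im z\<bar> * (1 / \<bar>Im z\<bar>))"
      by (rule mult_left_mono[OF 2]) (simp add: h_def)
    from order_trans[OF 1 this] show ?thesis unfolding mult.commute[of _ "h k"] .
  qed
  then have Rw: "(\<lambda>k. R (w k)) \<longlonglongrightarrow> R z" using h by (rule null_diff_tendsto)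
  have "norm (S z t - S (w k) t) \<le> (M z * (norm L * (1 / \<bar>Im z\<bar> * (1 / \<bar>Im z\<bar> * (norm L * M z))))) * h k" for k
  proof -
    define T where "T = S z t o\<^sub>L (adj L o\<^sub>L (R z o\<^sub>L (R (w k) o\<^sub>L (L o\<^sub>L S (w k) t))))"
    have "S z t - S (w k) t = (- (of_real s * (z - w k))) *\<^sub>O T"
      by (rule blinfun_eqI)
         (simp add: T_def blinfun.diff_left scale_op.rep_eq S_diff_resolvent[OF z w' t])
    then have "norm (S z t - S (w k) t) \<le> cmod (- (of_real s * (z - w k))) * norm T"
      by (simp only: norm_scale_op_le)
    also have "cmod (- (of_real s * (z - w k))) = h k"
      using s by (auto simp: h_def norm_mult norm_minus_commute)
    finally have 1: "norm (S z t - S (w k) t) \<le> h k * norm T" .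
    have 2: "norm T \<le> M z * (norm L * (1 / \<bar>Im z\<bar> * (1 / \<bar>Im z\<bar> * (norm L * M z))))"
      unfolding T_def
      using norm_S_const[OF z t] norm_S_const[OF w' t, of k] M_cong[OF w(1)] norm_R[OF Imz]
        norm_R[OF Imw, of k] w(1) norm_adj_le[OF clL]
      by (intro norm_blinfun_compose_le) auto
    have "h k * norm T \<le> h k * (M z * (norm L * (1 / \<bar>Im z\<bar> * (1 / \<bar>Im z\<bar> * (norm L * M z)))))"
      by (rule mult_left_mono[OF 2]) (simp add: h_def)
    from order_trans[OF 1 this] show ?thesis unfolding mult.commute[of _ "h k"] .
  qed
  then have Sw: "(\<lambda>k. S (w k) t) \<longlonglongrightarrow> S z t" using h by (rule null_diff_tendsto)
  show ?thesis
    unfolding q_def by (intro cinner.tendsto blinfun.tendsto tendsto_const Rw Sw)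
qed

text \<open>\<open>S_diff_shift\<close> gives f r - f t = (r - t) g r exactly, with g continuous, so
  the derivative is g t.\<close>

lemma S_vector_derivative:
  assumes z: "s * Im z > 0" and t: "t \<in> {0..b}"
  shows "((\<lambda>t. cinner u (S z t v)) has_vector_derivative - \<i> * cinner u (S z t (S z t v))) (at t within {0..b})"
  unfolding has_vector_derivative_def has_derivative_within
proof (intro conjI bounded_linear_scaleR_left)
  define f g where "f r = cinner u (S z r v)" and "g r = - \<i> * cinner u (S z r (S z t v))" for r
  have "continuous_on {0..} g"
    unfolding g_def
    by (intro continuous_intros cinner.continuous_on blinfun.continuous_on continuous_S z)
  then have "(g \<longlongrightarrow> g t) (at t within {0..b})"
    using continuous_on_subset[of "{0..}" g "{0..b}"] t by (auto simp: continuous_on_def)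
  then have g: "((\<lambda>r. norm (g r - g t)) \<longlongrightarrow> 0) (at t within {0..b})"
    by (simp add: tendsto_norm_zero_iff LIM_zero_iff)
  have quot: "f r - f t = (r - t) *\<^sub>R g r" if "r \<in> {0..b}" for r
  proof -
    have "f r - f t = cinner u (S z r v - S z t v)" by (simp add: f_def cinner.diff_right)
    also have "S z r v - S z t v = (\<i> * (t - r)) *\<^sub>C S z r (S z t v)"
      by (rule S_diff_shift[OF z]) (use that t in auto)
    also have "cinner u \<dots> = (\<i> * (t - r)) * cinner u (S z r (S z t v))"
      by (rule cinner_scaleC_right)
    finally show ?thesis by (simp add: g_def scaleR_conv_of_real algebra_simps)
  qed
  have "norm ((1 / norm (r - t)) *\<^sub>R (f r - (f t + (r - t) *\<^sub>R g t))) \<le> norm (g r - g t)"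
    if "r \<in> {0..b}" for r
  proof -
    have "f r - (f t + (r - t) *\<^sub>R g t) = (r - t) *\<^sub>R (g r - g t)"
      using quot[OF that] by (simp add: scaleR_diff_right diff_diff_eq[symmetric])
    then show ?thesis by simp
  qed
  then have "((\<lambda>r. (1 / norm (r - t)) *\<^sub>R (f r - (f t + (r - t) *\<^sub>R g t))) \<longlongrightarrow> 0) (at t within {0..b})"
    by (intro Lim_null_comparison[OF _ g]) (simp add: eventually_at_filter)
  then show "((\<lambda>y. (1 / norm (y - t)) *\<^sub>R (cinner u (S z y v) - (cinner u (S z t v) + (y - t) *\<^sub>R
      (- \<i> * cinner u (S z t (S z t v)))))) \<longlongrightarrow> 0) (at t within {0..b})"
    by (simp only: f_def g_def)
qed

text \<open>S z t is an antiderivative of -i S^2, and the boundary term at infinity vanishes by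
  \<open>norm_S\<close>. It is stated weakly because only matrix elements are integrated.\<close>

lemma S_square_integral:
  assumes z: "s * Im z > 0"
  shows "\<i> * integral {0..} (\<lambda>t. cinner u (S z t (S z t v))) = cinner u (S0 z v)"
proof -
  define f where "f t = cinner u (S z t (S z t v))" for t
  have cont: "continuous_on {0..} f"
    unfolding f_def by (intro cinner.continuous_on blinfun.continuous_on continuous_on_const continuous_S z)
  note norm_Sv = norm_blinfun_le[OF norm_S[OF z]]
  have bound: "cmod (f t) \<le> (norm u * M z ^ 2 * norm v) / (1 + t)\<^sup>2" if t: "t \<ge> 0" for t
  proof -
    have "norm (S z t (S z t v)) \<le> M z / (1 + t) * (M z / (1 + t) * norm v)"
      by (intro norm_Sv t order_refl)
    then have "cmod (f t) \<le> norm u * (M z / (1 + t) * (M z / (1 + t) * norm v))"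
      unfolding f_def by (rule order_trans[OF cinner_norm_le mult_left_mono]) simp
    then show ?thesis by (simp add: power2_eq_square ac_simps)
  qed
  have ftc: "\<i> * integral {0..real n} f = cinner u (S z 0 v) - cinner u (S z (real n) v)" for n
  proof -
    have "((\<lambda>t. - \<i> * f t) has_integral (cinner u (S z (real n) v) - cinner u (S z 0 v))) {0..real n}"
      unfolding f_def by (rule fundamental_theorem_of_calculus[OF of_nat_0_le_iff S_vector_derivative[OF z]])
    then have "integral {0..real n} (\<lambda>t. - \<i> * f t) = cinner u (S z (real n) v) - cinner u (S z 0 v)"
      by (rule integral_unique)
    then show ?thesis by (simp add: algebra_simps)
  qed
  have "(\<lambda>n. \<i> * integral {0..real n} f) \<longlonglongrightarrow> \<i> * integral {0..} f"
    by (intro tendsto_intros halfline_integral_limit[OF cont bound])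
  moreover have "(\<lambda>n. cinner u (S z 0 v) - cinner u (S z (real n) v)) \<longlonglongrightarrow> cinner u (S z 0 v) - 0"
  proof (intro tendsto_diff tendsto_const)
    have "(\<lambda>n. (norm u * M z * norm v) * inverse (real (Suc n))) \<longlonglongrightarrow> (norm u * M z * norm v) * 0"
      by (intro tendsto_mult tendsto_const LIMSEQ_inverse_real_of_nat)
    then have lim: "(\<lambda>n. (norm u * M z * norm v) * inverse (real (Suc n))) \<longlonglongrightarrow> 0" by simp
    show "(\<lambda>n. cinner u (S z (real n) v)) \<longlonglongrightarrow> 0"
    proof (rule Lim_null_comparison[OF always_eventually lim], rule allI)
      fix n
      have "cmod (cinner u (S z (real n) v)) \<le> norm u * (M z / (1 + real n) * norm v)"
        by (rule order_trans[OF cinner_norm_le mult_left_mono[OF norm_Sv]]) auto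
      then show "cmod (cinner u (S z (real n) v)) \<le> (norm u * M z * norm v) * inverse (real (Suc n))"
        by (simp add: divide_inverse ac_simps)
    qed
  qed
  ultimately have "\<i> * integral {0..} f = cinner u (S z 0 v) - 0"
    unfolding ftc by (rule LIMSEQ_unique)
  then show ?thesis by (simp add: f_def[abs_def] S_zero[OF z])
qed

section \<open>From diagonal coefficients to the trace\<close>

context
  fixes F :: "complex \<Rightarrow> 'a oper" and \<Xi> :: "real \<Rightarrow> 'a oper" and e :: "nat \<Rightarrow> 'a" and \<theta> :: "real \<Rightarrow> real"
  assumes fam: "shift_family P (complex_of_real s) F \<Xi>"
    and F: "\<And>z. F z = log_in P (P + G z)"
  defines "e \<equiv> trace_seq P" and "\<theta> \<equiv> \<lambda>t. trace_norm P (\<Xi> t)"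
begin

lemma e_frame: "frame P e" and P_e: "P (e n) = e n"
  unfolding e_def using frame_trace_seq[OF P] trace_seq_in_range[OF P] shift_family_onb[OF fam] by blast+

lemma \<theta>_integrable: "integrable lebesgue (\<lambda>t. \<theta> t / (1 + t\<^sup>2))"
  using fam by (simp add: shift_family_def \<theta>_def)

definition p :: "nat \<Rightarrow> real \<Rightarrow> complex" where "p n t = cinner (e n) (\<Xi> t (e n))"

lemma p_measurable: "p n \<in> borel_measurable lebesgue"
proof -
  have "e n \<in> range P" using P_e[of n] by (metis rangeI)
  then show ?thesis using fam unfolding p_def shift_family_def by blast
qed

lemma AE_trace:
  "AE t in lebesgue. op_trace P (\<Xi> t) = complex_of_real (\<theta> t) \<and>
    ((\<lambda>n. cmod (p n t)) has_sum \<theta> t) UNIV \<and> ((\<lambda>n. p n t) has_sum complex_of_real (\<theta> t)) UNIV"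
proof -
  have "AE t in lebesgue. positive_op (\<Xi> t) \<and> positive_op (P - \<Xi> t) \<and> trace_class P (\<Xi> t)"
    using fam by (simp add: shift_family_def)
  then show ?thesis
    by eventually_elim (auto simp: \<theta>_def p_def e_def intro: positive_trace_class_trace[OF E P])
qed

lemma AE_p_le: "AE t in lebesgue. cmod (p n t) \<le> \<theta> t"
  using AE_trace
proof eventually_elim
  case (elim t)
  then have "sum (\<lambda>n. cmod (p n t)) {n} \<le> \<theta> t" by (intro finite_sum_le_has_sum) auto
  then show ?case by simp
qed

text \<open>Subtracting the representations at two points removes the unknown constant
  \<open>C\<close> and the normalising term t/(1 + t^2); the common factor s (z - w) then
  cancels.\<close>

lemma coefficient_difference:
  assumes z: "s * Im z > 0" and w: "Im w = Im z" "w \<noteq> z"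
  shows "(LINT t|lebesgue. p n t * (1 / ((of_real t - z) * (of_real t - w)))) =
    \<i> * integral {0..} (q z w (e n))"
proof -
  have Imz: "Im z \<noteq> 0" "Im w \<noteq> 0" using z w by auto
  then have nr: "z \<notin> \<real>" "w \<notin> \<real>" by (auto simp: complex_is_Real_iff)
  have ran: "e n \<in> range P" using P_e[of n] by (metis rangeI)
  define k where "k v t = 1 / (of_real t - v) - complex_of_real (t / (1 + t\<^sup>2))" for v t
  obtain C where "\<forall>v. v \<notin> \<real> \<longrightarrow> (\<forall>x\<in>range P. \<forall>y\<in>range P. cinner x (F v y) = cinner x (C y) +
      of_real s * (LINT t|lebesgue. cinner x (\<Xi> t y) *
        (1 / (of_real t - v) - complex_of_real (t / (1 + t\<^sup>2)))))"
    using fam unfolding shift_family_def by blast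
  then have C: "cinner (e n) (F v (e n)) = cinner (e n) (C (e n)) +
      of_real s * (LINT t|lebesgue. p n t * k v t)" if "v \<notin> \<real>" for v
    using that ran unfolding p_def k_def by blast
  have int: "integrable lebesgue (\<lambda>t. p n t * k v t)" if v: "Im v \<noteq> 0" for v
  proof -
    obtain K where "\<And>t. cmod (k v t) \<le> K / (1 + t\<^sup>2)"
      using nevanlinna_kernel_bound[OF v] unfolding k_def by blast
    moreover have "k v \<in> borel_measurable borel" unfolding k_def by measurable
    ultimately show ?thesis
      using weighted_integrable(1)[OF p_measurable AE_p_le \<theta>_integrable] by blast
  qed
  have "of_real s * ((LINT t|lebesgue. p n t * k z t) - (LINT t|lebesgue. p n t * k w t)) =
      \<i> * (of_real s * (z - w)) * integral {0..} (q z w (e n))"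
    using log_difference[OF z w(1) P_e, of n] C[OF nr(1)] C[OF nr(2)] by (simp add: F algebra_simps)
  then have "(LINT t|lebesgue. p n t * k z t) - (LINT t|lebesgue. p n t * k w t) =
      (z - w) * (\<i> * integral {0..} (q z w (e n)))"
    using s by auto
  also have "(LINT t|lebesgue. p n t * k z t) - (LINT t|lebesgue. p n t * k w t) =
      (LINT t|lebesgue. p n t * k z t - p n t * k w t)"
    using int Imz by (simp add: Bochner_Integration.integral_diff)
  also have "\<dots> = (LINT t|lebesgue. (z - w) * (p n t * (1 / ((of_real t - z) * (of_real t - w)))))"
  proof (rule Bochner_Integration.integral_cong)
    fix t
    have "of_real t - z \<noteq> 0" "of_real t - w \<noteq> 0" using Imz by (auto simp: complex_eq_iff)
    then have "k z t - k w t = (z - w) * (1 / ((of_real t - z) * (of_real t - w)))"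
      by (simp add: k_def diff_frac_eq)
    then show "p n t * k z t - p n t * k w t =
        (z - w) * (p n t * (1 / ((of_real t - z) * (of_real t - w))))"
      by (simp only: right_diff_distrib[symmetric] mult.left_commute)
  qed simp
  also have "\<dots> = (z - w) * (LINT t|lebesgue. p n t * (1 / ((of_real t - z) * (of_real t - w))))"
    by (rule integral_mult_right_zero)
  finally show ?thesis using w by simp
qed

text \<open>Dominated convergence on both sides as \<open>w\<close> tends to \<open>z\<close> along
  a real increment, where neither majorant depends on \<open>w\<close>.\<close>

lemma coefficient_limit:
  assumes z: "s * Im z > 0"
  shows "(LINT t|lebesgue. p n t * (1 / (of_real t - z)\<^sup>2)) = \<i> * integral {0..} (q z z (e n))"
proof -
  define w where "w k = z + complex_of_real (inverse (real (Suc k)))" for k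
  have w: "Im (w k) = Im z" "w k \<noteq> z" for k by (simp_all add: w_def del: of_real_inverse of_nat_Suc)
  have "w \<longlonglongrightarrow> z + complex_of_real 0"
    unfolding w_def by (intro tendsto_intros tendsto_of_real LIMSEQ_inverse_real_of_nat)
  then have wz: "w \<longlonglongrightarrow> z" by simp
  have Imz: "Im z \<noteq> 0" using z by auto
  \<comment> \<open>The increments are at most 1, so \<open>a\<close> bounds the real parts of all
    points w k.\<close>
  define a where "a = \<bar>Re z\<bar> + 1"
  have Re: "\<bar>Re z\<bar> \<le> a" "\<bar>Re (w k)\<bar> \<le> a" for k
  proof -
    have "0 \<le> inverse (real (Suc k))" "inverse (real (Suc k)) \<le> 1" by (simp_all add: inverse_le_1_iff)
    moreover have "Re (w k) = Re z + inverse (real (Suc k))"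
      by (simp only: w_def plus_complex.sel Re_complex_of_real)
    ultimately show "\<bar>Re (w k)\<bar> \<le> a" unfolding a_def by linarith
  qed (simp add: a_def)
  define K where "K = 2 + (1 + 2 * a\<^sup>2) / Im z ^ 2"
  define kk where "kk v t = 1 / ((of_real t - z) * (of_real t - v))" for v t
  have kk_meas: "kk v \<in> borel_measurable borel" for v unfolding kk_def by measurable
  have kk_le: "cmod (kk (w k) t) \<le> K / (1 + t\<^sup>2)" for k t
    unfolding kk_def K_def using resolvent_kernel_product_bound[OF Imz w(1) Re] by blast
  have kk_le': "cmod (kk z t) \<le> K / (1 + t\<^sup>2)" for t
    unfolding kk_def K_def using resolvent_kernel_product_bound[OF Imz refl Re(1) Re(1)] by blast
  note wi = weighted_integrable[OF p_measurable AE_p_le \<theta>_integrable kk_meas]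
  have lim1: "(\<lambda>k. LINT t|lebesgue. p n t * kk (w k) t) \<longlonglongrightarrow> (LINT t|lebesgue. p n t * kk z t)"
  proof (rule integral_dominated_convergence)
    show "(\<lambda>t. p n t * kk z t) \<in> borel_measurable lebesgue"
      using wi(1)[OF kk_le'] by (rule borel_measurable_integrable)
    show "(\<lambda>t. p n t * kk (w k) t) \<in> borel_measurable lebesgue" for k
      using wi(1)[OF kk_le] by (rule borel_measurable_integrable)
    show "integrable lebesgue (\<lambda>t. K * (\<theta> t / (1 + t\<^sup>2)))" by (intro integrable_mult_right \<theta>_integrable)
    show "AE t in lebesgue. cmod (p n t * kk (w k) t) \<le> K * (\<theta> t / (1 + t\<^sup>2))" for k
      by (rule wi(2)[OF kk_le])
    have "(\<lambda>k. p n t * kk (w k) t) \<longlonglongrightarrow> p n t * kk z t" for t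
      unfolding kk_def by (intro tendsto_intros wz) (use Imz in \<open>auto simp: complex_eq_iff\<close>)
    then show "AE t in lebesgue. (\<lambda>k. p n t * kk (w k) t) \<longlonglongrightarrow> p n t * kk z t" by simp
  qed
  have eq: "(LINT t|lebesgue. p n t * kk (w k) t) = \<i> * integral {0..} (q z (w k) (e n))" for k
    unfolding kk_def by (rule coefficient_difference[OF z w])
  have lim2: "(\<lambda>k. \<i> * integral {0..} (q z (w k) (e n))) \<longlonglongrightarrow> \<i> * integral {0..} (q z z (e n))"
  proof (intro tendsto_mult tendsto_const dominated_convergence(2))
    show "q z (w k) (e n) integrable_on {0..}" for k by (rule q_integrable[OF z w(1)])
    show "(\<lambda>t. (M z ^ 2 * norm L ^ 2 / Im z ^ 2 * norm (e n) ^ 2) / (1 + t)\<^sup>2) integrable_on {0::real..}"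
      using has_integral_inverse_square by blast
    show "cmod (q z (w k) (e n) t) \<le> (M z ^ 2 * norm L ^ 2 / Im z ^ 2 * norm (e n) ^ 2) / (1 + t)\<^sup>2"
      if "t \<in> {0..}" for k t using q_bound[OF z w(1)] that by simp
    show "(\<lambda>k. q z (w k) (e n) t) \<longlonglongrightarrow> q z z (e n) t" if "t \<in> {0..}" for t
      using q_tendsto[OF z _ w(1) wz] that by simp
  qed
  have "(LINT t|lebesgue. p n t * kk z t) = \<i> * integral {0..} (q z z (e n))"
    by (rule LIMSEQ_unique[OF lim1[unfolded eq] lim2])
  then show ?thesis by (simp add: kk_def power2_eq_square)
qed

text \<open>Summation over the basis passes under the integral because the partial sums of |p n t|
  stay below the trace norm.\<close>

lemma \<theta>_kernel:
  assumes z: "Im z \<noteq> 0"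
  shows "integrable lebesgue (\<lambda>t. complex_of_real (\<theta> t) * (1 / (of_real t - z)\<^sup>2))"
    and "(\<lambda>n. LINT t|lebesgue. p n t * (1 / (of_real t - z)\<^sup>2)) sums
      (LINT t|lebesgue. complex_of_real (\<theta> t) * (1 / (of_real t - z)\<^sup>2))"
proof -
  define k where "k t = 1 / (of_real t - z)\<^sup>2" for t
  define K where "K = 2 + (1 + 2 * Re z ^ 2) / Im z ^ 2"
  have k_meas: "k \<in> borel_measurable borel" unfolding k_def by measurable
  have k_le: "cmod (k t) \<le> K / (1 + t\<^sup>2)" for t
    unfolding k_def K_def by (rule resolvent_kernel_square_bound[OF z])
  have \<theta>_nonneg: "AE t in lebesgue. cmod (complex_of_real (\<theta> t)) \<le> \<theta> t"
    using AE_p_le[of 0]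
  proof eventually_elim
    case (elim t)
    then have "0 \<le> \<theta> t" by (rule order_trans[OF norm_ge_zero])
    then show ?case by simp
  qed
  \<comment> \<open>Measurability of the trace norm is recovered from the integrable quotient by
    multiplying the weight back.\<close>
  have \<theta>_meas: "\<theta> \<in> borel_measurable lebesgue"
  proof -
    have id: "(\<lambda>t::real. 1 + t\<^sup>2) \<in> borel_measurable lebesgue"
      using measurable_completion[of "\<lambda>t::real. 1 + t\<^sup>2" lborel borel] by simp
    have "(\<lambda>t. \<theta> t / (1 + t\<^sup>2) * (1 + t\<^sup>2)) \<in> borel_measurable lebesgue"
      by (intro borel_measurable_times id borel_measurable_integrable[OF \<theta>_integrable])
    moreover have "\<theta> t / (1 + t\<^sup>2) * (1 + t\<^sup>2) = \<theta> t" for t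
    proof -
      have "1 + t\<^sup>2 > 0" by (simp add: add_pos_nonneg)
      then show ?thesis by simp
    qed
    ultimately show ?thesis by (simp only:)
  qed
  have \<theta>_meas': "(\<lambda>t. complex_of_real (\<theta> t)) \<in> borel_measurable lebesgue"
    using \<theta>_meas by measurable
  show int: "integrable lebesgue (\<lambda>t. complex_of_real (\<theta> t) * (1 / (of_real t - z)\<^sup>2))"
    using weighted_integrable(1)[OF \<theta>_meas' \<theta>_nonneg \<theta>_integrable k_meas k_le] by (simp add: k_def)
  note wi = weighted_integrable[OF p_measurable AE_p_le \<theta>_integrable k_meas k_le]
  have "(\<lambda>N. LINT t|lebesgue. (\<Sum>n<N. p n t) * k t) \<longlonglongrightarrow> (LINT t|lebesgue. complex_of_real (\<theta> t) * k t)"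
  proof (rule integral_dominated_convergence)
    show "(\<lambda>t. complex_of_real (\<theta> t) * k t) \<in> borel_measurable lebesgue"
      using borel_measurable_integrable[OF int] by (simp add: k_def)
    show "(\<lambda>t. (\<Sum>n<N. p n t) * k t) \<in> borel_measurable lebesgue" for N
      unfolding sum_distrib_right
      by (intro borel_measurable_sum borel_measurable_integrable[OF wi(1)])
    show "integrable lebesgue (\<lambda>t. K * (\<theta> t / (1 + t\<^sup>2)))" by (intro integrable_mult_right \<theta>_integrable)
    show "AE t in lebesgue. (\<lambda>N. (\<Sum>n<N. p n t) * k t) \<longlonglongrightarrow> complex_of_real (\<theta> t) * k t"
      using AE_trace
    proof eventually_elim
      case (elim t)
      then have "(\<lambda>n. p n t) sums complex_of_real (\<theta> t)" by (blast intro: has_sum_imp_sums)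
      then show ?case unfolding sums_def by (intro tendsto_intros)
    qed
    show "AE t in lebesgue. cmod ((\<Sum>n<N. p n t) * k t) \<le> K * (\<theta> t / (1 + t\<^sup>2))" for N
      using AE_trace
    proof eventually_elim
      case (elim t)
      have "cmod (\<Sum>n<N. p n t) \<le> (\<Sum>n<N. cmod (p n t))" by (rule norm_sum)
      also have "\<dots> \<le> \<theta> t" by (rule finite_sum_le_has_sum) (use elim in auto)
      finally have le: "cmod (\<Sum>n<N. p n t) \<le> \<theta> t" .
      have "cmod ((\<Sum>n<N. p n t) * k t) \<le> \<theta> t * (K / (1 + t\<^sup>2))"
        unfolding norm_mult by (rule mult_mono[OF le k_le order_trans[OF norm_ge_zero le] norm_ge_zero])
      then show ?case by (simp add: mult.commute)
    qed
  qed
  moreover have "(LINT t|lebesgue. (\<Sum>n<N. p n t) * k t) = (\<Sum>n<N. LINT t|lebesgue. p n t * k t)" for N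
    unfolding sum_distrib_right by (rule Bochner_Integration.integral_sum) (rule wi(1))
  ultimately show "(\<lambda>n. LINT t|lebesgue. p n t * (1 / (of_real t - z)\<^sup>2)) sums
      (LINT t|lebesgue. complex_of_real (\<theta> t) * (1 / (of_real t - z)\<^sup>2))"
    unfolding sums_def k_def by simp
qed

text \<open>For each t, cyclicity exchanges the sum over the basis of ran P for one over
  \<open>E\<close>, which moves both factors S next to each other. Only then can the t-integral be
  evaluated by \<open>S_square_integral\<close>.\<close>

lemma trace_formula:
  assumes z: "s * Im z > 0"
  shows "((\<lambda>m. cinner (E m) ((R1 z - R z) (E m))) has_sum
    - of_real s * (LINT t|lebesgue. complex_of_real (\<theta> t) * (1 / (of_real t - z)\<^sup>2))) UNIV"
proof -
  note Imz = Im_z[OF z]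
  define X where "X = adj L o\<^sub>L R z"
  define Y where "Y = R z o\<^sub>L L"
  define c where "c = (1 / \<bar>Im z\<bar>)\<^sup>2 * a"
  have X: "hs_le X c" and Y: "hs_le Y c"
    unfolding X_def Y_def c_def
    by (rule hs_le_compose_right[OF E hs_le_adj[OF E L] clR[OF Imz] norm_R[OF Imz]],
        rule hs_le_compose_left[OF L clR[OF Imz] norm_R[OF Imz]])
  have Xt: "hs_le (S z t o\<^sub>L X) ((M z / (1 + t))\<^sup>2 * c)"
    and Yt: "hs_le (Y o\<^sub>L S z t) ((M z / (1 + t))\<^sup>2 * c)" if "t \<ge> 0" for t
    by (rule hs_le_compose_left[OF X clS[OF z that] norm_S[OF z that]],
        rule hs_le_compose_right[OF E Y clS[OF z that] norm_S[OF z that]])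
  \<comment> \<open>The projection that \<open>trace_cyclic\<close> leaves between the operators
    disappears, since \<open>adj L\<close> maps into ran P.\<close>
  have PX: "P (S z t (X v)) = S z t (X v)" if "t \<ge> 0" for t v
    by (simp add: S_P[OF z that, symmetric] X_def P_adj_L)
  define r where "r m t = cinner (E m) (Y (S z t (S z t (X (E m)))))" for m t
  have q_eq: "q z z x t = cinner x ((S z t o\<^sub>L X) ((Y o\<^sub>L S z t) x))" for x t
    by (simp add: q_def X_def Y_def)
  have r_eq: "r m t = cinner (E m) ((Y o\<^sub>L S z t) ((S z t o\<^sub>L X) (E m)))" for m t
    by (simp add: r_def)
  have qb: "(\<Sum>n<k. cmod (q z z (e n) t)) \<le> (M z ^ 2 * c) / (1 + t)\<^sup>2"
    and rb: "(\<Sum>n<k. cmod (r n t)) \<le> (M z ^ 2 * c) / (1 + t)\<^sup>2" if t: "t \<ge> 0" for k t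
  proof -
    have eq: "((M z / (1 + t))\<^sup>2 * c + (M z / (1 + t))\<^sup>2 * c) / 2 = (M z ^ 2 * c) / (1 + t)\<^sup>2"
      by (simp add: power_divide)
    show "(\<Sum>n<k. cmod (q z z (e n) t)) \<le> (M z ^ 2 * c) / (1 + t)\<^sup>2"
      using finite_sum_le_infsum[OF trace_product_bound(1)[OF E P e_frame Xt[OF t] Yt[OF t]], of "{..<k}"]
        trace_product_bound(2)[OF E P e_frame Xt[OF t] Yt[OF t]]
      unfolding q_eq eq by simp
    show "(\<Sum>n<k. cmod (r n t)) \<le> (M z ^ 2 * c) / (1 + t)\<^sup>2"
      using finite_sum_le_infsum[OF trace_product_bound(1)[OF E projection_id E Yt[OF t] Xt[OF t]], of "{..<k}"]
        trace_product_bound(2)[OF E projection_id E Yt[OF t] Xt[OF t]]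
      unfolding r_eq eq by simp
  qed
  have "\<exists>c. (\<lambda>n. q z z (e n) t) sums c \<and> (\<lambda>m. r m t) sums c" if t: "t \<ge> 0" for t
  proof -
    obtain c where "((\<lambda>n. cinner (e n) ((S z t o\<^sub>L X) (id_blinfun ((Y o\<^sub>L S z t) (e n))))) has_sum c) UNIV"
      "((\<lambda>m. cinner (E m) ((Y o\<^sub>L S z t) (P ((S z t o\<^sub>L X) (E m))))) has_sum c) UNIV"
      by (rule trace_cyclic[OF P projection_id e_frame E Xt[OF t] Yt[OF t]])
    then have "((\<lambda>n. q z z (e n) t) has_sum c) UNIV" "((\<lambda>m. r m t) has_sum c) UNIV"
      by (simp_all add: q_eq r_eq PX[OF t])
    then show ?thesis using has_sum_imp_sums by blast
  qed
  then obtain T where T: "t \<ge> 0 \<Longrightarrow> (\<lambda>n. q z z (e n) t) sums T t" "t \<ge> 0 \<Longrightarrow> (\<lambda>m. r m t) sums T t" for t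
    by metis
  have "(\<lambda>n. integral {0..} (q z z (e n))) sums integral {0..} T"
    by (rule halfline_sums[OF q_continuous[OF z refl] qb T(1)])
  then have "(\<lambda>n. \<i> * integral {0..} (q z z (e n))) sums (\<i> * integral {0..} T)"
    by (rule sums_mult)
  then have "(\<lambda>n. LINT t|lebesgue. p n t * (1 / (of_real t - z)\<^sup>2)) sums (\<i> * integral {0..} T)"
    by (simp only: coefficient_limit[OF z])
  \<comment> \<open>The same series has been summed in two ways: through the integral in t of the
    logarithm and through the spectral shift operators.\<close>
  then have I: "\<i> * integral {0..} T =
      (LINT t|lebesgue. complex_of_real (\<theta> t) * (1 / (of_real t - z)\<^sup>2))" (is "_ = ?I")
    using \<theta>_kernel(2)[OF Imz] by (rule sums_unique2)
  have r_cont: "continuous_on {0..} (r m)" for m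
    unfolding r_def
    by (intro cinner.continuous_on blinfun.continuous_on continuous_on_const continuous_S z)
  have "(\<lambda>m. integral {0..} (r m)) sums integral {0..} T"
    by (rule halfline_sums[OF r_cont rb T(2)])
  then have "(\<lambda>m. \<i> * integral {0..} (r m)) sums ?I"
    unfolding I[symmetric] by (rule sums_mult)
  \<comment> \<open>Here R L S0 (adj L) R = R1 L (adj L) R = -s (R1 - R), using s^2 = 1.\<close>
  moreover have "\<i> * integral {0..} (r m) = - of_real s * cinner (E m) ((R1 z - R z) (E m))" for m
  proof -
    have "r m = (\<lambda>t. cinner (adj Y (E m)) (S z t (S z t (X (E m)))))"
      by (rule ext) (simp add: r_def cinner_adj_left hs_le_clinear[OF Y])
    then have "\<i> * integral {0..} (r m) = cinner (E m) (Y (S0 z (X (E m))))"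
      using S_square_integral[OF z, of "adj Y (E m)" "X (E m)"]
      by (simp add: cinner_adj_left hs_le_clinear[OF Y])
    also have "Y (S0 z (X (E m))) = R1 z (L (adj L (R z (E m))))"
      by (simp add: X_def Y_def R_L_S0[OF Imz])
    also have "\<dots> = (- s) *\<^sub>R (R1 z (E m) - R z (E m))"
      using resolvent_A1(2)[OF Imz, of "E m"] s by auto
    finally show ?thesis
      by (simp add: cinner.minus_right cinner.scaleR_right blinfun.diff_left scaleR_conv_of_real)
  qed
  ultimately have "(\<lambda>m. - of_real s * cinner (E m) ((R1 z - R z) (E m))) sums ?I" by simp
  then have "(\<lambda>m. - of_real s * (- of_real s * cinner (E m) ((R1 z - R z) (E m)))) sums
      (- of_real s * ?I)"
    by (rule sums_mult)
  moreover have "- of_real s * (- of_real s * x) = x" for x :: complex using s by auto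
  ultimately have sums: "(\<lambda>m. cinner (E m) ((R1 z - R z) (E m))) sums (- of_real s * ?I)" by (simp only:)
  \<comment> \<open>So far only the ordered series converges. Up to sign the resolvent difference is
    (Y S0) X, a product of two Hilbert-Schmidt operators, which makes the sum absolute.\<close>
  have YS: "hs_le (Y o\<^sub>L S0 z) (norm (S0 z) ^ 2 * c)"
    by (rule hs_le_compose_right[OF E Y clS0[OF Imz] order_refl])
  have "cmod (cinner (E m) ((R1 z - R z) (E m))) = cmod (cinner (E m) ((Y o\<^sub>L S0 z) (X (E m))))" for m
  proof -
    have "(Y o\<^sub>L S0 z) (X (E m)) = R1 z (L (adj L (R z (E m))))"
      by (simp add: X_def Y_def R_L_S0[OF Imz])
    also have "\<dots> = (- s) *\<^sub>R (R1 z - R z) (E m)"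
      using resolvent_A1(2)[OF Imz, of "E m"] s by (auto simp: blinfun.diff_left)
    finally show ?thesis using s by (auto simp: cinner.minus_right)
  qed
  then have "(\<lambda>m. cmod (cinner (E m) ((R1 z - R z) (E m)))) summable_on UNIV"
    using trace_product_bound(1)[OF E projection_id E YS X] by simp
  then have "summable (\<lambda>m. cmod (cinner (E m) ((R1 z - R z) (E m))))"
    by (rule summable_on_imp_summable)
  then show ?thesis using sums by (rule norm_summable_imp_has_sum)
qed

text \<open>In the other half plane \<^const>\<open>log_in\<close> takes its second branch, but there the formula follows
  by conjugation.\<close>

lemma trace_formula_nonreal:
  assumes z: "Im z \<noteq> 0"
  shows "((\<lambda>m. cinner (E m) ((R1 z - R z) (E m))) has_sum
    - of_real s * (LINT t|lebesgue. complex_of_real (\<theta> t) * (1 / (of_real t - z)\<^sup>2))) UNIV"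
proof (cases "s * Im z > 0")
  case True
  then show ?thesis by (rule trace_formula)
next
  case False
  then have "s * Im (cnj z) > 0" using z s by auto
  note tf = has_sum_bounded_linear[OF bounded_linear_cnj trace_formula[OF this]]
  have adj: "adj (R z) = R (cnj z)" "adj (R1 z) = R1 (cnj z)"
    using adj_resolves[OF sa res[OF z] res[of "cnj z"]] adj_resolves[OF sa1 res1[OF z] res1[of "cnj z"]] z
    by simp_all
  have "cnj (cinner x ((R1 (cnj z) - R (cnj z)) x)) = cinner x ((R1 z - R z) x)" for x
  proof -
    have "cnj (cinner x (adj T x)) = cinner x (T x)" if "clinear_op T" for T
      by (metis cinner_adj_left cinner_commute that)
    then show ?thesis
      using clR[OF z] clR1[OF z] by (simp add: adj[symmetric] blinfun.diff_left cinner.diff_right)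
  qed
  moreover have "cnj (LINT t|lebesgue. complex_of_real (\<theta> t) * (1 / (complex_of_real t - cnj z)\<^sup>2)) =
      (LINT t|lebesgue. complex_of_real (\<theta> t) * (1 / (of_real t - z)\<^sup>2))"
    by (subst Bochner_Integration.integral_cnj[symmetric]) simp
  ultimately show ?thesis using tf by simp
qed

end

end

section \<open>The trace formula\<close>

text \<open>The factors are arranged so that each contains one copy of \<open>K\<close>, hence both
  are Hilbert-Schmidt.\<close>

lemma resolvent_difference_kernel:
  assumes "V = K o\<^sub>L J o\<^sub>L adj K" "resolves D H0 z R0" "resolves D (perturb H0 V) z R"
  shows "R - R0 = (- R0 o\<^sub>L K) o\<^sub>L (J o\<^sub>L adj K o\<^sub>L R)"
  using resolvent_perturb(1)[OF assms(2,3)] assms(1)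
  by (intro blinfun_eqI) (simp add: blinfun.diff_left blinfun.minus_left)

lemma hs_le_uminus_compose:
  assumes K: "hs_le K c" and R: "clinear_op R"
  shows "hs_le (- R o\<^sub>L K) (norm R ^ 2 * c)"
  by (rule hs_le_compose_left[OF K clinear_minus[OF R]]) simp

text \<open>The trace of the resolvent difference is moved into the form
  \<open>- \<Sum>\<^sub>m \<langle>K J E\<^sub>m, R R0 K E\<^sub>m\<rangle>\<close>, whose terms are dominated uniformly in the resolvents.\<close>

lemma resolvent_difference_trace:
  fixes K J R R0 :: "'a::complex_hilbert_space oper"
  assumes E: "frame (id_blinfun :: 'a oper) E" and K: "hs_le K c" and J: "clinear_op J" "adj J = J"
    and R: "clinear_op R" "clinear_op R0"
    and eq: "R - R0 = (- R0 o\<^sub>L K) o\<^sub>L (J o\<^sub>L adj K o\<^sub>L R)"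
  shows "(\<Sum>\<^sub>\<infinity>m. cinner (E m) ((R - R0) (E m))) = (\<Sum>m. - cinner (K (J (E m))) (R (R0 (K (E m)))))"
    and "cmod (- cinner (K (J (E m))) (R (R0 (K (E m))))) \<le>
      norm R * norm R0 * ((norm (K (J (E m))) ^ 2 + norm (K (E m)) ^ 2) / 2)"
proof -
  note clK = hs_le_clinear[OF K]
  have X: "hs_le (- R0 o\<^sub>L K) (norm R0 ^ 2 * c)" by (rule hs_le_uminus_compose[OF K R(2)])
  have JK: "hs_le (J o\<^sub>L adj K) (norm J ^ 2 * c)"
    by (rule hs_le_compose_left[OF hs_le_adj[OF E K] J(1) order_refl])
  have Y: "hs_le (J o\<^sub>L adj K o\<^sub>L R) (norm R ^ 2 * (norm J ^ 2 * c))"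
    by (rule hs_le_compose_right[OF E JK R(1) order_refl])
  have J_sym: "cinner x (J y) = cinner (J x) y" for x y
    using cinner_adj_left[OF J(1), of x y] J(2) by simp
  obtain S where "((\<lambda>n. cinner (E n) ((- R0 o\<^sub>L K) (id_blinfun ((J o\<^sub>L adj K o\<^sub>L R) (E n))))) has_sum S) UNIV"
    "((\<lambda>m. cinner (E m) ((J o\<^sub>L adj K o\<^sub>L R) (id_blinfun ((- R0 o\<^sub>L K) (E m))))) has_sum S) UNIV"
    by (rule trace_cyclic[OF projection_id projection_id E E X Y])
  then have 1: "((\<lambda>n. cinner (E n) ((R - R0) (E n))) has_sum S) UNIV"
    and 2: "((\<lambda>m. - cinner (K (J (E m))) (R (R0 (K (E m))))) has_sum S) UNIV"
    by (simp_all add: eq J_sym cinner_adj_right clK blinfun.minus_left blinfun.minus_right cinner.minus_right)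
  show "(\<Sum>\<^sub>\<infinity>m. cinner (E m) ((R - R0) (E m))) = (\<Sum>m. - cinner (K (J (E m))) (R (R0 (K (E m)))))"
    unfolding infsumI[OF 1] by (rule sums_unique[OF has_sum_imp_sums[OF 2]])
  have "cmod (- cinner (K (J (E m))) (R (R0 (K (E m))))) \<le> norm (K (J (E m))) * norm (R (R0 (K (E m))))"
    by (simp add: cinner_norm_le)
  also have "\<dots> \<le> norm (K (J (E m))) * (norm R * (norm R0 * norm (K (E m))))"
    by (intro mult_left_mono norm_blinfun_le order_refl) auto
  also have "\<dots> = norm R * norm R0 * (norm (K (J (E m))) * norm (K (E m)))" by simp
  also have "\<dots> \<le> norm R * norm R0 * ((norm (K (J (E m))) ^ 2 + norm (K (E m)) ^ 2) / 2)"
    by (intro mult_left_mono mult_le_mean_squares) auto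
  finally show "cmod (- cinner (K (J (E m))) (R (R0 (K (E m))))) \<le>
      norm R * norm R0 * ((norm (K (J (E m))) ^ 2 + norm (K (E m)) ^ 2) / 2)" .
qed

text \<open>Norm continuity follows from the first resolvent identity once the resolvents on the
  vertical line are bounded by the one at its real foot.\<close>

lemma self_adjoint_resolvent_vertical:
  assumes A: "self_adjoint_on D A" and z: "z \<in> \<real>" "z \<notin> spec D A"
  shows "resolves D A (z + \<i> * of_real \<epsilon>) (resolvent D A (z + \<i> * of_real \<epsilon>))"
    and "norm (resolvent D A (z + \<i> * of_real \<epsilon>)) \<le> norm (resolvent D A z)"
    and "((\<lambda>\<epsilon>. resolvent D A (z + \<i> * of_real \<epsilon>)) \<longlongrightarrow> resolvent D A z) (at 0)"
proof -
  have Imz: "Im z = 0" using z by (simp add: complex_is_Real_iff)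
  have res: "resolves D A z (resolvent D A z)" by (rule resolvent_resolves[OF A z(2)])
  show res': "resolves D A (z + \<i> * of_real \<epsilon>) (resolvent D A (z + \<i> * of_real \<epsilon>))" for \<epsilon>
  proof (cases "\<epsilon> = 0")
    case False
    then show ?thesis by (intro self_adjoint_resolves_nonreal(1)[OF A]) (simp add: Imz)
  qed (simp add: res)
  show bound: "norm (resolvent D A (z + \<i> * of_real \<epsilon>)) \<le> norm (resolvent D A z)" for \<epsilon>
    by (rule self_adjoint_resolves_near_real[OF A res Imz res']) simp
  show "((\<lambda>\<epsilon>. resolvent D A (z + \<i> * of_real \<epsilon>)) \<longlongrightarrow> resolvent D A z) (at 0)"
  proof (rule LIM_zero_cancel, rule Lim_null_comparison)
    show "\<forall>\<^sub>F \<epsilon> in at 0. norm (resolvent D A (z + \<i> * of_real \<epsilon>) - resolvent D A z) \<le>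
        \<bar>\<epsilon>\<bar> * (norm (resolvent D A z) * norm (resolvent D A z))"
    proof (intro always_eventually allI)
      fix \<epsilon> :: real
      define R' where "R' = resolvent D A (z + \<i> * of_real \<epsilon>)"
      have "R' - resolvent D A z = (\<i> * \<epsilon>) *\<^sub>O (R' o\<^sub>L resolvent D A z)"
        using resolvent_identity[OF res' res, of \<epsilon>]
        by (intro blinfun_eqI) (simp add: R'_def blinfun.diff_left scale_op.rep_eq)
      then have "norm (R' - resolvent D A z) \<le> \<bar>\<epsilon>\<bar> * norm (R' o\<^sub>L resolvent D A z)"
        using norm_scale_op_le[of "\<i> * \<epsilon>" "R' o\<^sub>L resolvent D A z"] by (simp add: norm_mult)
      also have "\<dots> \<le> \<bar>\<epsilon>\<bar> * (norm (resolvent D A z) * norm (resolvent D A z))"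
        by (intro mult_left_mono norm_blinfun_compose_le) (use bound[of \<epsilon>] in \<open>auto simp: R'_def\<close>)
      finally show "norm (R' - resolvent D A z) \<le> \<dots>" .
    qed
    have "((\<lambda>\<epsilon>. \<bar>\<epsilon>\<bar> * (norm (resolvent D A z) * norm (resolvent D A z))) \<longlongrightarrow>
        \<bar>0\<bar> * (norm (resolvent D A z) * norm (resolvent D A z))) (at (0::real))"
      by (intro tendsto_intros)
    then show "((\<lambda>\<epsilon>. \<bar>\<epsilon>\<bar> * (norm (resolvent D A z) * norm (resolvent D A z))) \<longlongrightarrow> 0) (at (0::real))"
      by simp
  qed
qed

lemma resolvent_difference_trace_limit:
  fixes K J :: "'a::complex_hilbert_space oper"
  assumes E: "frame (id_blinfun :: 'a oper) E" and K: "hs_le K c" and J: "clinear_op J" "adj J = J"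
    and H0: "self_adjoint_on D H0" and V: "V = K o\<^sub>L J o\<^sub>L adj K" and H: "self_adjoint_on D (perturb H0 V)"
    and z: "z \<in> \<real>" "z \<notin> spec D H0" "z \<notin> spec D (perturb H0 V)"
  shows "((\<lambda>\<epsilon>. \<Sum>\<^sub>\<infinity>m. cinner (E m) ((resolvent D (perturb H0 V) (z + \<i> * of_real \<epsilon>) -
      resolvent D H0 (z + \<i> * of_real \<epsilon>)) (E m))) \<longlongrightarrow>
    (\<Sum>\<^sub>\<infinity>m. cinner (E m) ((resolvent D (perturb H0 V) z - resolvent D H0 z) (E m)))) (at 0)"
proof -
  define R0 where "R0 \<epsilon> = resolvent D H0 (z + \<i> * of_real \<epsilon>)" for \<epsilon>
  define R where "R \<epsilon> = resolvent D (perturb H0 V) (z + \<i> * of_real \<epsilon>)" for \<epsilon>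
  note v0 = self_adjoint_resolvent_vertical[OF H0 z(1,2), folded R0_def]
    and v = self_adjoint_resolvent_vertical[OF H z(1,3), folded R_def]
  have at0: "resolvent D H0 z = R0 0" "resolvent D (perturb H0 V) z = R 0" by (simp_all add: R0_def R_def)
  note tr = resolvent_difference_trace[OF E K J resolves_clinear[OF v(1)] resolves_clinear[OF v0(1)]
      resolvent_difference_kernel[OF V v0(1) v(1)]]
  \<comment> \<open>Tannery majorant: the resolvent norms are largest at eps = 0, and the vectors K
    J E m and K E m are square summable in norm.\<close>
  define b where "b m = norm (R 0) * norm (R0 0) * ((norm (K (J (E m))) ^ 2 + norm (K (E m)) ^ 2) / 2)" for m
  have "summable b"
  proof -
    have KJ: "hs_le (K o\<^sub>L J) (norm J ^ 2 * c)" by (rule hs_le_compose_right[OF E K J(1) order_refl])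
    have "summable (\<lambda>m. norm (K (J (E m))) ^ 2)" "summable (\<lambda>m. norm (K (E m)) ^ 2)"
      using hs_leD(1)[OF KJ projection_id E] hs_leD(1)[OF K projection_id E]
      by (auto intro!: summable_on_imp_summable)
    then show ?thesis unfolding b_def by (intro summable_mult summable_divide summable_add)
  qed
  have bound: "cmod (- cinner (K (J (E m))) (R \<epsilon> (R0 \<epsilon> (K (E m))))) \<le> b m" for m \<epsilon>
    unfolding b_def at0[symmetric]
    by (rule order_trans[OF tr(2)], intro mult_right_mono mult_mono v0(2) v(2)) auto
  have "((\<lambda>\<epsilon>. \<Sum>m. - cinner (K (J (E m))) (R \<epsilon> (R0 \<epsilon> (K (E m))))) \<longlongrightarrow>
      (\<Sum>m. - cinner (K (J (E m))) (R 0 (R0 0 (K (E m)))))) (at 0)"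
  proof (rule tannerys_theorem[THEN conjunct2, THEN conjunct2])
    show "((\<lambda>\<epsilon>. - cinner (K (J (E m))) (R \<epsilon> (R0 \<epsilon> (K (E m))))) \<longlongrightarrow>
        - cinner (K (J (E m))) (R 0 (R0 0 (K (E m))))) (at 0)" for m
      using v0(3) v(3) unfolding at0
      by (intro tendsto_minus cinner.tendsto blinfun.tendsto tendsto_const)
    show "\<forall>\<^sub>F (m, \<epsilon>) in at_top \<times>\<^sub>F at 0. norm (- cinner (K (J (E m))) (R \<epsilon> (R0 \<epsilon> (K (E m))))) \<le> b m"
      using bound by (intro always_eventually) auto
  qed (use \<open>summable b\<close> in auto)
  then show ?thesis
    unfolding at0 R0_def[symmetric] R_def[symmetric] tr(1) .
qed

theorem theorem3p7:
  fixes D :: "'a::{complex_hilbert_space, second_countable_topology} set"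
    and H0 H :: "'a \<Rightarrow> 'a"
    and J K V :: "'a oper"
    and \<Xi>p \<Xi>m :: "real \<Rightarrow> 'a oper"
    and \<xi> :: "real \<Rightarrow> real"
  assumes "self_adjoint_on D H0"
    and "clinear_op J" and "adj J = J" and "J o\<^sub>L J = id_blinfun"
    and "hilbert_schmidt K"
    and "V = K o\<^sub>L J o\<^sub>L adj K"
    and "H = perturb H0 V"
    and "Xi_plus D H0 J K \<Xi>p"
    and "Xi_minus D H0 J K \<Xi>m"
    and "AE t in lebesgue. complex_of_real (\<xi> t) =
           op_trace (J_plus J) (\<Xi>p t) - op_trace (J_minus J) (\<Xi>m t)"
  shows "\<forall>z. z \<notin> spec D H0 \<union> spec D H \<longrightarrow>
    trace_class id_blinfun (resolvent D H z - resolvent D H0 z) \<and>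
    (z \<notin> \<real> \<longrightarrow> integrable lebesgue (\<lambda>t. \<xi> t / (complex_of_real t - z)\<^sup>2)) \<and>
    (integrable lebesgue (\<lambda>t. \<xi> t / (complex_of_real t - z)\<^sup>2) \<longrightarrow>
      op_trace id_blinfun (resolvent D H z - resolvent D H0 z) =
        - (LINT t|lebesgue. \<xi> t / (complex_of_real t - z)\<^sup>2)) \<and>
    (z \<in> \<real> \<longrightarrow>
      ((\<lambda>\<epsilon>::real. - (LINT t|lebesgue. \<xi> t / (complex_of_real t - (z + \<i> * \<epsilon>))\<^sup>2))
        \<longlongrightarrow> op_trace id_blinfun (resolvent D H z - resolvent D H0 z)) (at 0))"
proof -
  let ?f = "\<lambda>z t. complex_of_real (\<xi> t) / (of_real t - z)\<^sup>2"
  let ?d = "\<lambda>z. resolvent D H z - resolvent D H0 z"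
  let ?tr = "\<lambda>z. op_trace id_blinfun (?d z)"
  note sa0 = assms(1) and J = assms(2-4)
  define Pp Pm where "Pp = J_plus J" and "Pm = J_minus J"
  have P_apply: "Pp x = (1/2) *\<^sub>R (x + J x)" "Pm x = (1/2) *\<^sub>R (x - J x)" for x
    by (simp_all add: Pp_def Pm_def J_plus_def J_minus_def blinfun.scaleR_left blinfun.add_left blinfun.diff_left)
  have JJ: "J (J x) = x" for x by (rule blinfun_compose_idD[OF J(3)])
  have P_lin: "clinear_op Pp" "clinear_op Pm"
    unfolding Pp_def Pm_def J_plus_def J_minus_def using J(1) by blast+
  have "J (Pp x) = Pp x" "J (Pm x) = - Pm x" for x
    by (simp_all add: P_apply blinfun.scaleR_right blinfun.add_right blinfun.diff_right JJ add.commute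
        flip: scaleR_minus_right)
  then have "Pp (Pp x) = Pp x" "Pm (Pm x) = Pm x" for x
    by (simp_all add: P_apply(1)[of "Pp x"] P_apply(2)[of "Pm x"])
  then have idem: "Pp o\<^sub>L Pp = Pp" "Pm o\<^sub>L Pm = Pm" by (auto intro: blinfun_eqI)
  have adjP: "adj Pp = Pp" "adj Pm = Pm"
    unfolding Pp_def Pm_def J_plus_def J_minus_def using J
    by (simp_all add: adj_scaleR adj_add adj_diff clinear_add clinear_diff)
  have proj: "projection Pp" "projection Pm"
    by (simp_all add: projection_def P_lin idem adjP)
  obtain B where B: "is_onb UNIV B" "(\<lambda>e. norm (K e) ^ 2) summable_on B" and clK: "clinear_op K"
    using assms(5) by (auto simp: hilbert_schmidt_def)
  have ran_id: "range (blinfun_apply (id_blinfun :: 'a oper)) = UNIV" by simp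
  have ex_id: "\<exists>B. is_onb (range (blinfun_apply (id_blinfun :: 'a oper))) B" using B ran_id by metis
  define E where "E = trace_seq (id_blinfun :: 'a oper)"
  have E: "frame (id_blinfun :: 'a oper) E" unfolding E_def by (rule frame_trace_seq[OF projection_id ex_id])
  have op_tr: "op_trace id_blinfun T = (\<Sum>\<^sub>\<infinity>m. cinner (E m) (T (E m)))" for T
    unfolding E_def by (rule op_trace_eq[OF projection_id ex_id])
  obtain c where K: "hs_le K c"
  proof -
    have B': "frame (id_blinfun :: 'a oper) (padded_seq B)"
      by (rule frame_onb) (use B ran_id in simp_all)
    have "(\<lambda>n. norm (K (padded_seq B n)) ^ 2) summable_on UNIV"
      using B(2) unfolding summable_on_def
      by (subst has_sum_padded_seq[where f = "\<lambda>e. norm (K e) ^ 2"]) (simp_all add: onb_countable[OF B(1)])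
    then show thesis using hs_leI[OF B' clK] that by blast
  qed
  have LP: "(K o\<^sub>L Pp) o\<^sub>L Pp = K o\<^sub>L Pp" "(K o\<^sub>L Pm) o\<^sub>L Pm = K o\<^sub>L Pm"
    by (rule blinfun_eqI, simp add: projection_idem proj)+
  have adjL: "adj (K o\<^sub>L Pp) = Pp o\<^sub>L adj K" "adj (K o\<^sub>L Pm) = Pm o\<^sub>L adj K"
    using proj by (simp_all add: adj_compose clK P_lin projection_def)
  \<comment> \<open>First step, from \<open>H0\<close> to H_+. As Pp is idempotent, (K Pp)(Pp adj K)
    is the positive part of the perturbation.\<close>
  interpret plus: definite_perturbation D H0 Pp "K o\<^sub>L Pp" 1 "norm Pp ^ 2 * c" E
    using sa0 proj(1) hs_le_compose_right[OF E K P_lin(1) order_refl] LP(1) E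
    by unfold_locales auto
  have plus_A1: "plus.A1 = H_plus H0 J K"
    unfolding plus.A1_def H_plus_def adjL Pp_def[symmetric]
    by (rule arg_cong[where f = "perturb H0"], rule blinfun_eqI) (simp add: projection_idem[OF proj(1)])
  have sa_plus: "self_adjoint_on D (H_plus H0 J K)" using plus.sa1 by (simp only: plus_A1)
  \<comment> \<open>Second step, from H_+ to \<open>H\<close>: subtracting K Pm (adj K) completes
    the perturbation to \<open>V\<close> because Pp - Pm = J.\<close>
  interpret minus: definite_perturbation D "H_plus H0 J K" Pm "K o\<^sub>L Pm" "-1" "norm Pm ^ 2 * c" E
    using sa_plus proj(2) hs_le_compose_right[OF E K P_lin(2) order_refl] LP(2) E
    by unfold_locales auto
  have "Pp x - Pm x = J x" for x
  proof -
    have "Pp x - Pm x = (1/2) *\<^sub>R ((x + J x) - (x - J x))" by (simp only: P_apply scaleR_diff_right)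
    then show ?thesis by simp
  qed
  then have KJ: "K (Pp x) - K (Pm x) = K (J x)" for x by (simp flip: blinfun.diff_right)
  have "minus.A1 = perturb (H_plus H0 J K) ((-1) *\<^sub>R ((K o\<^sub>L Pm) o\<^sub>L (Pm o\<^sub>L adj K)))"
    by (simp only: minus.A1_def adjL)
  also have "\<dots> = H"
    unfolding assms(6,7) H_plus_def perturb_def Pp_def[symmetric]
    by (rule ext) (simp add: projection_idem[OF proj(2)] blinfun.minus_left KJ[symmetric])
  finally have minus_A1: "minus.A1 = H" .
  have sa_H: "self_adjoint_on D H" using minus.sa1 by (simp only: minus_A1)
  have Phi_p: "Phi_plus D H0 J K z = Pp + plus.G z" for z
    by (rule blinfun_eqI) (simp add: Phi_plus_def Pp_def[symmetric] plus.G_def adjL blinfun.add_left)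
  have Phi_m: "Phi_tilde_minus D H0 J K z = Pm + minus.G z" for z
    by (rule blinfun_eqI) (simp add: Phi_tilde_minus_def Pm_def[symmetric] minus.G_def adjL
        blinfun.add_left blinfun.diff_left blinfun.minus_left)
  have fam_p: "shift_family Pp (complex_of_real 1) (\<lambda>z. log_in Pp (Pp + plus.G z)) \<Xi>p"
    using assms(8) by (simp add: Xi_plus_def Pp_def[symmetric] Phi_p)
  have fam_m: "shift_family Pm (complex_of_real (-1)) (\<lambda>z. log_in Pm (Pm + minus.G z)) \<Xi>m"
    using assms(9) by (simp add: Xi_minus_def Pm_def[symmetric] Phi_m)
  define \<theta>p \<theta>m where "\<theta>p t = trace_norm Pp (\<Xi>p t)" and "\<theta>m t = trace_norm Pm (\<Xi>m t)" for t
  define k where "k z t = 1 / (complex_of_real t - z)\<^sup>2" for z t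
  let ?p = "\<lambda>z t. complex_of_real (\<theta>p t) * k z t" and ?m = "\<lambda>z t. complex_of_real (\<theta>m t) * k z t"
  have \<xi>: "AE t in lebesgue. ?p z t - ?m z t = ?f z t" for z
    using assms(10) plus.AE_trace[OF fam_p refl] minus.AE_trace[OF fam_m refl]
  proof eventually_elim
    case (elim t)
    then have "complex_of_real (\<xi> t) = complex_of_real (\<theta>p t) - complex_of_real (\<theta>m t)"
      by (simp add: \<theta>p_def \<theta>m_def Pp_def[symmetric] Pm_def[symmetric])
    then show ?case by (simp add: k_def diff_divide_distrib)
  qed
  have nonreal: "integrable lebesgue (?f z) \<and> ?tr z = - integral\<^sup>L lebesgue (?f z)" if z: "Im z \<noteq> 0" for z
  proof -
    have int: "integrable lebesgue (?p z)"
      "integrable lebesgue (?m z)"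
      using plus.\<theta>_kernel(1)[OF fam_p refl z] minus.\<theta>_kernel(1)[OF fam_m refl z]
      by (simp_all add: \<theta>p_def \<theta>m_def k_def)
    have int_diff: "integrable lebesgue (\<lambda>t. ?p z t - ?m z t)"
      by (intro Bochner_Integration.integrable_diff int)
    \<comment> \<open>Measurability of xi is not a hypothesis; it comes from almost-everywhere
      equality, Lebesgue measure being complete.\<close>
    have meas: "?f z \<in> borel_measurable lebesgue"
      by (rule borel_measurable_AE[OF borel_measurable_integrable[OF int_diff] \<xi>])
    have 1: "integrable lebesgue (?f z)"
      by (rule integrable_cong_AE_imp[OF int_diff meas]) (use \<xi>[of z] in auto)
    have "integral\<^sup>L lebesgue (?f z) =
        (LINT t|lebesgue. ?p z t - ?m z t)"
      by (rule integral_cong_AE[OF meas borel_measurable_integrable[OF int_diff]]) (use \<xi>[of z] in auto)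
    also have "\<dots> = integral\<^sup>L lebesgue (?p z) - integral\<^sup>L lebesgue (?m z)"
      by (rule Bochner_Integration.integral_diff[OF int])
    finally have 2: "integral\<^sup>L lebesgue (?f z) =
      integral\<^sup>L lebesgue (?p z) - integral\<^sup>L lebesgue (?m z)" .
    \<comment> \<open>The resolvent of H_+ cancels when the two steps are added.\<close>
    have "((\<lambda>m. cinner (E m) ((resolvent D (H_plus H0 J K) z - resolvent D H0 z) (E m)) +
        cinner (E m) ((resolvent D H z - resolvent D (H_plus H0 J K) z) (E m))) has_sum
      (- complex_of_real 1 * integral\<^sup>L lebesgue (?p z) +
       (- complex_of_real (-1) * integral\<^sup>L lebesgue (?m z)))) UNIV"
      using plus.trace_formula_nonreal[OF fam_p refl z] minus.trace_formula_nonreal[OF fam_m refl z]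
      unfolding plus_A1 minus_A1 \<theta>p_def \<theta>m_def k_def by (rule has_sum_add)
    then have "((\<lambda>m. cinner (E m) ((?d z) (E m))) has_sum - integral\<^sup>L lebesgue (?f z)) UNIV"
      by (simp add: 2 blinfun.diff_left cinner.diff_right)
    then have "?tr z = - integral\<^sup>L lebesgue (?f z)"
      unfolding op_tr by (rule infsumI)
    with 1 show ?thesis by blast
  qed
  show ?thesis
  proof (intro allI impI)
    fix z assume "z \<notin> spec D H0 \<union> spec D H"
    then have z: "z \<notin> spec D H0" "z \<notin> spec D H" by auto
    note res = resolvent_resolves[OF sa0 z(1)] resolvent_resolves[OF sa_H z(2), unfolded assms(7)]
    have JK: "hs_le (J o\<^sub>L adj K) (norm J ^ 2 * c)"
      by (rule hs_le_compose_left[OF hs_le_adj[OF E K] J(1) order_refl])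
    have tc: "trace_class id_blinfun (?d z)"
      unfolding assms(7) resolvent_difference_kernel[OF assms(6) res]
      by (rule trace_class_product[OF B(1) hs_le_uminus_compose[OF K resolves_clinear[OF res(1)]]
            hs_le_compose_right[OF E JK resolves_clinear[OF res(2)] order_refl]])
    \<comment> \<open>All points z + i eps with eps nonzero are nonreal, so the formula already
      proved rewrites the traces as integrals.\<close>
    have lim: "((\<lambda>\<epsilon>::real. - integral\<^sup>L lebesgue (?f (z + \<i> * \<epsilon>))) \<longlongrightarrow> ?tr z) (at 0)" if real: "z \<in> \<real>"
    proof (rule Lim_transform_eventually)
      show "((\<lambda>\<epsilon>::real. ?tr (z + \<i> * \<epsilon>)) \<longlongrightarrow> ?tr z) (at 0)"
        unfolding op_tr assms(7)
        by (rule resolvent_difference_trace_limit[OF E K J(1,2) sa0 assms(6) sa_H[unfolded assms(7)] real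
              z(1) z(2)[unfolded assms(7)]])
      have "Im z = 0" using real by (simp add: complex_is_Real_iff)
      then show "\<forall>\<^sub>F \<epsilon>::real in at 0. ?tr (z + \<i> * \<epsilon>) = - integral\<^sup>L lebesgue (?f (z + \<i> * \<epsilon>))"
        unfolding eventually_at_filter by (intro always_eventually allI impI) (simp add: nonreal)
    qed
    have "?tr z = - integral\<^sup>L lebesgue (?f z)"
      if int: "integrable lebesgue (?f z)"
    proof (cases "z \<in> \<real>")
      case False
      then show ?thesis using nonreal by (auto simp: complex_is_Real_iff)
    next
      case True
      then have Imz: "Im z = 0" by (simp add: complex_is_Real_iff)
      define \<epsilon> where "\<epsilon> n = inverse (real (Suc n))" for n
      have \<epsilon>0: "\<epsilon> \<longlonglongrightarrow> 0" unfolding \<epsilon>_def by (rule LIMSEQ_inverse_real_of_nat)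
      have \<epsilon>_pos: "\<epsilon> n > 0" for n by (simp add: \<epsilon>_def)
      define f where "f n t = complex_of_real (\<xi> t) / (of_real t - (z + \<i> * \<epsilon> n))\<^sup>2" for n t
      have "filterlim \<epsilon> (at 0) sequentially"
        using \<epsilon>0 \<epsilon>_pos by (intro filterlim_atI) (auto intro!: always_eventually simp: less_imp_neq[symmetric])
      from filterlim_compose[OF lim[OF True] this]
      have lim1: "(\<lambda>n. - (LINT t|lebesgue. f n t)) \<longlonglongrightarrow> ?tr z"
        by (simp add: f_def)
      \<comment> \<open>For real z one has |t - z| <= |t - z - i eps|, so the integrand at
        \<open>z\<close>, integrable by assumption, is itself the majorant.\<close>
      have "(\<lambda>n. LINT t|lebesgue. f n t) \<longlonglongrightarrow> integral\<^sup>L lebesgue (?f z)"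
      proof (rule integral_dominated_convergence)
        show "?f z \<in> borel_measurable lebesgue"
          by (rule borel_measurable_integrable[OF int])
        show "f n \<in> borel_measurable lebesgue" for n
          using nonreal[of "z + \<i> * \<epsilon> n"] \<epsilon>_pos[of n] unfolding f_def
          by (intro borel_measurable_integrable) (simp add: Imz)
        show "integrable lebesgue (\<lambda>t. cmod (?f z t))"
          by (rule integrable_norm[OF int])
        \<comment> \<open>At t = Re z the integrand at \<open>z\<close> has the default value 0 of
          division by zero, so convergence and domination may fail there; a single point is
          negligible.\<close>
        have "{Re z} \<in> null_sets lebesgue" by (rule finite_imp_null_set_lborel[THEN null_sets_completionI]) simp
        then have ne: "AE t in lebesgue. t \<noteq> Re z" by (rule AE_not_in[THEN AE_mp]) simp
        have zr: "z = complex_of_real (Re z)" using Imz by (simp add: complex_eq_iff)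
        show "AE t in lebesgue. (\<lambda>n. f n t) \<longlonglongrightarrow> ?f z t"
          using ne
        proof eventually_elim
          case (elim t)
          have nz: "of_real t - z \<noteq> 0" using elim by (auto simp: complex_eq_iff)
          have "(\<lambda>n. f n t) \<longlonglongrightarrow> complex_of_real (\<xi> t) / (of_real t - (z + \<i> * of_real 0))\<^sup>2"
            unfolding f_def by (intro tendsto_intros \<epsilon>0) (use nz in simp)
          then show ?case by simp
        qed
        show "AE t in lebesgue. cmod (f n t) \<le> cmod (?f z t)" for n
          using ne
        proof eventually_elim
          case (elim t)
          have "cmod (of_real t - z) = \<bar>Re (of_real t - (z + \<i> * \<epsilon> n))\<bar>"
            by (subst zr) (simp flip: of_real_diff)
          also have "\<dots> \<le> cmod (of_real t - (z + \<i> * \<epsilon> n))" by (rule abs_Re_le_cmod)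
          finally have le: "cmod (of_real t - z) ^ 2 \<le> cmod (of_real t - (z + \<i> * \<epsilon> n)) ^ 2"
            by (intro power_mono) auto
          have pos: "0 < cmod (of_real t - z) ^ 2" using elim by (auto simp: complex_eq_iff)
          show ?case
            unfolding f_def norm_divide norm_power
            by (rule divide_left_mono[OF le norm_ge_zero mult_pos_pos[OF less_le_trans[OF pos le] pos]])
        qed
      qed
      from LIMSEQ_unique[OF lim1 tendsto_minus[OF this]] show ?thesis .
    qed
    with tc lim nonreal show "trace_class id_blinfun (?d z) \<and>
      (z \<notin> \<real> \<longrightarrow> integrable lebesgue (?f z)) \<and>
      (integrable lebesgue (?f z) \<longrightarrow> ?tr z = - integral\<^sup>L lebesgue (?f z)) \<and>
      (z \<in> \<real> \<longrightarrow>
        ((\<lambda>\<epsilon>::real. - integral\<^sup>L lebesgue (?f (z + \<i> * \<epsilon>))) \<longlongrightarrow> ?tr z) (at 0))"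
      by (auto simp: complex_is_Real_iff)
  qed
qed

end
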